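(* If $\mathbb{D}$ is a stable derivator and $M$ is a cocontinuous monad on $\mathbb{D}$, then the prederivator $M\text{-}\mathbf{Mod}_{\mathbb{D}}$ of levelwise $M$-modules is also a stable derivator.
   Context: $\mathbf{Cat}$ is the $2$-category of small categories and $\mathbf{CAT}$ the $2$-category of all categories. A diagram category $\mathbf{Dia}$ is a full $2$-subcategory of $\mathbf{Cat}$ that: contains all finite posets; is closed under pullbacks and finite coproducts; contains the slices $J_{/j}$ and $J_{j/}$ for $J\in\mathbf{Dia}$, $j\in J$; is closed under $J\mapsto J^{\mathrm{op}}$; and contains $J$ whenever there is a Grothendieck fibration $u:J\to K$ with $K$ and all fibers $J_k$ in $\mathbf{Dia}$. A diagram category $\mathbf{Dia}$ is fixed; all prederivators have domain $\mathbf{Dia}$. $\mathbf{Dia}^{\mathrm{op}}$ is obtained by reversing $1$-cells only. A prederivator is a strict $2$-functor $\mathbb{D}:\mathbf{Dia}^{\mathrm{op}}\to\mathbf{CAT}$; one writes $u^*$, $\alpha^*$ for the images of a functor $u$ and a natural transformation $\alpha$. $e$ is the terminal category; an object $j\in J$ is viewed as a functor $j:e\to J$. $\mathbf{PDer}$ is the $2$-category of prederivators. A $1$-cell $F:\mathbb{D}\to\mathbb{E}$ is a pseudonatural transformation: functors $F_J:\mathbb{D}(J)\to\mathbb{E}(J)$ for $J\in\mathbf{Dia}$ and natural isomorphisms $\gamma^F_u:u^*F_K\to F_Ju^*$ for $u:J\to K$, with $\gamma^F_{1_J}=1_{F_J}$, $\gamma^F_{vu}=\gamma^F_uv^*\circ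 u^*\gamma^F_v$, and $\gamma^F_v\circ\alpha^*F_K=F_J\alpha^*\circ\gamma^F_u$ for $\alpha:u\Rightarrow v$. Composition has $\gamma^{GF}_u=G_J\gamma^F_u\circ\gamma^G_uF_K$. A $2$-cell $\rho:F\to G$ is a modification: natural transformations $\rho_J:F_J\Rightarrow G_J$ with $\gamma^G_u\circ u^*\rho_K=\rho_Ju^*\circ\gamma^F_u$ for all $u:J\to K$. A monad on $\mathbb{D}$ is a monad $(M,\mu,\mathbb{S})$ in the $2$-category $\mathbf{PDer}$; so $(M_J,\mu_J,\mathbb{S}_J)$ is a monad on $\mathbb{D}(J)$ for each $J$. The prederivator $M\text{-}\mathbf{Mod}_{\mathbb{D}}$ has value at $J$ the Eilenberg-Moore category $M_J\text{-}\mathbf{Mod}_{\mathbb{D}(J)}$ of modules $(X,\lambda:M_JX\to X)$ and $M_J$-linear maps. For $u:J\to K$, the pullback $\overline{u^*}$ sends $(X,\lambda)$ to $(u^*X,\,u^*\lambda\circ(\gamma^M_u)^{-1}_X)$ and $f$ to $u^*f$; for $\alpha:u\Rightarrow v$, $\overline{\alpha^*}$ has component $\alpha^*_X$ at $(X,\lambda)$. A derivator is a prederivator $\mathbb{D}$ satisfying: (Der1) For any finite family $\{J_i\}$ in $\mathbf{Dia}$, the functor $\mathbb{D}(\coprod J_i)\to\prod\mathbb{D}(J_i)$ induced by the inclusions is an equivalence. (Der2) For any $J\in\mathbf{Dia}$, a morphism $f$ in $\mathbb{D}(J)$ is an isomorphism if and only if $j^*f$ is an isomorphism in $\mathbb{D}(e)$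 for all $j\in J$. (Der3L, Der3R) For every functor $u:J\to K$ in $\mathbf{Dia}$, $u^*:\mathbb{D}(K)\to\mathbb{D}(J)$ has a right adjoint $u_*$ and a left adjoint $u_!$. (Der4L) For every $u:J\to K$ in $\mathbf{Dia}$ and $k\in K$, let $J_{k/}$ be the category of pairs $(j,a:k\to u(j))$, with $\mathrm{pr}:J_{k/}\to J$, $\pi:J_{k/}\to e$, and $\alpha:k\pi\Rightarrow u\,\mathrm{pr}$ with component $a$ at $(j,a)$. Then the mate $k^*u_*\xrightarrow{\eta}\pi_*\pi^*k^*u_*\xrightarrow{\pi_*\alpha^*u_*}\pi_*\mathrm{pr}^*u^*u_*\xrightarrow{\varepsilon}\pi_*\mathrm{pr}^*$ is an isomorphism. (Der4R) For every $u:J\to K$ in $\mathbf{Dia}$ and $k\in K$, let $J_{/k}$ be the category of pairs $(j,a:u(j)\to k)$, with $\mathrm{pr}:J_{/k}\to J$, $\pi:J_{/k}\to e$, and $\alpha:u\,\mathrm{pr}\Rightarrow k\pi$ with component $a$ at $(j,a)$. Then the mate $\pi_!\mathrm{pr}^*\xrightarrow{\eta}\pi_!\mathrm{pr}^*u^*u_!\xrightarrow{\pi_!\alpha^*u_!}\pi_!\pi^*k^*u_!\xrightarrow{\varepsilon}k^*u_!$ is an isomorphism. A monad $M$ on a derivator $\mathbb{D}$ is cocontinuous if for every $u:J\to K$ in $\mathbf{Dia}$ the mate $$u_!M_J\xrightarrow{u_!M_J\eta}u_!M_Ju^*u_!\xrightarrow{u_!(\gamma^M_u)^{-1}u_!}u_!u^*M_Ku_!\xrightarrow{\varepsilon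 M_Ku_!}M_Ku_!$$ is an isomorphism. Let $\square$ be the poset $\{0,1\}\times\{0,1\}$ (the commutative square), $i_{\ulcorner}:\ulcorner\to\square$ the full subcategory omitting $(1,1)$ and $i_{\lrcorner}:\lrcorner\to\square$ the full subcategory omitting $(0,0)$. An object of $\mathbb{D}(\square)$ is cocartesian if it lies in the essential image of $(i_{\ulcorner})_!:\mathbb{D}(\ulcorner)\to\mathbb{D}(\square)$, and cartesian if it lies in the essential image of $(i_{\lrcorner})_*:\mathbb{D}(\lrcorner)\to\mathbb{D}(\square)$. A derivator $\mathbb{D}$ is stable if it is pointed (i.e. $\mathbb{D}(J)$ has a zero object for every $J\in\mathbf{Dia}$) and an object of $\mathbb{D}(\square)$ is cocartesian if and only if it is cartesian. (Strongness is not part of the definition of stable.) *)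

theory Defs
  imports Main "HOL-Library.FuncSet"
begin

section \<open>Categories, functors, natural transformations\<close>

text \<open>
  Functors and natural transformations carry their source and target, and their underlying
  functions are extensional (equal to \<^const>\<open>undefined\<close> off the carriers). Hence equality in HOL
  is equality of functors and of transformations, as the strict 2-functor axioms require.
\<close>

record ('o, 'a) cat =
  Obj :: "'o set"
  Arr :: "'a set"
  Dom :: "'a \<Rightarrow> 'o"
  Cod :: "'a \<Rightarrow> 'o"
  Ide :: "'o \<Rightarrow> 'a"
  Comp :: "'a \<Rightarrow> 'a \<Rightarrow> 'a"

definition hom :: "('o, 'a) cat \<Rightarrow> 'o \<Rightarrow> 'o \<Rightarrow> 'a set" where
  "hom C x y = {f \<in> Arr C. Dom C f = x \<and> Cod C f = y}"

locale category =
  fixes C :: "('o, 'a) cat"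
  assumes dom_obj: "f \<in> Arr C \<Longrightarrow> Dom C f \<in> Obj C"
    and cod_obj: "f \<in> Arr C \<Longrightarrow> Cod C f \<in> Obj C"
    and ide_hom: "x \<in> Obj C \<Longrightarrow> Ide C x \<in> hom C x x"
    and comp_hom: "f \<in> hom C x y \<Longrightarrow> g \<in> hom C y z \<Longrightarrow> Comp C g f \<in> hom C x z"
    and ide_left: "f \<in> hom C x y \<Longrightarrow> Comp C (Ide C y) f = f"
    and ide_right: "f \<in> hom C x y \<Longrightarrow> Comp C f (Ide C x) = f"
    and comp_assoc: "f \<in> hom C w x \<Longrightarrow> g \<in> hom C x y \<Longrightarrow> h \<in> hom C y z
          \<Longrightarrow> Comp C h (Comp C g f) = Comp C (Comp C h g) f"

definition is_inverse :: "('o, 'a) cat \<Rightarrow> 'a \<Rightarrow> 'a \<Rightarrow> bool" where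
  "is_inverse C f g \<longleftrightarrow> f \<in> Arr C \<and> g \<in> hom C (Cod C f) (Dom C f) \<and>
     Comp C g f = Ide C (Dom C f) \<and> Comp C f g = Ide C (Cod C f)"

definition is_iso :: "('o, 'a) cat \<Rightarrow> 'a \<Rightarrow> bool" where
  "is_iso C f \<longleftrightarrow> (\<exists>g. is_inverse C f g)"

definition inv_arr :: "('o, 'a) cat \<Rightarrow> 'a \<Rightarrow> 'a" where
  "inv_arr C f = (THE g. is_inverse C f g)"

definition iso_objs :: "('o, 'a) cat \<Rightarrow> 'o \<Rightarrow> 'o \<Rightarrow> bool" where
  "iso_objs C x y \<longleftrightarrow> (\<exists>f \<in> hom C x y. is_iso C f)"

definition zero_object :: "('o, 'a) cat \<Rightarrow> 'o \<Rightarrow> bool" where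
  "zero_object C z \<longleftrightarrow> z \<in> Obj C \<and>
     (\<forall>x \<in> Obj C. (\<exists>!f. f \<in> hom C z x) \<and> (\<exists>!f. f \<in> hom C x z))"

record ('o, 'a, 'p, 'b) fnct =
  Src :: "('o, 'a) cat"
  Tgt :: "('p, 'b) cat"
  FO :: "'o \<Rightarrow> 'p"
  FA :: "'a \<Rightarrow> 'b"

definition is_functor :: "('o, 'a, 'p, 'b) fnct \<Rightarrow> bool" where
  "is_functor F \<longleftrightarrow> category (Src F) \<and> category (Tgt F) \<and>
     FO F \<in> Obj (Src F) \<rightarrow>\<^sub>E Obj (Tgt F) \<and>
     FA F \<in> Arr (Src F) \<rightarrow>\<^sub>E Arr (Tgt F) \<and>
     (\<forall>f \<in> Arr (Src F). Dom (Tgt F) (FA F f) = FO F (Dom (Src F) f) \<and>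
                         Cod (Tgt F) (FA F f) = FO F (Cod (Src F) f)) \<and>
     (\<forall>x \<in> Obj (Src F). FA F (Ide (Src F) x) = Ide (Tgt F) (FO F x)) \<and>
     (\<forall>f \<in> Arr (Src F). \<forall>g \<in> Arr (Src F). Cod (Src F) f = Dom (Src F) g \<longrightarrow>
        FA F (Comp (Src F) g f) = Comp (Tgt F) (FA F g) (FA F f))"

definition functor_between ::
    "('o, 'a, 'p, 'b) fnct \<Rightarrow> ('o, 'a) cat \<Rightarrow> ('p, 'b) cat \<Rightarrow> bool" where
  "functor_between F C D \<longleftrightarrow> is_functor F \<and> Src F = C \<and> Tgt F = D"

definition id_functor :: "('o, 'a) cat \<Rightarrow> ('o, 'a, 'o, 'a) fnct" where
  "id_functor C = \<lparr>Src = C, Tgt = C, FO = (\<lambda>x \<in> Obj C. x), FA = (\<lambda>f \<in> Arr C. f)\<rparr>"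

definition comp_functor ::
    "('p, 'b, 'q, 'c) fnct \<Rightarrow> ('o, 'a, 'p, 'b) fnct \<Rightarrow> ('o, 'a, 'q, 'c) fnct"
    (infixr "\<circ>\<^sub>F" 75) where
  "G \<circ>\<^sub>F F = \<lparr>Src = Src F, Tgt = Tgt G,
     FO = (\<lambda>x \<in> Obj (Src F). FO G (FO F x)), FA = (\<lambda>f \<in> Arr (Src F). FA G (FA F f))\<rparr>"

definition is_cat_iso :: "('o, 'a, 'p, 'b) fnct \<Rightarrow> bool" where
  "is_cat_iso F \<longleftrightarrow> is_functor F \<and> bij_betw (FO F) (Obj (Src F)) (Obj (Tgt F)) \<and>
     bij_betw (FA F) (Arr (Src F)) (Arr (Tgt F))"

definition cat_iso_between ::
    "('o, 'a, 'p, 'b) fnct \<Rightarrow> ('o, 'a) cat \<Rightarrow> ('p, 'b) cat \<Rightarrow> bool" where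
  "cat_iso_between F C D \<longleftrightarrow> is_cat_iso F \<and> Src F = C \<and> Tgt F = D"

record ('o, 'a, 'p, 'b) nattrans =
  NSrc :: "('o, 'a, 'p, 'b) fnct"
  NTgt :: "('o, 'a, 'p, 'b) fnct"
  NC :: "'o \<Rightarrow> 'b"

definition is_nattrans :: "('o, 'a, 'p, 'b) nattrans \<Rightarrow> bool" where
  "is_nattrans \<tau> \<longleftrightarrow>
     is_functor (NSrc \<tau>) \<and> is_functor (NTgt \<tau>) \<and>
     Src (NSrc \<tau>) = Src (NTgt \<tau>) \<and> Tgt (NSrc \<tau>) = Tgt (NTgt \<tau>) \<and>
     NC \<tau> \<in> extensional (Obj (Src (NSrc \<tau>))) \<and>
     (\<forall>x \<in> Obj (Src (NSrc \<tau>)).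
        NC \<tau> x \<in> hom (Tgt (NSrc \<tau>)) (FO (NSrc \<tau>) x) (FO (NTgt \<tau>) x)) \<and>
     (\<forall>f \<in> Arr (Src (NSrc \<tau>)).
        Comp (Tgt (NSrc \<tau>)) (NC \<tau> (Cod (Src (NSrc \<tau>)) f)) (FA (NSrc \<tau>) f) =
        Comp (Tgt (NSrc \<tau>)) (FA (NTgt \<tau>) f) (NC \<tau> (Dom (Src (NSrc \<tau>)) f)))"

definition nattrans_between ::
    "('o, 'a, 'p, 'b) nattrans \<Rightarrow> ('o, 'a, 'p, 'b) fnct \<Rightarrow> ('o, 'a, 'p, 'b) fnct \<Rightarrow> bool" where
  "nattrans_between \<tau> F G \<longleftrightarrow> is_nattrans \<tau> \<and> NSrc \<tau> = F \<and> NTgt \<tau> = G"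

definition is_nat_iso :: "('o, 'a, 'p, 'b) nattrans \<Rightarrow> bool" where
  "is_nat_iso \<tau> \<longleftrightarrow> is_nattrans \<tau> \<and>
     (\<forall>x \<in> Obj (Src (NSrc \<tau>)). is_iso (Tgt (NSrc \<tau>)) (NC \<tau> x))"

definition id_nattrans :: "('o, 'a, 'p, 'b) fnct \<Rightarrow> ('o, 'a, 'p, 'b) nattrans" where
  "id_nattrans F = \<lparr>NSrc = F, NTgt = F, NC = (\<lambda>x \<in> Obj (Src F). Ide (Tgt F) (FO F x))\<rparr>"

definition vcomp ::
    "('o, 'a, 'p, 'b) nattrans \<Rightarrow> ('o, 'a, 'p, 'b) nattrans \<Rightarrow> ('o, 'a, 'p, 'b) nattrans"
    (infixr "\<circ>\<^sub>N" 65) where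
  "\<sigma> \<circ>\<^sub>N \<tau> = \<lparr>NSrc = NSrc \<tau>, NTgt = NTgt \<sigma>,
     NC = (\<lambda>x \<in> Obj (Src (NSrc \<tau>)). Comp (Tgt (NSrc \<tau>)) (NC \<sigma> x) (NC \<tau> x))\<rparr>"

text \<open>Whiskering: \<open>F \<lhd> \<tau>\<close> is $F\tau$ and \<open>\<tau> \<rhd> F\<close> is $\tau F$.\<close>

definition whisker_left ::
    "('p, 'b, 'q, 'c) fnct \<Rightarrow> ('o, 'a, 'p, 'b) nattrans \<Rightarrow> ('o, 'a, 'q, 'c) nattrans"
    (infixr "\<lhd>" 70) where
  "F \<lhd> \<tau> = \<lparr>NSrc = F \<circ>\<^sub>F NSrc \<tau>, NTgt = F \<circ>\<^sub>F NTgt \<tau>,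
     NC = (\<lambda>x \<in> Obj (Src (NSrc \<tau>)). FA F (NC \<tau> x))\<rparr>"

definition whisker_right ::
    "('p, 'b, 'q, 'c) nattrans \<Rightarrow> ('o, 'a, 'p, 'b) fnct \<Rightarrow> ('o, 'a, 'q, 'c) nattrans"
    (infixl "\<rhd>" 72) where
  "\<tau> \<rhd> F = \<lparr>NSrc = NSrc \<tau> \<circ>\<^sub>F F, NTgt = NTgt \<tau> \<circ>\<^sub>F F,
     NC = (\<lambda>x \<in> Obj (Src F). NC \<tau> (FO F x))\<rparr>"

definition inv_nattrans :: "('o, 'a, 'p, 'b) nattrans \<Rightarrow> ('o, 'a, 'p, 'b) nattrans" where
  "inv_nattrans \<tau> = \<lparr>NSrc = NTgt \<tau>, NTgt = NSrc \<tau>,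
     NC = (\<lambda>x \<in> Obj (Src (NSrc \<tau>)). inv_arr (Tgt (NSrc \<tau>)) (NC \<tau> x))\<rparr>"

text \<open>\<open>L\<close> is left adjoint to \<open>R\<close> with unit \<open>\<eta>\<close> and counit \<open>\<epsilon>\<close>.\<close>

definition adjunction ::
    "('o, 'a, 'p, 'b) fnct \<Rightarrow> ('p, 'b, 'o, 'a) fnct \<Rightarrow>
     ('o, 'a, 'o, 'a) nattrans \<Rightarrow> ('p, 'b, 'p, 'b) nattrans \<Rightarrow> bool" where
  "adjunction L R \<eta> \<epsilon> \<longleftrightarrow>
     is_functor L \<and> is_functor R \<and> Src R = Tgt L \<and> Tgt R = Src L \<and>
     nattrans_between \<eta> (id_functor (Src L)) (R \<circ>\<^sub>F L) \<and>
     nattrans_between \<epsilon> (L \<circ>\<^sub>F R) (id_functor (Tgt L)) \<and>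
     (\<epsilon> \<rhd> L) \<circ>\<^sub>N (L \<lhd> \<eta>) = id_nattrans L \<and>
     (R \<lhd> \<epsilon>) \<circ>\<^sub>N (\<eta> \<rhd> R) = id_nattrans R"

definition is_equivalence :: "('o, 'a, 'p, 'b) fnct \<Rightarrow> bool" where
  "is_equivalence F \<longleftrightarrow> is_functor F \<and>
     (\<exists>G \<eta> \<epsilon>. functor_between G (Tgt F) (Src F) \<and>
        is_nat_iso \<eta> \<and> NSrc \<eta> = id_functor (Src F) \<and> NTgt \<eta> = G \<circ>\<^sub>F F \<and>
        is_nat_iso \<epsilon> \<and> NSrc \<epsilon> = F \<circ>\<^sub>F G \<and> NTgt \<epsilon> = id_functor (Tgt F))"

definition ess_image :: "('o, 'a, 'p, 'b) fnct \<Rightarrow> 'p set" where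
  "ess_image F = {y \<in> Obj (Tgt F). \<exists>x \<in> Obj (Src F). iso_objs (Tgt F) (FO F x) y}"

section \<open>Constructions on categories\<close>

definition op_cat :: "('o, 'a) cat \<Rightarrow> ('o, 'a) cat" where
  "op_cat C = \<lparr>Obj = Obj C, Arr = Arr C, Dom = Cod C, Cod = Dom C, Ide = Ide C,
     Comp = (\<lambda>g f. Comp C f g)\<rparr>"

definition full_subcat :: "('o, 'a) cat \<Rightarrow> 'o set \<Rightarrow> ('o, 'a) cat" where
  "full_subcat C S = C\<lparr>Obj := Obj C \<inter> S, Arr := {f \<in> Arr C. Dom C f \<in> S \<and> Cod C f \<in> S}\<rparr>"

definition full_incl :: "('o, 'a) cat \<Rightarrow> 'o set \<Rightarrow> ('o, 'a, 'o, 'a) fnct" where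
  "full_incl C S = \<lparr>Src = full_subcat C S, Tgt = C,
     FO = (\<lambda>x \<in> Obj (full_subcat C S). x), FA = (\<lambda>f \<in> Arr (full_subcat C S). f)\<rparr>"

definition fiber :: "('o, 'a, 'p, 'b) fnct \<Rightarrow> 'p \<Rightarrow> ('o, 'a) cat" where
  "fiber u k = (Src u)\<lparr>Obj := {x \<in> Obj (Src u). FO u x = k},
     Arr := {f \<in> Arr (Src u). FA u f = Ide (Tgt u) k}\<rparr>"

definition cartesian_arrow :: "('o, 'a, 'p, 'b) fnct \<Rightarrow> 'a \<Rightarrow> bool" where
  "cartesian_arrow u g \<longleftrightarrow> g \<in> Arr (Src u) \<and>
     (\<forall>h \<in> Arr (Src u). \<forall>w \<in> hom (Tgt u) (FO u (Dom (Src u) h)) (FO u (Dom (Src u) g)).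
        Cod (Src u) h = Cod (Src u) g \<and> FA u h = Comp (Tgt u) (FA u g) w \<longrightarrow>
        (\<exists>!l. l \<in> hom (Src u) (Dom (Src u) h) (Dom (Src u) g) \<and>
              FA u l = w \<and> Comp (Src u) g l = h))"

definition grothendieck_fibration :: "('o, 'a, 'p, 'b) fnct \<Rightarrow> bool" where
  "grothendieck_fibration u \<longleftrightarrow> is_functor u \<and>
     (\<forall>y \<in> Obj (Src u). \<forall>f \<in> Arr (Tgt u). Cod (Tgt u) f = FO u y \<longrightarrow>
        (\<exists>g. cartesian_arrow u g \<and> Cod (Src u) g = y \<and> FA u g = f))"

text \<open>Finite posets, viewed as categories.\<close>

definition finite_poset :: "('o, 'a) cat \<Rightarrow> bool" where
  "finite_poset C \<longleftrightarrow> category C \<and> finite (Obj C) \<and>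
     (\<forall>x y f g. f \<in> hom C x y \<and> g \<in> hom C x y \<longrightarrow> f = g) \<and>
     (\<forall>x y f g. f \<in> hom C x y \<and> g \<in> hom C y x \<longrightarrow> x = y)"

definition pullback_cat ::
    "('o, 'a, 'q, 'c) fnct \<Rightarrow> ('p, 'b, 'q, 'c) fnct \<Rightarrow> ('o \<times> 'p, 'a \<times> 'b) cat" where
  "pullback_cat u v = \<lparr>
     Obj = {(x, y). x \<in> Obj (Src u) \<and> y \<in> Obj (Src v) \<and> FO u x = FO v y},
     Arr = {(f, g). f \<in> Arr (Src u) \<and> g \<in> Arr (Src v) \<and> FA u f = FA v g},
     Dom = (\<lambda>(f, g). (Dom (Src u) f, Dom (Src v) g)),
     Cod = (\<lambda>(f, g). (Cod (Src u) f, Cod (Src v) g)),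
     Ide = (\<lambda>(x, y). (Ide (Src u) x, Ide (Src v) y)),
     Comp = (\<lambda>(f', g') (f, g). (Comp (Src u) f' f, Comp (Src v) g' g))\<rparr>"

definition coprod_cat :: "'i set \<Rightarrow> ('i \<Rightarrow> ('o, 'a) cat) \<Rightarrow> ('i \<times> 'o, 'i \<times> 'a) cat" where
  "coprod_cat I J = \<lparr>
     Obj = (SIGMA i:I. Obj (J i)), Arr = (SIGMA i:I. Arr (J i)),
     Dom = (\<lambda>(i, f). (i, Dom (J i) f)), Cod = (\<lambda>(i, f). (i, Cod (J i) f)),
     Ide = (\<lambda>(i, x). (i, Ide (J i) x)),
     Comp = (\<lambda>(i, g) (_, f). (i, Comp (J i) g f))\<rparr>"

definition coprod_incl ::
    "'i set \<Rightarrow> ('i \<Rightarrow> ('o, 'a) cat) \<Rightarrow> 'i \<Rightarrow> ('o, 'a, 'i \<times> 'o, 'i \<times> 'a) fnct" where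
  "coprod_incl I J i = \<lparr>Src = J i, Tgt = coprod_cat I J,
     FO = (\<lambda>x \<in> Obj (J i). (i, x)), FA = (\<lambda>f \<in> Arr (J i). (i, f))\<rparr>"

definition prod_cat :: "'i set \<Rightarrow> ('i \<Rightarrow> ('o, 'a) cat) \<Rightarrow> ('i \<Rightarrow> 'o, 'i \<Rightarrow> 'a) cat" where
  "prod_cat I C = \<lparr>
     Obj = (\<Pi>\<^sub>E i\<in>I. Obj (C i)), Arr = (\<Pi>\<^sub>E i\<in>I. Arr (C i)),
     Dom = (\<lambda>f. \<lambda>i\<in>I. Dom (C i) (f i)), Cod = (\<lambda>f. \<lambda>i\<in>I. Cod (C i) (f i)),
     Ide = (\<lambda>x. \<lambda>i\<in>I. Ide (C i) (x i)),
     Comp = (\<lambda>g f. \<lambda>i\<in>I. Comp (C i) (g i) (f i))\<rparr>"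

definition tuple_functor ::
    "('o, 'a) cat \<Rightarrow> 'i set \<Rightarrow> ('i \<Rightarrow> ('o, 'a, 'p, 'b) fnct) \<Rightarrow>
     ('o, 'a, 'i \<Rightarrow> 'p, 'i \<Rightarrow> 'b) fnct" where
  "tuple_functor C I F = \<lparr>Src = C, Tgt = prod_cat I (\<lambda>i. Tgt (F i)),
     FO = (\<lambda>x \<in> Obj C. \<lambda>i\<in>I. FO (F i) x), FA = (\<lambda>f \<in> Arr C. \<lambda>i\<in>I. FA (F i) f)\<rparr>"

text \<open>
  For $u : J \to K$ and $k \in K$, \<open>coslice_cat u k\<close> is $J_{k/}$ (objects
  $(j, a : k \to u(j))$) and \<open>slice_cat u k\<close> is $J_{/k}$ (objects $(j, a : u(j) \to k)$). An
  arrow is recorded together with its end points.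
\<close>

definition coslice_cat ::
    "('o, 'a, 'p, 'b) fnct \<Rightarrow> 'p \<Rightarrow> ('o \<times> 'b, ('o \<times> 'b) \<times> 'a \<times> ('o \<times> 'b)) cat" where
  "coslice_cat u k = \<lparr>
     Obj = {(j, a). j \<in> Obj (Src u) \<and> a \<in> hom (Tgt u) k (FO u j)},
     Arr = {((j, a), f, (j', a')). j \<in> Obj (Src u) \<and> a \<in> hom (Tgt u) k (FO u j) \<and>
              j' \<in> Obj (Src u) \<and> a' \<in> hom (Tgt u) k (FO u j') \<and>
              f \<in> hom (Src u) j j' \<and> Comp (Tgt u) (FA u f) a = a'},
     Dom = fst, Cod = (\<lambda>(_, _, y). y),
     Ide = (\<lambda>x. (x, Ide (Src u) (fst x), x)),
     Comp = (\<lambda>(_, g, z) (x, f, _). (x, Comp (Src u) g f, z))\<rparr>"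

definition slice_cat ::
    "('o, 'a, 'p, 'b) fnct \<Rightarrow> 'p \<Rightarrow> ('o \<times> 'b, ('o \<times> 'b) \<times> 'a \<times> ('o \<times> 'b)) cat" where
  "slice_cat u k = \<lparr>
     Obj = {(j, a). j \<in> Obj (Src u) \<and> a \<in> hom (Tgt u) (FO u j) k},
     Arr = {((j, a), f, (j', a')). j \<in> Obj (Src u) \<and> a \<in> hom (Tgt u) (FO u j) k \<and>
              j' \<in> Obj (Src u) \<and> a' \<in> hom (Tgt u) (FO u j') k \<and>
              f \<in> hom (Src u) j j' \<and> Comp (Tgt u) a' (FA u f) = a},
     Dom = fst, Cod = (\<lambda>(_, _, y). y),
     Ide = (\<lambda>x. (x, Ide (Src u) (fst x), x)),
     Comp = (\<lambda>(_, g, z) (x, f, _). (x, Comp (Src u) g f, z))\<rparr>"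

text \<open>The projections $J_{k/} \to J$ and $J_{/k} \to J$; the first argument is either of the two.\<close>

definition comma_proj ::
    "('o \<times> 'b, ('o \<times> 'b) \<times> 'a \<times> ('o \<times> 'b)) cat \<Rightarrow> ('o, 'a) cat \<Rightarrow>
     ('o \<times> 'b, ('o \<times> 'b) \<times> 'a \<times> ('o \<times> 'b), 'o, 'a) fnct" where
  "comma_proj P J = \<lparr>Src = P, Tgt = J,
     FO = (\<lambda>x \<in> Obj P. fst x), FA = (\<lambda>f \<in> Arr P. fst (snd f))\<rparr>"

section \<open>Diagram categories\<close>

text \<open>
  A small category is one whose objects and arrows are elements of a type \<^typ>\<open>'u\<close> that plays
  the role of the universe of small sets. The categories constructed above live over other types;
  a diagram category contains them in the sense that it contains an isomorphic copy. (It is closed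
  under isomorphism: an isomorphism is a Grothendieck fibration whose fibers are
  one-element posets.) Being a full 2-subcategory, it is determined by its set of objects.
\<close>

type_synonym 'u small_cat = "('u, 'u) cat"
type_synonym 'u small_functor = "('u, 'u, 'u, 'u) fnct"
type_synonym 'u small_nattrans = "('u, 'u, 'u, 'u) nattrans"

definition has_copy :: "'u small_cat set \<Rightarrow> ('o, 'a) cat \<Rightarrow> bool" where
  "has_copy Dia C \<longleftrightarrow> (\<exists>P \<in> Dia. \<exists>\<phi>. cat_iso_between \<phi> P C)"

locale diagram_category =
  fixes Dia :: "'u small_cat set"
  assumes is_category: "J \<in> Dia \<Longrightarrow> category J"
    and finite_posets: "finite_poset J \<Longrightarrow> J \<in> Dia"
    and pullbacks: "J \<in> Dia \<Longrightarrow> J' \<in> Dia \<Longrightarrow> K \<in> Dia \<Longrightarrow> functor_between u J K \<Longrightarrow>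
          functor_between v J' K \<Longrightarrow> has_copy Dia (pullback_cat u v)"
    and finite_coproducts: "finite (I :: nat set) \<Longrightarrow> (\<And>i. i \<in> I \<Longrightarrow> F i \<in> Dia) \<Longrightarrow>
          has_copy Dia (coprod_cat I F)"
    and slices: "J \<in> Dia \<Longrightarrow> j \<in> Obj J \<Longrightarrow> has_copy Dia (slice_cat (id_functor J) j)"
    and coslices: "J \<in> Dia \<Longrightarrow> j \<in> Obj J \<Longrightarrow> has_copy Dia (coslice_cat (id_functor J) j)"
    and opposites: "J \<in> Dia \<Longrightarrow> op_cat J \<in> Dia"
    and fibrations: "K \<in> Dia \<Longrightarrow> functor_between u J K \<Longrightarrow> grothendieck_fibration u \<Longrightarrow>
          (\<And>k. k \<in> Obj K \<Longrightarrow> fiber u k \<in> Dia) \<Longrightarrow> J \<in> Dia"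

text \<open>The category $e$; the element representing its only object and arrow is immaterial.\<close>

definition one_cat :: "'u small_cat" where
  "one_cat = \<lparr>Obj = {undefined}, Arr = {undefined}, Dom = (\<lambda>_. undefined),
     Cod = (\<lambda>_. undefined), Ide = (\<lambda>_. undefined), Comp = (\<lambda>_ _. undefined)\<rparr>"

definition to_one :: "'u small_cat \<Rightarrow> 'u small_functor" where
  "to_one J = \<lparr>Src = J, Tgt = one_cat,
     FO = (\<lambda>_ \<in> Obj J. undefined), FA = (\<lambda>_ \<in> Arr J. undefined)\<rparr>"

definition point :: "'u small_cat \<Rightarrow> 'u \<Rightarrow> 'u small_functor" where
  "point J j = \<lparr>Src = one_cat, Tgt = J,
     FO = (\<lambda>_ \<in> Obj one_cat. j), FA = (\<lambda>_ \<in> Arr one_cat. Ide J j)\<rparr>"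

section \<open>Prederivators\<close>

text \<open>
  \<open>Val D J\<close> is $\mathbb{D}(J)$, \<open>Pull D u\<close> is $u^*$ and \<open>Pull2 D \<alpha>\<close> is $\alpha^*$. Compatibility
  with horizontal composition of 2-cells is stated in terms of whiskering.
\<close>

record ('u, 'o, 'a) prederivator =
  Val :: "'u small_cat \<Rightarrow> ('o, 'a) cat"
  Pull :: "'u small_functor \<Rightarrow> ('o, 'a, 'o, 'a) fnct"
  Pull2 :: "'u small_nattrans \<Rightarrow> ('o, 'a, 'o, 'a) nattrans"

definition dia_functor :: "'u small_cat set \<Rightarrow> 'u small_functor \<Rightarrow> bool" where
  "dia_functor Dia u \<longleftrightarrow> is_functor u \<and> Src u \<in> Dia \<and> Tgt u \<in> Dia"

definition dia_nattrans :: "'u small_cat set \<Rightarrow> 'u small_nattrans \<Rightarrow> bool" where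
  "dia_nattrans Dia \<alpha> \<longleftrightarrow> is_nattrans \<alpha> \<and> dia_functor Dia (NSrc \<alpha>)"

locale prederivator =
  fixes Dia :: "'u small_cat set" and D :: "('u, 'o, 'a) prederivator"
  assumes val_category: "J \<in> Dia \<Longrightarrow> category (Val D J)"
    and pull_functor: "dia_functor Dia u \<Longrightarrow>
          functor_between (Pull D u) (Val D (Tgt u)) (Val D (Src u))"
    and pull2_nattrans: "dia_nattrans Dia \<alpha> \<Longrightarrow>
          nattrans_between (Pull2 D \<alpha>) (Pull D (NSrc \<alpha>)) (Pull D (NTgt \<alpha>))"
    and pull_id: "J \<in> Dia \<Longrightarrow> Pull D (id_functor J) = id_functor (Val D J)"
    and pull_comp: "dia_functor Dia u \<Longrightarrow> dia_functor Dia v \<Longrightarrow> Tgt u = Src v \<Longrightarrow>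
          Pull D (v \<circ>\<^sub>F u) = Pull D u \<circ>\<^sub>F Pull D v"
    and pull2_id: "dia_functor Dia u \<Longrightarrow> Pull2 D (id_nattrans u) = id_nattrans (Pull D u)"
    and pull2_vcomp: "dia_nattrans Dia \<alpha> \<Longrightarrow> dia_nattrans Dia \<beta> \<Longrightarrow> NTgt \<alpha> = NSrc \<beta> \<Longrightarrow>
          Pull2 D (\<beta> \<circ>\<^sub>N \<alpha>) = Pull2 D \<beta> \<circ>\<^sub>N Pull2 D \<alpha>"
    and pull2_whisker_left: "dia_nattrans Dia \<alpha> \<Longrightarrow> dia_functor Dia v \<Longrightarrow>
          Tgt (NSrc \<alpha>) = Src v \<Longrightarrow> Pull2 D (v \<lhd> \<alpha>) = Pull2 D \<alpha> \<rhd> Pull D v"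
    and pull2_whisker_right: "dia_functor Dia u \<Longrightarrow> dia_nattrans Dia \<beta> \<Longrightarrow>
          Tgt u = Src (NSrc \<beta>) \<Longrightarrow> Pull2 D (\<beta> \<rhd> u) = Pull D u \<lhd> Pull2 D \<beta>"

text \<open>1-cells (pseudonatural transformations) and 2-cells (modifications) of $\mathbf{PDer}$.\<close>

record ('u, 'o, 'a, 'p, 'b) pder_map =
  Cpt :: "'u small_cat \<Rightarrow> ('o, 'a, 'p, 'b) fnct"
  Gam :: "'u small_functor \<Rightarrow> ('o, 'a, 'p, 'b) nattrans"

type_synonym ('u, 'o, 'a, 'p, 'b) pder_2cell = "'u small_cat \<Rightarrow> ('o, 'a, 'p, 'b) nattrans"

definition is_pder_map ::
    "'u small_cat set \<Rightarrow> ('u, 'o, 'a) prederivator \<Rightarrow> ('u, 'p, 'b) prederivator \<Rightarrow>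
     ('u, 'o, 'a, 'p, 'b) pder_map \<Rightarrow> bool" where
  "is_pder_map Dia D E F \<longleftrightarrow>
     (\<forall>J \<in> Dia. functor_between (Cpt F J) (Val D J) (Val E J)) \<and>
     (\<forall>u. dia_functor Dia u \<longrightarrow>
        is_nat_iso (Gam F u) \<and>
        NSrc (Gam F u) = Pull E u \<circ>\<^sub>F Cpt F (Tgt u) \<and>
        NTgt (Gam F u) = Cpt F (Src u) \<circ>\<^sub>F Pull D u) \<and>
     (\<forall>J \<in> Dia. Gam F (id_functor J) = id_nattrans (Cpt F J)) \<and>
     (\<forall>u v. dia_functor Dia u \<and> dia_functor Dia v \<and> Tgt u = Src v \<longrightarrow>
        Gam F (v \<circ>\<^sub>F u) = (Gam F u \<rhd> Pull D v) \<circ>\<^sub>N (Pull E u \<lhd> Gam F v)) \<and>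
     (\<forall>\<alpha>. dia_nattrans Dia \<alpha> \<longrightarrow>
        Gam F (NTgt \<alpha>) \<circ>\<^sub>N (Pull2 E \<alpha> \<rhd> Cpt F (Tgt (NSrc \<alpha>))) =
        (Cpt F (Src (NSrc \<alpha>)) \<lhd> Pull2 D \<alpha>) \<circ>\<^sub>N Gam F (NSrc \<alpha>))"

definition pder_id :: "('u, 'o, 'a) prederivator \<Rightarrow> ('u, 'o, 'a, 'o, 'a) pder_map" where
  "pder_id D = \<lparr>Cpt = (\<lambda>J. id_functor (Val D J)), Gam = (\<lambda>u. id_nattrans (Pull D u))\<rparr>"

definition pder_comp ::
    "('u, 'p, 'b, 'q, 'c) pder_map \<Rightarrow> ('u, 'o, 'a, 'p, 'b) pder_map \<Rightarrow>
     ('u, 'o, 'a, 'q, 'c) pder_map" where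
  "pder_comp G F = \<lparr>Cpt = (\<lambda>J. Cpt G J \<circ>\<^sub>F Cpt F J),
     Gam = (\<lambda>u. (Cpt G (Src u) \<lhd> Gam F u) \<circ>\<^sub>N (Gam G u \<rhd> Cpt F (Tgt u)))\<rparr>"

definition is_pder_2cell ::
    "'u small_cat set \<Rightarrow> ('u, 'o, 'a) prederivator \<Rightarrow> ('u, 'p, 'b) prederivator \<Rightarrow>
     ('u, 'o, 'a, 'p, 'b) pder_map \<Rightarrow> ('u, 'o, 'a, 'p, 'b) pder_map \<Rightarrow>
     ('u, 'o, 'a, 'p, 'b) pder_2cell \<Rightarrow> bool" where
  "is_pder_2cell Dia D E F G \<rho> \<longleftrightarrow>
     (\<forall>J \<in> Dia. nattrans_between (\<rho> J) (Cpt F J) (Cpt G J)) \<and>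
     (\<forall>u. dia_functor Dia u \<longrightarrow>
        Gam G u \<circ>\<^sub>N (Pull E u \<lhd> \<rho> (Tgt u)) = (\<rho> (Src u) \<rhd> Pull D u) \<circ>\<^sub>N Gam F u)"

section \<open>Monads on prederivators and their modules\<close>

definition monad_on ::
    "'u small_cat set \<Rightarrow> ('u, 'o, 'a) prederivator \<Rightarrow> ('u, 'o, 'a, 'o, 'a) pder_map \<Rightarrow>
     ('u, 'o, 'a, 'o, 'a) pder_2cell \<Rightarrow> ('u, 'o, 'a, 'o, 'a) pder_2cell \<Rightarrow> bool" where
  "monad_on Dia D M \<mu> S \<longleftrightarrow>
     is_pder_map Dia D D M \<and>
     is_pder_2cell Dia D D (pder_comp M M) M \<mu> \<and>
     is_pder_2cell Dia D D (pder_id D) M S \<and>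
     (\<forall>J \<in> Dia.
        \<mu> J \<circ>\<^sub>N (Cpt M J \<lhd> \<mu> J) = \<mu> J \<circ>\<^sub>N (\<mu> J \<rhd> Cpt M J) \<and>
        \<mu> J \<circ>\<^sub>N (Cpt M J \<lhd> S J) = id_nattrans (Cpt M J) \<and>
        \<mu> J \<circ>\<^sub>N (S J \<rhd> Cpt M J) = id_nattrans (Cpt M J))"

text \<open>
  The Eilenberg-Moore category of a monad $(T, \mu, \eta)$. A linear map is recorded together with
  its source and target modules.
\<close>

definition em_cat ::
    "('o, 'a, 'o, 'a) fnct \<Rightarrow> ('o, 'a, 'o, 'a) nattrans \<Rightarrow> ('o, 'a, 'o, 'a) nattrans \<Rightarrow>
     ('o \<times> 'a, ('o \<times> 'a) \<times> 'a \<times> ('o \<times> 'a)) cat" where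
  "em_cat T \<mu> \<eta> = (let C = Src T;
       is_module = (\<lambda>(X, l). X \<in> Obj C \<and> l \<in> hom C (FO T X) X \<and>
         Comp C l (NC \<eta> X) = Ide C X \<and> Comp C l (NC \<mu> X) = Comp C l (FA T l)) in
     \<lparr>Obj = {A. is_module A},
      Arr = {(A, f, B). is_module A \<and> is_module B \<and> f \<in> hom C (fst A) (fst B) \<and>
               Comp C f (snd A) = Comp C (snd B) (FA T f)},
      Dom = fst, Cod = (\<lambda>(_, _, B). B),
      Ide = (\<lambda>A. (A, Ide C (fst A), A)),
      Comp = (\<lambda>(_, g, B) (A, f, _). (A, Comp C g f, B))\<rparr>)"

definition module_val ::
    "('u, 'o, 'a, 'o, 'a) pder_map \<Rightarrow> ('u, 'o, 'a, 'o, 'a) pder_2cell \<Rightarrow>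
     ('u, 'o, 'a, 'o, 'a) pder_2cell \<Rightarrow> 'u small_cat \<Rightarrow>
     ('o \<times> 'a, ('o \<times> 'a) \<times> 'a \<times> ('o \<times> 'a)) cat" where
  "module_val M \<mu> S J = em_cat (Cpt M J) (\<mu> J) (S J)"

definition module_pull_obj ::
    "('u, 'o, 'a) prederivator \<Rightarrow> ('u, 'o, 'a, 'o, 'a) pder_map \<Rightarrow> 'u small_functor \<Rightarrow>
     'o \<times> 'a \<Rightarrow> 'o \<times> 'a" where
  "module_pull_obj D M u = (\<lambda>(X, l). (FO (Pull D u) X,
     Comp (Val D (Src u)) (FA (Pull D u) l) (inv_arr (Val D (Src u)) (NC (Gam M u) X))))"

definition module_pull ::
    "('u, 'o, 'a) prederivator \<Rightarrow> ('u, 'o, 'a, 'o, 'a) pder_map \<Rightarrow>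
     ('u, 'o, 'a, 'o, 'a) pder_2cell \<Rightarrow> ('u, 'o, 'a, 'o, 'a) pder_2cell \<Rightarrow> 'u small_functor \<Rightarrow>
     ('o \<times> 'a, ('o \<times> 'a) \<times> 'a \<times> ('o \<times> 'a), 'o \<times> 'a, ('o \<times> 'a) \<times> 'a \<times> ('o \<times> 'a)) fnct" where
  "module_pull D M \<mu> S u = \<lparr>Src = module_val M \<mu> S (Tgt u), Tgt = module_val M \<mu> S (Src u),
     FO = (\<lambda>A \<in> Obj (module_val M \<mu> S (Tgt u)). module_pull_obj D M u A),
     FA = (\<lambda>(A, f, B) \<in> Arr (module_val M \<mu> S (Tgt u)).
             (module_pull_obj D M u A, FA (Pull D u) f, module_pull_obj D M u B))\<rparr>"

definition module_prederivator ::
    "('u, 'o, 'a) prederivator \<Rightarrow> ('u, 'o, 'a, 'o, 'a) pder_map \<Rightarrow>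
     ('u, 'o, 'a, 'o, 'a) pder_2cell \<Rightarrow> ('u, 'o, 'a, 'o, 'a) pder_2cell \<Rightarrow>
     ('u, 'o \<times> 'a, ('o \<times> 'a) \<times> 'a \<times> ('o \<times> 'a)) prederivator" where
  "module_prederivator D M \<mu> S = \<lparr>
     Val = module_val M \<mu> S,
     Pull = module_pull D M \<mu> S,
     Pull2 = (\<lambda>\<alpha>. \<lparr>NSrc = module_pull D M \<mu> S (NSrc \<alpha>), NTgt = module_pull D M \<mu> S (NTgt \<alpha>),
       NC = (\<lambda>A \<in> Obj (module_val M \<mu> S (Tgt (NSrc \<alpha>))).
               (module_pull_obj D M (NSrc \<alpha>) A, NC (Pull2 D \<alpha>) (fst A),
                module_pull_obj D M (NTgt \<alpha>) A))\<rparr>)\<rparr>"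

section \<open>Derivators\<close>

text \<open>
  Coproducts, slices and the commutative square enter through isomorphic copies inside \<open>Dia\<close>, and
  mates are formed with arbitrary choices of the adjoints involved. All these choices are unique
  up to canonical isomorphism, and each axiom is required for all of them.
\<close>

definition der1 :: "'u small_cat set \<Rightarrow> ('u, 'o, 'a) prederivator \<Rightarrow> bool" where
  "der1 Dia D \<longleftrightarrow>
     (\<forall>(I :: nat set) J P \<phi>. finite I \<and> (\<forall>i\<in>I. J i \<in> Dia) \<and> P \<in> Dia \<and>
        cat_iso_between \<phi> (coprod_cat I J) P \<longrightarrow>
        is_equivalence (tuple_functor (Val D P) I (\<lambda>i. Pull D (\<phi> \<circ>\<^sub>F coprod_incl I J i))))"

definition der2 :: "'u small_cat set \<Rightarrow> ('u, 'o, 'a) prederivator \<Rightarrow> bool" where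
  "der2 Dia D \<longleftrightarrow>
     (\<forall>J \<in> Dia. \<forall>f \<in> Arr (Val D J). is_iso (Val D J) f \<longleftrightarrow>
        (\<forall>j \<in> Obj J. is_iso (Val D one_cat) (FA (Pull D (point J j)) f)))"

definition der3L :: "'u small_cat set \<Rightarrow> ('u, 'o, 'a) prederivator \<Rightarrow> bool" where
  "der3L Dia D \<longleftrightarrow> (\<forall>u. dia_functor Dia u \<longrightarrow> (\<exists>R \<eta> \<epsilon>. adjunction (Pull D u) R \<eta> \<epsilon>))"

definition der3R :: "'u small_cat set \<Rightarrow> ('u, 'o, 'a) prederivator \<Rightarrow> bool" where
  "der3R Dia D \<longleftrightarrow> (\<forall>u. dia_functor Dia u \<longrightarrow> (\<exists>L \<eta> \<epsilon>. adjunction L (Pull D u) \<eta> \<epsilon>))"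

text \<open>
  In the next two definitions \<open>P\<close> is a copy of $J_{k/}$ (respectively $J_{/k}$), \<open>\<alpha>\<close> is the 2-cell with
  component $a$ at $(j, a)$, \<open>R\<close> and \<open>R'\<close> are $u_*$ and $\pi_*$, and \<open>L\<close> and \<open>L'\<close> are $u_!$ and
  $\pi_!$.
\<close>

definition der4L :: "'u small_cat set \<Rightarrow> ('u, 'o, 'a) prederivator \<Rightarrow> bool" where
  "der4L Dia D \<longleftrightarrow>
     (\<forall>u k P \<phi>. dia_functor Dia u \<and> k \<in> Obj (Tgt u) \<and> P \<in> Dia \<and>
        cat_iso_between \<phi> P (coslice_cat u k) \<longrightarrow>
        (let pr = comma_proj (coslice_cat u k) (Src u) \<circ>\<^sub>F \<phi>; \<pi> = to_one P;
             \<alpha> = \<lparr>NSrc = point (Tgt u) k \<circ>\<^sub>F \<pi>, NTgt = u \<circ>\<^sub>F pr,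
                  NC = (\<lambda>p \<in> Obj P. snd (FO \<phi> p))\<rparr>
         in \<forall>R \<eta> \<epsilon> R' \<eta>' \<epsilon>'. adjunction (Pull D u) R \<eta> \<epsilon> \<and> adjunction (Pull D \<pi>) R' \<eta>' \<epsilon>' \<longrightarrow>
              is_nat_iso (((R' \<circ>\<^sub>F Pull D pr) \<lhd> \<epsilon>) \<circ>\<^sub>N (R' \<lhd> Pull2 D \<alpha> \<rhd> R) \<circ>\<^sub>N
                          (\<eta>' \<rhd> (Pull D (point (Tgt u) k) \<circ>\<^sub>F R)))))"

definition der4R :: "'u small_cat set \<Rightarrow> ('u, 'o, 'a) prederivator \<Rightarrow> bool" where
  "der4R Dia D \<longleftrightarrow>
     (\<forall>u k P \<phi>. dia_functor Dia u \<and> k \<in> Obj (Tgt u) \<and> P \<in> Dia \<and>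
        cat_iso_between \<phi> P (slice_cat u k) \<longrightarrow>
        (let pr = comma_proj (slice_cat u k) (Src u) \<circ>\<^sub>F \<phi>; \<pi> = to_one P;
             \<alpha> = \<lparr>NSrc = u \<circ>\<^sub>F pr, NTgt = point (Tgt u) k \<circ>\<^sub>F \<pi>,
                  NC = (\<lambda>p \<in> Obj P. snd (FO \<phi> p))\<rparr>
         in \<forall>L \<eta> \<epsilon> L' \<eta>' \<epsilon>'. adjunction L (Pull D u) \<eta> \<epsilon> \<and> adjunction L' (Pull D \<pi>) \<eta>' \<epsilon>' \<longrightarrow>
              is_nat_iso ((\<epsilon>' \<rhd> (Pull D (point (Tgt u) k) \<circ>\<^sub>F L)) \<circ>\<^sub>N (L' \<lhd> Pull2 D \<alpha> \<rhd> L) \<circ>\<^sub>N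
                          ((L' \<circ>\<^sub>F Pull D pr) \<lhd> \<eta>))))"

definition derivator :: "'u small_cat set \<Rightarrow> ('u, 'o, 'a) prederivator \<Rightarrow> bool" where
  "derivator Dia D \<longleftrightarrow> prederivator Dia D \<and> der1 Dia D \<and> der2 Dia D \<and>
     der3L Dia D \<and> der3R Dia D \<and> der4L Dia D \<and> der4R Dia D"

text \<open>Here \<open>L\<close> is $u_!$.\<close>

definition cocontinuous ::
    "'u small_cat set \<Rightarrow> ('u, 'o, 'a) prederivator \<Rightarrow> ('u, 'o, 'a, 'o, 'a) pder_map \<Rightarrow> bool" where
  "cocontinuous Dia D M \<longleftrightarrow>
     (\<forall>u L \<eta> \<epsilon>. dia_functor Dia u \<and> adjunction L (Pull D u) \<eta> \<epsilon> \<longrightarrow>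
        is_nat_iso ((\<epsilon> \<rhd> (Cpt M (Tgt u) \<circ>\<^sub>F L)) \<circ>\<^sub>N (L \<lhd> inv_nattrans (Gam M u) \<rhd> L) \<circ>\<^sub>N
                    ((L \<circ>\<^sub>F Cpt M (Src u)) \<lhd> \<eta>)))"

section \<open>Stability\<close>

text \<open>The poset $\{0,1\} \times \{0,1\}$; \<^const>\<open>False\<close> is 0 and \<^const>\<open>True\<close> is 1.\<close>

definition square_cat :: "(bool \<times> bool, (bool \<times> bool) \<times> (bool \<times> bool)) cat" where
  "square_cat = \<lparr>Obj = UNIV, Arr = {(p, q). fst p \<le> fst q \<and> snd p \<le> snd q},
     Dom = fst, Cod = snd, Ide = (\<lambda>p. (p, p)), Comp = (\<lambda>g f. (fst f, snd g))\<rparr>"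

text \<open>\<open>Q\<close> is a copy of the square, identified with it by \<open>\<phi>\<close>.\<close>

definition ul_incl ::
    "'u small_cat \<Rightarrow> ('u, 'u, bool \<times> bool, (bool \<times> bool) \<times> (bool \<times> bool)) fnct \<Rightarrow>
     'u small_functor" where
  "ul_incl Q \<phi> = full_incl Q {q. FO \<phi> q \<noteq> (True, True)}"

definition lr_incl ::
    "'u small_cat \<Rightarrow> ('u, 'u, bool \<times> bool, (bool \<times> bool) \<times> (bool \<times> bool)) fnct \<Rightarrow>
     'u small_functor" where
  "lr_incl Q \<phi> = full_incl Q {q. FO \<phi> q \<noteq> (False, False)}"

definition cocartesian ::
    "('u, 'o, 'a) prederivator \<Rightarrow> 'u small_cat \<Rightarrow>
     ('u, 'u, bool \<times> bool, (bool \<times> bool) \<times> (bool \<times> bool)) fnct \<Rightarrow> 'o \<Rightarrow> bool" where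
  "cocartesian D Q \<phi> X \<longleftrightarrow>
     (\<exists>L \<eta> \<epsilon>. adjunction L (Pull D (ul_incl Q \<phi>)) \<eta> \<epsilon> \<and> X \<in> ess_image L)"

definition cartesian ::
    "('u, 'o, 'a) prederivator \<Rightarrow> 'u small_cat \<Rightarrow>
     ('u, 'u, bool \<times> bool, (bool \<times> bool) \<times> (bool \<times> bool)) fnct \<Rightarrow> 'o \<Rightarrow> bool" where
  "cartesian D Q \<phi> X \<longleftrightarrow>
     (\<exists>R \<eta> \<epsilon>. adjunction (Pull D (lr_incl Q \<phi>)) R \<eta> \<epsilon> \<and> X \<in> ess_image R)"

definition pointed :: "'u small_cat set \<Rightarrow> ('u, 'o, 'a) prederivator \<Rightarrow> bool" where
  "pointed Dia D \<longleftrightarrow> (\<forall>J \<in> Dia. \<exists>Z. zero_object (Val D J) Z)"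

definition stable_derivator :: "'u small_cat set \<Rightarrow> ('u, 'o, 'a) prederivator \<Rightarrow> bool" where
  "stable_derivator Dia D \<longleftrightarrow> derivator Dia D \<and> pointed Dia D \<and>
     (\<forall>Q \<phi>. Q \<in> Dia \<and> cat_iso_between \<phi> Q square_cat \<longrightarrow>
        (\<forall>X \<in> Obj (Val D Q). cocartesian D Q \<phi> X \<longleftrightarrow> cartesian D Q \<phi> X))"

end

theory Submission
  imports Defs
begin

text \<open>
  Everything in a derivator that is asked of adjoints (their existence, invertibility of mates,
  cocontinuity of the monad, essential images) can be said in terms of universal arrows, without
  choosing the adjoints: a mate is invertible iff it sends universal arrows to universal arrows
  (\<open>left_mate_iso_iff\<close>, \<open>right_mate_iso_iff\<close>). The theorem is then a statement about how
  universal arrows pass between a category and the category of modules over a monad.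

  A pullback functor, together with the comparison of the monads, is a morphism of monads
  (\<open>monad_mor\<close>), and it acts on modules by acting on their underlying objects. Given a universal arrow
  between the underlying object \<open>X\<close> of a module and the restriction of an object \<open>A\<close>, the universal
  property provides a unique action on \<open>A\<close> for which the arrow is linear, and the arrow stays universal
  among modules. For arrows into \<open>X\<close> (right adjoints) the action is induced directly. For arrows out of
  \<open>X\<close> (left adjoints) it is a map out of \<open>M A\<close>, so the monad has to preserve universal arrows, and that
  is cocontinuity. Conversely, as universal arrows are unique up to isomorphism, every universal arrow
  of modules has a universal underlying arrow. Hence the Kan extensions of modules exist and are computed on underlying objects,
  and the base change axioms for modules are the base change axioms for the given derivator
  (\<open>base_change_to_N\<close>, \<open>base_change_from_N\<close>). The axiom on coproducts holds since a compatible family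
  of actions glues to one action, and isomorphisms are detected on underlying objects.

  For stability, a zero object carries exactly one action. It is initial among modules because the
  monad preserves initial objects, these being left Kan extensions from the empty category. A square
  is cocartesian iff there is a universal arrow from some object over the corner to its restriction; as
  the corner is a sieve, that arrow is invertible (\<open>sieve_unit_iso\<close>), so the object may be taken to be
  the restriction itself, which is a module if the square is one. Thus a square of modules is cocartesian,
  and dually cartesian, iff its underlying square is (\<open>cocartesian_N_iff\<close>, \<open>cartesian_N_iff\<close>).
\<close>

section \<open>Calculating in categories\<close>

notation Comp (infixr "\<cdot>\<index>" 70)

lemma in_hom [simp]: "f \<in> hom C x y \<longleftrightarrow> f \<in> Arr C \<and> Dom C f = x \<and> Cod C f = y"
  by (auto simp: hom_def)

context category
begin

lemma obj_simps [simp]: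
  "f \<in> Arr C \<Longrightarrow> Dom C f \<in> Obj C" "f \<in> Arr C \<Longrightarrow> Cod C f \<in> Obj C"
  "x \<in> Obj C \<Longrightarrow> Ide C x \<in> Arr C" "x \<in> Obj C \<Longrightarrow> Dom C (Ide C x) = x"
  "x \<in> Obj C \<Longrightarrow> Cod C (Ide C x) = x"
  using dom_obj cod_obj ide_hom by auto

lemma comp_simps [simp]:
  assumes "f \<in> Arr C" "g \<in> Arr C" "Cod C f = Dom C g"
  shows "g \<cdot>\<^bsub>C\<^esub> f \<in> Arr C" "Dom C (g \<cdot>\<^bsub>C\<^esub> f) = Dom C f" "Cod C (g \<cdot>\<^bsub>C\<^esub> f) = Cod C g"
  using comp_hom[of f "Dom C f" "Cod C f" g "Cod C g"] assms by auto

lemma assoc [simp]: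
  "\<lbrakk>f \<in> Arr C; g \<in> Arr C; h \<in> Arr C; Cod C f = Dom C g; Cod C g = Dom C h\<rbrakk>
     \<Longrightarrow> (h \<cdot>\<^bsub>C\<^esub> g) \<cdot>\<^bsub>C\<^esub> f = h \<cdot>\<^bsub>C\<^esub> g \<cdot>\<^bsub>C\<^esub> f"
  using comp_assoc[of f _ _ g _ h] by simp

lemma ide_simps [simp]:
  "\<lbrakk>f \<in> Arr C; Cod C f = y\<rbrakk> \<Longrightarrow> Ide C y \<cdot>\<^bsub>C\<^esub> f = f"
  "\<lbrakk>f \<in> Arr C; Dom C f = x\<rbrakk> \<Longrightarrow> f \<cdot>\<^bsub>C\<^esub> Ide C x = f"
  using ide_left[of f "Dom C f" y] ide_right[of f x "Cod C f"] by auto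

text \<open>Rewrites with an equation of composites inside a longer composite bracketed to the right.\<close>

lemma reassoc:
  assumes "g \<cdot>\<^bsub>C\<^esub> f = k \<cdot>\<^bsub>C\<^esub> h" "f \<in> Arr C" "g \<in> Arr C" "Cod C f = Dom C g"
    "h \<in> Arr C" "k \<in> Arr C" "Cod C h = Dom C k" "x \<in> Arr C" "Cod C x = Dom C f"
  shows "g \<cdot>\<^bsub>C\<^esub> f \<cdot>\<^bsub>C\<^esub> x = k \<cdot>\<^bsub>C\<^esub> h \<cdot>\<^bsub>C\<^esub> x"
proof -
  have "Dom C f = Dom C h" using assms comp_simps(2) by metis
  then have "g \<cdot>\<^bsub>C\<^esub> f \<cdot>\<^bsub>C\<^esub> x = (g \<cdot>\<^bsub>C\<^esub> f) \<cdot>\<^bsub>C\<^esub> x" "k \<cdot>\<^bsub>C\<^esub> h \<cdot>\<^bsub>C\<^esub> x = (k \<cdot>\<^bsub>C\<^esub> h) \<cdot>\<^bsub>C\<^esub> x"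
    using assms(2-) by (auto intro!: assoc[symmetric])
  then show ?thesis using assms(1) by simp
qed

lemma reassoc1:
  assumes "g \<cdot>\<^bsub>C\<^esub> f = k" "f \<in> Arr C" "g \<in> Arr C" "Cod C f = Dom C g"
    "x \<in> Arr C" "Cod C x = Dom C f"
  shows "g \<cdot>\<^bsub>C\<^esub> f \<cdot>\<^bsub>C\<^esub> x = k \<cdot>\<^bsub>C\<^esub> x"
  using assms assoc by metis

lemma is_inverse_iff:
  "is_inverse C f g \<longleftrightarrow> f \<in> Arr C \<and> g \<in> Arr C \<and> Dom C g = Cod C f \<and> Cod C g = Dom C f \<and>
     g \<cdot>\<^bsub>C\<^esub> f = Ide C (Dom C f) \<and> f \<cdot>\<^bsub>C\<^esub> g = Ide C (Cod C f)"
  by (auto simp: is_inverse_def)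

lemma inverse_unique:
  assumes "is_inverse C f g" "is_inverse C f h"
  shows "g = h"
proof -
  have "g = g \<cdot>\<^bsub>C\<^esub> f \<cdot>\<^bsub>C\<^esub> h" using assms by (simp add: is_inverse_iff)
  also have "\<dots> = (g \<cdot>\<^bsub>C\<^esub> f) \<cdot>\<^bsub>C\<^esub> h"
    using assms by (intro assoc[symmetric]) (auto simp: is_inverse_iff)
  also have "\<dots> = h" using assms by (simp add: is_inverse_iff)
  finally show ?thesis .
qed

lemma inv_arr_eq: "is_inverse C f g \<Longrightarrow> inv_arr C f = g"
  unfolding inv_arr_def by (blast intro: the_equality inverse_unique)

lemma is_isoI:
  "\<lbrakk>f \<in> Arr C; g \<in> Arr C; Dom C g = Cod C f; Cod C g = Dom C f;
     g \<cdot>\<^bsub>C\<^esub> f = Ide C (Dom C f); f \<cdot>\<^bsub>C\<^esub> g = Ide C (Cod C f)\<rbrakk> \<Longrightarrow> is_iso C f"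
  unfolding is_iso_def is_inverse_iff by blast

lemma inv_simps [simp]:
  assumes "is_iso C f"
  shows "f \<in> Arr C" "inv_arr C f \<in> Arr C" "Dom C (inv_arr C f) = Cod C f"
    "Cod C (inv_arr C f) = Dom C f"
    "inv_arr C f \<cdot>\<^bsub>C\<^esub> f = Ide C (Dom C f)" "f \<cdot>\<^bsub>C\<^esub> inv_arr C f = Ide C (Cod C f)"
  using assms inv_arr_eq unfolding is_iso_def by (metis is_inverse_iff)+

lemma is_iso_inv [simp]: "is_iso C f \<Longrightarrow> is_iso C (inv_arr C f)"
  by (rule is_isoI[where g = f]) auto

lemma inv_cancel [simp]:
  assumes "is_iso C f" "g \<in> Arr C"
  shows "Cod C g = Dom C f \<Longrightarrow> inv_arr C f \<cdot>\<^bsub>C\<^esub> f \<cdot>\<^bsub>C\<^esub> g = g"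
    "Cod C g = Cod C f \<Longrightarrow> f \<cdot>\<^bsub>C\<^esub> inv_arr C f \<cdot>\<^bsub>C\<^esub> g = g"
  using assms by (metis inv_simps assoc ide_simps(1))+

lemma is_iso_ide [simp]: "x \<in> Obj C \<Longrightarrow> is_iso C (Ide C x)"
  by (rule is_isoI[where g = "Ide C x"]) auto

lemma inv_ide [simp]: "x \<in> Obj C \<Longrightarrow> inv_arr C (Ide C x) = Ide C x"
  by (rule inv_arr_eq) (simp add: is_inverse_iff)

lemma comp_is_inverse:
  assumes "is_iso C f" "is_iso C g" "Cod C f = Dom C g"
  shows "is_inverse C (g \<cdot>\<^bsub>C\<^esub> f) (inv_arr C f \<cdot>\<^bsub>C\<^esub> inv_arr C g)"
  using assms by (simp add: is_inverse_iff)

lemma is_iso_comp [simp]: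
  "\<lbrakk>is_iso C f; is_iso C g; Cod C f = Dom C g\<rbrakk> \<Longrightarrow> is_iso C (g \<cdot>\<^bsub>C\<^esub> f)"
  using comp_is_inverse unfolding is_iso_def by blast

lemma inv_comp [simp]:
  "\<lbrakk>is_iso C f; is_iso C g; Cod C f = Dom C g\<rbrakk>
     \<Longrightarrow> inv_arr C (g \<cdot>\<^bsub>C\<^esub> f) = inv_arr C f \<cdot>\<^bsub>C\<^esub> inv_arr C g"
  using comp_is_inverse inv_arr_eq by blast

lemma iso_cancel_left:
  assumes "is_iso C g" "f \<in> Arr C" "f' \<in> Arr C" "Cod C f = Dom C g" "Cod C f' = Dom C g"
  shows "g \<cdot>\<^bsub>C\<^esub> f = g \<cdot>\<^bsub>C\<^esub> f' \<longleftrightarrow> f = f'"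
  using assms inv_cancel(1) by metis

lemma iso_cancel_right:
  assumes "is_iso C g" "f \<in> Arr C" "f' \<in> Arr C" "Dom C f = Cod C g" "Dom C f' = Cod C g"
  shows "f \<cdot>\<^bsub>C\<^esub> g = f' \<cdot>\<^bsub>C\<^esub> g \<longleftrightarrow> f = f'"
proof
  assume "f \<cdot>\<^bsub>C\<^esub> g = f' \<cdot>\<^bsub>C\<^esub> g"
  then have "(f \<cdot>\<^bsub>C\<^esub> g) \<cdot>\<^bsub>C\<^esub> inv_arr C g = (f' \<cdot>\<^bsub>C\<^esub> g) \<cdot>\<^bsub>C\<^esub> inv_arr C g" by simp
  then show "f = f'" using assms by simp
qed simp

lemma iso_objsI: "is_iso C f \<Longrightarrow> iso_objs C (Dom C f) (Cod C f)"
  by (auto simp: iso_objs_def)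

lemma iso_objsE:
  assumes "iso_objs C x y"
  obtains f where "is_iso C f" "Dom C f = x" "Cod C f = y"
  using assms unfolding iso_objs_def by auto

end

locale funct = dom: category C + cod: category D
  for C :: "('o, 'a) cat" and D :: "('p, 'b) cat" +
  fixes F :: "('o, 'a, 'p, 'b) fnct"
  assumes between: "functor_between F C D"
begin

lemma src_tgt [simp]: "Src F = C" "Tgt F = D"
  using between by (auto simp: functor_between_def)

lemma is_functor [simp]: "is_functor F"
  using between by (auto simp: functor_between_def)

lemma obj [simp]: "x \<in> Obj C \<Longrightarrow> FO F x \<in> Obj D"
  using is_functor unfolding is_functor_def by auto

lemma arr [simp]:
  "f \<in> Arr C \<Longrightarrow> FA F f \<in> Arr D" "f \<in> Arr C \<Longrightarrow> Dom D (FA F f) = FO F (Dom C f)"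
  "f \<in> Arr C \<Longrightarrow> Cod D (FA F f) = FO F (Cod C f)"
  using is_functor unfolding is_functor_def by auto

lemma ide [simp]: "x \<in> Obj C \<Longrightarrow> FA F (Ide C x) = Ide D (FO F x)"
  using is_functor unfolding is_functor_def by auto

lemma comp [simp]:
  "\<lbrakk>f \<in> Arr C; g \<in> Arr C; Cod C f = Dom C g\<rbrakk> \<Longrightarrow> FA F (g \<cdot>\<^bsub>C\<^esub> f) = FA F g \<cdot>\<^bsub>D\<^esub> FA F f"
  using is_functor unfolding is_functor_def by auto

lemma ext: "FO F \<in> extensional (Obj C)" "FA F \<in> extensional (Arr C)"
  using is_functor unfolding is_functor_def by (auto simp: PiE_def)

lemma preserves_inverse:
  assumes "is_iso C f"
  shows "is_inverse D (FA F f) (FA F (inv_arr C f))"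
  using assms by (simp add: cod.is_inverse_iff flip: comp)

lemma is_iso [simp]: "is_iso C f \<Longrightarrow> is_iso D (FA F f)"
  using preserves_inverse unfolding is_iso_def by blast

lemma inv: "is_iso C f \<Longrightarrow> FA F (inv_arr C f) = inv_arr D (FA F f)"
  using preserves_inverse cod.inv_arr_eq by metis

end

lemma functI: "functor_between F C D \<Longrightarrow> funct C D F"
  by (auto simp: funct_def funct_axioms_def functor_between_def is_functor_def)

lemma is_functor_funct: "is_functor F \<longleftrightarrow> funct (Src F) (Tgt F) F"
proof
  show "funct (Src F) (Tgt F) F" if "is_functor F"
    using that by (intro functI) (auto simp: functor_between_def)
qed (rule funct.is_functor)

lemma funct_intro:
  assumes "category C" "category D" "Src F = C" "Tgt F = D"
    "FO F \<in> extensional (Obj C)" "FA F \<in> extensional (Arr C)"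
    "\<And>x. x \<in> Obj C \<Longrightarrow> FO F x \<in> Obj D"
    "\<And>f. f \<in> Arr C \<Longrightarrow> FA F f \<in> hom D (FO F (Dom C f)) (FO F (Cod C f))"
    "\<And>x. x \<in> Obj C \<Longrightarrow> FA F (Ide C x) = Ide D (FO F x)"
    "\<And>f g. \<lbrakk>f \<in> Arr C; g \<in> Arr C; Cod C f = Dom C g\<rbrakk> \<Longrightarrow> FA F (g \<cdot>\<^bsub>C\<^esub> f) = FA F g \<cdot>\<^bsub>D\<^esub> FA F f"
  shows "funct C D F"
  using assms by (intro functI) (auto simp: functor_between_def is_functor_def PiE_def)

lemma fnct_eqI:
  assumes "funct C D F" "funct C D G" "\<And>x. x \<in> Obj C \<Longrightarrow> FO F x = FO G x"
    "\<And>f. f \<in> Arr C \<Longrightarrow> FA F f = FA G f"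
  shows "F = G"
proof -
  interpret F: funct C D F by fact
  interpret G: funct C D G by fact
  have "FO F = FO G" "FA F = FA G"
    using F.ext G.ext assms(3,4) by (auto intro: extensionalityI)
  moreover have "fnct.more F = fnct.more G" by simp
  ultimately show ?thesis by (intro fnct.equality) auto
qed

lemma comp_functor_simps [simp]:
  "Src (G \<circ>\<^sub>F F) = Src F" "Tgt (G \<circ>\<^sub>F F) = Tgt G"
  "x \<in> Obj (Src F) \<Longrightarrow> FO (G \<circ>\<^sub>F F) x = FO G (FO F x)"
  "f \<in> Arr (Src F) \<Longrightarrow> FA (G \<circ>\<^sub>F F) f = FA G (FA F f)"
  by (simp_all add: comp_functor_def)

lemma id_functor_simps [simp]:
  "Src (id_functor C) = C" "Tgt (id_functor C) = C"
  "x \<in> Obj C \<Longrightarrow> FO (id_functor C) x = x" "f \<in> Arr C \<Longrightarrow> FA (id_functor C) f = f"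
  by (simp_all add: id_functor_def)

lemma funct_comp:
  assumes "funct C D F" "funct D E G"
  shows "funct C E (G \<circ>\<^sub>F F)"
proof -
  interpret F: funct C D F by fact
  interpret G: funct D E G by fact
  show ?thesis
    by (rule funct_intro) (auto simp: F.dom.category_axioms G.cod.category_axioms comp_functor_def)
qed

lemma funct_id: "category C \<Longrightarrow> funct C C (id_functor C)"
  by (rule funct_intro) (auto simp: id_functor_def category.obj_simps category.comp_simps)

lemma is_functor_comp [simp]:
  "\<lbrakk>is_functor F; is_functor G; Src G = Tgt F\<rbrakk> \<Longrightarrow> is_functor (G \<circ>\<^sub>F F)"
  using funct_comp[of "Src F" "Tgt F" F "Tgt G" G] by (auto simp: is_functor_funct)

text \<open>
  Functors and transformations carry their domains, so the laws of the 2-category of categories are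
  equations between records. They are simplification rules with side conditions on the domains only,
  by which the end points of a pasting of whiskered transformations are normalized.
\<close>

lemma comp_functor_assoc [simp]:
  assumes "is_functor F" "Src G = Tgt F"
  shows "(H \<circ>\<^sub>F G) \<circ>\<^sub>F F = H \<circ>\<^sub>F G \<circ>\<^sub>F F"
proof -
  obtain C D where "funct C D F" using assms is_functor_funct by blast
  then interpret F: funct C D F .
  have [simp]: "Src G = D" using assms(2) by simp
  show ?thesis by (auto simp: comp_functor_def intro!: ext)
qed

lemma comp_functor_id [simp]:
  assumes "is_functor F"
  shows "Src F = C \<Longrightarrow> F \<circ>\<^sub>F id_functor C = F" "Tgt F = D \<Longrightarrow> id_functor D \<circ>\<^sub>F F = F"
proof -
  obtain A B where "funct A B F" using assms is_functor_funct by blast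
  then interpret F: funct A B F .
  have id: "funct A A (id_functor A)" "funct B B (id_functor B)"
    using funct_id F.dom.category_axioms F.cod.category_axioms by blast+
  have "F \<circ>\<^sub>F id_functor A = F"
    by (rule fnct_eqI[OF funct_comp[OF id(1) F.funct_axioms] F.funct_axioms]) auto
  moreover have "id_functor B \<circ>\<^sub>F F = F"
    by (rule fnct_eqI[OF funct_comp[OF F.funct_axioms id(2)] F.funct_axioms]) auto
  ultimately show "Src F = C \<Longrightarrow> F \<circ>\<^sub>F id_functor C = F" "Tgt F = D \<Longrightarrow> id_functor D \<circ>\<^sub>F F = F"
    by auto
qed

locale nattr = S: funct C D F + T: funct C D G
  for C :: "('o, 'a) cat" and D :: "('p, 'b) cat" and F G +
  fixes \<tau> :: "('o, 'a, 'p, 'b) nattrans"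
  assumes between: "nattrans_between \<tau> F G"
begin

lemma src_tgt [simp]: "NSrc \<tau> = F" "NTgt \<tau> = G"
  using between by (auto simp: nattrans_between_def)

lemma is_nattrans [simp]: "is_nattrans \<tau>"
  using between by (auto simp: nattrans_between_def)

lemma cpt [simp]:
  "x \<in> Obj C \<Longrightarrow> NC \<tau> x \<in> Arr D" "x \<in> Obj C \<Longrightarrow> Dom D (NC \<tau> x) = FO F x"
  "x \<in> Obj C \<Longrightarrow> Cod D (NC \<tau> x) = FO G x"
  using is_nattrans unfolding is_nattrans_def by auto

lemma natural:
  "f \<in> Arr C \<Longrightarrow> Dom C f = x \<Longrightarrow> Cod C f = y \<Longrightarrow> NC \<tau> y \<cdot>\<^bsub>D\<^esub> FA F f = FA G f \<cdot>\<^bsub>D\<^esub> NC \<tau> x"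
  using is_nattrans unfolding is_nattrans_def by auto

lemma ext: "NC \<tau> \<in> extensional (Obj C)"
  using is_nattrans unfolding is_nattrans_def by auto

end

lemma nattrI: "nattrans_between \<tau> F G \<Longrightarrow> Src F = C \<Longrightarrow> Tgt F = D \<Longrightarrow> nattr C D F G \<tau>"
  by (auto simp: nattr_def nattr_axioms_def nattrans_between_def is_nattrans_def is_functor_funct)

lemma nattr_intro:
  assumes "funct C D F" "funct C D G" "NSrc \<tau> = F" "NTgt \<tau> = G" "NC \<tau> \<in> extensional (Obj C)"
    "\<And>x. x \<in> Obj C \<Longrightarrow> NC \<tau> x \<in> hom D (FO F x) (FO G x)"
    "\<And>f. f \<in> Arr C \<Longrightarrow> NC \<tau> (Cod C f) \<cdot>\<^bsub>D\<^esub> FA F f = FA G f \<cdot>\<^bsub>D\<^esub> NC \<tau> (Dom C f)"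
  shows "nattr C D F G \<tau>"
proof -
  interpret F: funct C D F by fact
  interpret G: funct C D G by fact
  show ?thesis
    by (rule nattrI) (use assms in \<open>auto simp: nattrans_between_def is_nattrans_def\<close>)
qed

lemma nattrans_eqI:
  assumes "nattr C D F G \<sigma>" "nattr C D F G \<tau>" "\<And>x. x \<in> Obj C \<Longrightarrow> NC \<sigma> x = NC \<tau> x"
  shows "\<sigma> = \<tau>"
proof -
  interpret \<sigma>: nattr C D F G \<sigma> by fact
  interpret \<tau>: nattr C D F G \<tau> by fact
  have "NC \<sigma> = NC \<tau>"
    using \<sigma>.ext \<tau>.ext assms(3) by (auto intro: extensionalityI)
  then show ?thesis by (intro nattrans.equality) auto
qed

lemma is_nattrans_nattr:
  "is_nattrans \<tau> \<longleftrightarrow> nattr (Src (NSrc \<tau>)) (Tgt (NSrc \<tau>)) (NSrc \<tau>) (NTgt \<tau>) \<tau>"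
proof
  show "nattr (Src (NSrc \<tau>)) (Tgt (NSrc \<tau>)) (NSrc \<tau>) (NTgt \<tau>) \<tau>" if "is_nattrans \<tau>"
    using that by (intro nattrI) (auto simp: nattrans_between_def)
qed (rule nattr.is_nattrans)

lemma is_nat_iso_iff:
  assumes "nattr C D F G \<tau>"
  shows "is_nat_iso \<tau> \<longleftrightarrow> (\<forall>x \<in> Obj C. is_iso D (NC \<tau> x))"
proof -
  interpret nattr C D F G \<tau> by fact
  show ?thesis by (auto simp: is_nat_iso_def)
qed

lemma vcomp_simps [simp]:
  "NSrc (\<sigma> \<circ>\<^sub>N \<tau>) = NSrc \<tau>" "NTgt (\<sigma> \<circ>\<^sub>N \<tau>) = NTgt \<sigma>"
  "x \<in> Obj (Src (NSrc \<tau>)) \<Longrightarrow> NC (\<sigma> \<circ>\<^sub>N \<tau>) x = NC \<sigma> x \<cdot>\<^bsub>Tgt (NSrc \<tau>)\<^esub> NC \<tau> x"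
  by (simp_all add: vcomp_def)

lemma whisker_simps [simp]:
  "NSrc (H \<lhd> \<tau>) = H \<circ>\<^sub>F NSrc \<tau>" "NTgt (H \<lhd> \<tau>) = H \<circ>\<^sub>F NTgt \<tau>"
  "x \<in> Obj (Src (NSrc \<tau>)) \<Longrightarrow> NC (H \<lhd> \<tau>) x = FA H (NC \<tau> x)"
  "NSrc (\<sigma> \<rhd> K) = NSrc \<sigma> \<circ>\<^sub>F K" "NTgt (\<sigma> \<rhd> K) = NTgt \<sigma> \<circ>\<^sub>F K"
  "y \<in> Obj (Src K) \<Longrightarrow> NC (\<sigma> \<rhd> K) y = NC \<sigma> (FO K y)"
  by (simp_all add: whisker_left_def whisker_right_def)

lemma id_nattrans_simps [simp]:
  "NSrc (id_nattrans F) = F" "NTgt (id_nattrans F) = F"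
  "x \<in> Obj (Src F) \<Longrightarrow> NC (id_nattrans F) x = Ide (Tgt F) (FO F x)"
  by (simp_all add: id_nattrans_def)

lemma inv_nattrans_simps [simp]:
  "NSrc (inv_nattrans \<tau>) = NTgt \<tau>" "NTgt (inv_nattrans \<tau>) = NSrc \<tau>"
  "x \<in> Obj (Src (NSrc \<tau>)) \<Longrightarrow> NC (inv_nattrans \<tau>) x = inv_arr (Tgt (NSrc \<tau>)) (NC \<tau> x)"
  by (simp_all add: inv_nattrans_def)

lemma nattr_vcomp:
  assumes "nattr C D F G \<tau>" "nattr C D G H \<sigma>"
  shows "nattr C D F H (\<sigma> \<circ>\<^sub>N \<tau>)"
proof -
  interpret \<tau>: nattr C D F G \<tau> by fact
  interpret \<sigma>: nattr C D G H \<sigma> by fact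
  show ?thesis
  proof (rule nattr_intro[OF \<tau>.S.funct_axioms \<sigma>.T.funct_axioms])
    fix f assume f: "f \<in> Arr C"
    let ?x = "Dom C f" and ?y = "Cod C f"
    have "(NC \<sigma> ?y \<cdot>\<^bsub>D\<^esub> NC \<tau> ?y) \<cdot>\<^bsub>D\<^esub> FA F f = NC \<sigma> ?y \<cdot>\<^bsub>D\<^esub> FA G f \<cdot>\<^bsub>D\<^esub> NC \<tau> ?x"
      using f by (simp add: \<tau>.natural)
    also have "\<dots> = FA H f \<cdot>\<^bsub>D\<^esub> NC \<sigma> ?x \<cdot>\<^bsub>D\<^esub> NC \<tau> ?x"
      using f by (intro \<tau>.S.cod.reassoc) (auto simp: \<sigma>.natural)
    finally show "NC (\<sigma> \<circ>\<^sub>N \<tau>) ?y \<cdot>\<^bsub>D\<^esub> FA F f = FA H f \<cdot>\<^bsub>D\<^esub> NC (\<sigma> \<circ>\<^sub>N \<tau>) ?x"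
      using f by simp
  qed (auto simp: vcomp_def)
qed

lemma nattr_whisker_left:
  assumes "nattr C D F G \<tau>" "funct D E H"
  shows "nattr C E (H \<circ>\<^sub>F F) (H \<circ>\<^sub>F G) (H \<lhd> \<tau>)"
proof -
  interpret \<tau>: nattr C D F G \<tau> by fact
  interpret H: funct D E H by fact
  show ?thesis
    by (rule nattr_intro)
      (auto simp: whisker_left_def \<tau>.natural simp flip: H.comp
        intro: funct_comp \<tau>.S.funct_axioms \<tau>.T.funct_axioms H.funct_axioms)
qed

lemma nattr_whisker_right:
  assumes "nattr D E F G \<tau>" "funct C D H"
  shows "nattr C E (F \<circ>\<^sub>F H) (G \<circ>\<^sub>F H) (\<tau> \<rhd> H)"
proof -
  interpret \<tau>: nattr D E F G \<tau> by fact
  interpret H: funct C D H by fact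
  show ?thesis
    by (rule nattr_intro)
      (auto simp: whisker_right_def \<tau>.natural
        intro: funct_comp \<tau>.S.funct_axioms \<tau>.T.funct_axioms H.funct_axioms)
qed

lemma nattr_id: "funct C D F \<Longrightarrow> nattr C D F F (id_nattrans F)"
proof -
  assume "funct C D F"
  then interpret funct C D F .
  show ?thesis by (rule nattr_intro[OF funct_axioms funct_axioms]) (auto simp: id_nattrans_def)
qed

lemma is_nattrans_simps [simp]:
  "\<lbrakk>is_nattrans \<tau>; is_nattrans \<sigma>; NTgt \<tau> = NSrc \<sigma>\<rbrakk> \<Longrightarrow> is_nattrans (\<sigma> \<circ>\<^sub>N \<tau>)"
  "\<lbrakk>is_nattrans \<tau>; is_functor H; Src H = Tgt (NSrc \<tau>)\<rbrakk> \<Longrightarrow> is_nattrans (H \<lhd> \<tau>)"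
  "\<lbrakk>is_nattrans \<tau>; is_functor G; Src (NSrc \<tau>) = Tgt G\<rbrakk> \<Longrightarrow> is_nattrans (\<tau> \<rhd> G)"
  "is_functor K \<Longrightarrow> is_nattrans (id_nattrans K)"
proof -
  show "is_nattrans (\<sigma> \<circ>\<^sub>N \<tau>)" if "is_nattrans \<tau>" "is_nattrans \<sigma>" "NTgt \<tau> = NSrc \<sigma>"
  proof -
    have "Src (NSrc \<sigma>) = Src (NSrc \<tau>)" "Tgt (NSrc \<sigma>) = Tgt (NSrc \<tau>)"
      using that unfolding is_nattrans_def by auto
    then show ?thesis
      using that nattr_vcomp[of _ _ "NSrc \<tau>" "NTgt \<tau>" \<tau> "NTgt \<sigma>" \<sigma>]
      by (auto simp: is_nattrans_nattr)
  qed
  show "is_nattrans (H \<lhd> \<tau>)" if "is_nattrans \<tau>" "is_functor H" "Src H = Tgt (NSrc \<tau>)"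
    using that nattr_whisker_left[of _ _ "NSrc \<tau>" "NTgt \<tau>" \<tau> "Tgt H" H]
    by (auto simp: is_nattrans_nattr is_functor_funct)
  show "is_nattrans (\<tau> \<rhd> G)" if "is_nattrans \<tau>" "is_functor G" "Src (NSrc \<tau>) = Tgt G"
    using that nattr_whisker_right[of _ _ "NSrc \<tau>" "NTgt \<tau>" \<tau> "Src G" G]
    by (auto simp: is_nattrans_nattr is_functor_funct)
  show "is_nattrans (id_nattrans K)" if "is_functor K"
    using that nattr_id[of "Src K" "Tgt K" K] by (simp add: is_nattrans_nattr is_functor_funct)
qed

lemma nattr_inv:
  assumes "nattr C D F G \<tau>" "\<And>x. x \<in> Obj C \<Longrightarrow> is_iso D (NC \<tau> x)"
  shows "nattr C D G F (inv_nattrans \<tau>)"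
proof -
  interpret \<tau>: nattr C D F G \<tau> by fact
  show ?thesis
  proof (rule nattr_intro[OF \<tau>.T.funct_axioms \<tau>.S.funct_axioms])
    fix f assume f: "f \<in> Arr C"
    let ?x = "NC \<tau> (Dom C f)" and ?y = "NC \<tau> (Cod C f)"
    have [simp]: "is_iso D ?x" "is_iso D ?y" using f assms(2) by auto
    have "inv_arr D ?y \<cdot>\<^bsub>D\<^esub> FA G f = inv_arr D ?y \<cdot>\<^bsub>D\<^esub> (FA G f \<cdot>\<^bsub>D\<^esub> ?x) \<cdot>\<^bsub>D\<^esub> inv_arr D ?x"
      using f by simp
    also have "\<dots> = FA F f \<cdot>\<^bsub>D\<^esub> inv_arr D ?x"
      using f by (simp flip: \<tau>.natural)
    finally show "NC (inv_nattrans \<tau>) (Cod C f) \<cdot>\<^bsub>D\<^esub> FA G f =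
        FA F f \<cdot>\<^bsub>D\<^esub> NC (inv_nattrans \<tau>) (Dom C f)"
      using f by simp
  qed (use assms(2) in \<open>auto simp: inv_nattrans_def\<close>)
qed

section \<open>Universal arrows\<close>

text \<open>
  \<open>univ_from U X A h\<close> says that \<open>(A, h)\<close> is initial in the category of arrows from \<open>X\<close> to \<open>U\<close>, that
  is, that \<open>A\<close> with \<open>h\<close> is a value at \<open>X\<close> of a left adjoint of \<open>U\<close> together with its unit;
  \<open>univ_to\<close> is the dual notion, for right adjoints.
\<close>

definition univ_from :: "('o, 'a, 'p, 'b) fnct \<Rightarrow> 'p \<Rightarrow> 'o \<Rightarrow> 'b \<Rightarrow> bool" where
  "univ_from U X A h \<longleftrightarrow> A \<in> Obj (Src U) \<and> h \<in> hom (Tgt U) X (FO U A) \<and>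
     (\<forall>B \<in> Obj (Src U). \<forall>g \<in> hom (Tgt U) X (FO U B).
        \<exists>!f. f \<in> hom (Src U) A B \<and> FA U f \<cdot>\<^bsub>Tgt U\<^esub> h = g)"

definition univ_to :: "('o, 'a, 'p, 'b) fnct \<Rightarrow> 'p \<Rightarrow> 'o \<Rightarrow> 'b \<Rightarrow> bool" where
  "univ_to U X A e \<longleftrightarrow> A \<in> Obj (Src U) \<and> e \<in> hom (Tgt U) (FO U A) X \<and>
     (\<forall>B \<in> Obj (Src U). \<forall>g \<in> hom (Tgt U) (FO U B) X.
        \<exists>!f. f \<in> hom (Src U) B A \<and> e \<cdot>\<^bsub>Tgt U\<^esub> FA U f = g)"

context funct
begin

lemma univ_from_arr:
  assumes "univ_from F X A h"
  shows "A \<in> Obj C" "h \<in> Arr D" "Dom D h = X" "Cod D h = FO F A" "X \<in> Obj D"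
  using assms by (auto simp: univ_from_def)

lemma univ_fromE:
  assumes "univ_from F X A h" "g \<in> Arr D" "Dom D g = X" "Cod D g = FO F B" "B \<in> Obj C"
  obtains f where "f \<in> Arr C" "Dom C f = A" "Cod C f = B" "FA F f \<cdot>\<^bsub>D\<^esub> h = g"
proof -
  have "\<exists>!f. f \<in> hom C A B \<and> FA F f \<cdot>\<^bsub>D\<^esub> h = g"
    using assms unfolding univ_from_def by auto
  then show ?thesis using that by auto
qed

lemma univ_from_eq:
  assumes "univ_from F X A h" "f \<in> Arr C" "f' \<in> Arr C" "Dom C f = A" "Dom C f' = A"
    "Cod C f = Cod C f'" "FA F f \<cdot>\<^bsub>D\<^esub> h = FA F f' \<cdot>\<^bsub>D\<^esub> h"
  shows "f = f'"
proof -
  have "\<exists>!k. k \<in> hom C A (Cod C f) \<and> FA F k \<cdot>\<^bsub>D\<^esub> h = FA F f \<cdot>\<^bsub>D\<^esub> h"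
    using assms(1-4) unfolding univ_from_def by auto
  then show ?thesis using assms by auto
qed

lemma univ_fromI:
  assumes "A \<in> Obj C" "h \<in> hom D X (FO F A)"
    "\<And>B g. \<lbrakk>B \<in> Obj C; g \<in> Arr D; Dom D g = X; Cod D g = FO F B\<rbrakk>
       \<Longrightarrow> \<exists>f \<in> hom C A B. FA F f \<cdot>\<^bsub>D\<^esub> h = g"
    "\<And>f f'. \<lbrakk>f \<in> Arr C; f' \<in> Arr C; Dom C f = A; Dom C f' = A; Cod C f = Cod C f';
       FA F f \<cdot>\<^bsub>D\<^esub> h = FA F f' \<cdot>\<^bsub>D\<^esub> h\<rbrakk> \<Longrightarrow> f = f'"
  shows "univ_from F X A h"
proof -
  have "\<exists>!f. f \<in> hom C A B \<and> FA F f \<cdot>\<^bsub>D\<^esub> h = g" if "B \<in> Obj C" "g \<in> hom D X (FO F B)" for B g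
  proof -
    from that obtain f where f: "f \<in> hom C A B" "FA F f \<cdot>\<^bsub>D\<^esub> h = g"
      using assms(3)[of B g] by auto
    show ?thesis by (rule ex1I[of _ f]) (use f assms(4) in auto)
  qed
  then show ?thesis using assms(1,2) by (simp add: univ_from_def)
qed

lemma univ_from_along_iso:
  assumes h: "univ_from F X A h" and f: "is_iso C f" "Dom C f = A" "Cod C f = B"
  shows "univ_from F X B (FA F f \<cdot>\<^bsub>D\<^esub> h)"
proof -
  note [simp] = univ_from_arr[OF h]
  show ?thesis
  proof (rule univ_fromI)
    fix B' g assume g: "B' \<in> Obj C" "g \<in> Arr D" "Dom D g = X" "Cod D g = FO F B'"
    obtain k where k: "k \<in> Arr C" "Dom C k = A" "Cod C k = B'" "FA F k \<cdot>\<^bsub>D\<^esub> h = g"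
      using univ_fromE[OF h] g by metis
    have "FA F (k \<cdot>\<^bsub>C\<^esub> inv_arr C f) \<cdot>\<^bsub>D\<^esub> FA F f \<cdot>\<^bsub>D\<^esub> h = g"
      using k f h by (simp add: inv)
    then show "\<exists>m \<in> hom C B B'. FA F m \<cdot>\<^bsub>D\<^esub> FA F f \<cdot>\<^bsub>D\<^esub> h = g"
      using k f by (intro bexI[where x = "k \<cdot>\<^bsub>C\<^esub> inv_arr C f"]) auto
  next
    fix m m'
    assume m: "m \<in> Arr C" "m' \<in> Arr C" "Dom C m = B" "Dom C m' = B" "Cod C m = Cod C m'"
      "FA F m \<cdot>\<^bsub>D\<^esub> FA F f \<cdot>\<^bsub>D\<^esub> h = FA F m' \<cdot>\<^bsub>D\<^esub> FA F f \<cdot>\<^bsub>D\<^esub> h"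
    have "m \<cdot>\<^bsub>C\<^esub> f = m' \<cdot>\<^bsub>C\<^esub> f"
      by (rule univ_from_eq[OF h]) (use m f h in auto)
    then show "m = m'" using m f by (simp add: dom.iso_cancel_right)
  qed (use h f in auto)
qed

lemma univ_from_precomp_iso:
  assumes h: "univ_from F X A h" and s: "is_iso D s" "Cod D s = X" "Dom D s = Y"
  shows "univ_from F Y A (h \<cdot>\<^bsub>D\<^esub> s)"
proof -
  note [simp] = univ_from_arr[OF h]
  show ?thesis
  proof (rule univ_fromI)
    fix B g assume g: "B \<in> Obj C" "g \<in> Arr D" "Dom D g = Y" "Cod D g = FO F B"
    obtain k where k: "k \<in> Arr C" "Dom C k = A" "Cod C k = B" "FA F k \<cdot>\<^bsub>D\<^esub> h = g \<cdot>\<^bsub>D\<^esub> inv_arr D s"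
      using univ_fromE[OF h, of "g \<cdot>\<^bsub>D\<^esub> inv_arr D s" B] g s by auto
    have "FA F k \<cdot>\<^bsub>D\<^esub> h \<cdot>\<^bsub>D\<^esub> s = (FA F k \<cdot>\<^bsub>D\<^esub> h) \<cdot>\<^bsub>D\<^esub> s" using k(1-3) h s by simp
    also have "\<dots> = g" using k g s by simp
    finally show "\<exists>m \<in> hom C A B. FA F m \<cdot>\<^bsub>D\<^esub> h \<cdot>\<^bsub>D\<^esub> s = g" using k by auto
  next
    fix m m'
    assume m: "m \<in> Arr C" "m' \<in> Arr C" "Dom C m = A" "Dom C m' = A" "Cod C m = Cod C m'"
      "FA F m \<cdot>\<^bsub>D\<^esub> h \<cdot>\<^bsub>D\<^esub> s = FA F m' \<cdot>\<^bsub>D\<^esub> h \<cdot>\<^bsub>D\<^esub> s"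
    then have "(FA F m \<cdot>\<^bsub>D\<^esub> h) \<cdot>\<^bsub>D\<^esub> s = (FA F m' \<cdot>\<^bsub>D\<^esub> h) \<cdot>\<^bsub>D\<^esub> s" using h s by simp
    then have "FA F m \<cdot>\<^bsub>D\<^esub> h = FA F m' \<cdot>\<^bsub>D\<^esub> h"
      by (subst (asm) cod.iso_cancel_right) (use m(1-5) h s in auto)
    then show "m = m'" using univ_from_eq[OF h] m by blast
  qed (use h s in auto)
qed

lemma univ_from_unique:
  assumes h: "univ_from F X A h" and k: "univ_from F X B k"
  obtains f where "is_iso C f" "Dom C f = A" "Cod C f = B" "FA F f \<cdot>\<^bsub>D\<^esub> h = k"
proof -
  note [simp] = univ_from_arr[OF h] univ_from_arr[OF k]
  obtain f where f: "f \<in> Arr C" "Dom C f = A" "Cod C f = B" "FA F f \<cdot>\<^bsub>D\<^esub> h = k"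
    using univ_fromE[OF h] k by (metis univ_from_arr)
  obtain g where g: "g \<in> Arr C" "Dom C g = B" "Cod C g = A" "FA F g \<cdot>\<^bsub>D\<^esub> k = h"
    using univ_fromE[OF k] h by (metis univ_from_arr)
  have "g \<cdot>\<^bsub>C\<^esub> f = Ide C A" by (rule univ_from_eq[OF h]) (use f g h in auto)
  moreover have "f \<cdot>\<^bsub>C\<^esub> g = Ide C B" by (rule univ_from_eq[OF k]) (use f g k in auto)
  ultimately have "is_iso C f" using f g dom.is_isoI[of f g] by simp
  then show ?thesis using that f by blast
qed

end

section \<open>Duality\<close>

definition op_functor :: "('o, 'a, 'p, 'b) fnct \<Rightarrow> ('o, 'a, 'p, 'b) fnct" where
  "op_functor F = \<lparr>Src = op_cat (Src F), Tgt = op_cat (Tgt F), FO = FO F, FA = FA F\<rparr>"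

definition op_nattrans :: "('o, 'a, 'p, 'b) nattrans \<Rightarrow> ('o, 'a, 'p, 'b) nattrans" where
  "op_nattrans \<tau> = \<lparr>NSrc = op_functor (NTgt \<tau>), NTgt = op_functor (NSrc \<tau>), NC = NC \<tau>\<rparr>"

lemma op_cat_simps [simp]:
  "Obj (op_cat C) = Obj C" "Arr (op_cat C) = Arr C" "Dom (op_cat C) = Cod C" "Cod (op_cat C) = Dom C"
  "Ide (op_cat C) = Ide C" "g \<cdot>\<^bsub>op_cat C\<^esub> f = f \<cdot>\<^bsub>C\<^esub> g"
  by (simp_all add: op_cat_def)

lemma hom_op: "hom (op_cat C) x y = hom C y x"
  by auto

lemma op_op_cat [simp]: "op_cat (op_cat C) = C"
  by (simp add: op_cat_def)

lemma op_functor_simps [simp]: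
  "Src (op_functor F) = op_cat (Src F)" "Tgt (op_functor F) = op_cat (Tgt F)"
  "FO (op_functor F) = FO F" "FA (op_functor F) = FA F"
  by (simp_all add: op_functor_def)

lemma op_nattrans_simps [simp]:
  "NSrc (op_nattrans \<tau>) = op_functor (NTgt \<tau>)" "NTgt (op_nattrans \<tau>) = op_functor (NSrc \<tau>)"
  "NC (op_nattrans \<tau>) = NC \<tau>"
  by (simp_all add: op_nattrans_def)

lemma op_op_functor [simp]: "op_functor (op_functor F) = F"
  by (simp add: op_functor_def)

lemma op_functor_comp: "op_functor (G \<circ>\<^sub>F F) = op_functor G \<circ>\<^sub>F op_functor F"
  by (simp add: op_functor_def comp_functor_def)

lemma op_functor_id: "op_functor (id_functor C) = id_functor (op_cat C)"
  by (simp add: op_functor_def id_functor_def)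

lemma category_op: "category C \<Longrightarrow> category (op_cat C)"
proof -
  assume "category C"
  then interpret category C .
  show ?thesis by unfold_locales auto
qed

lemma funct_op: "funct C D F \<Longrightarrow> funct (op_cat C) (op_cat D) (op_functor F)"
proof -
  assume "funct C D F"
  then interpret funct C D F .
  show ?thesis
    by (rule funct_intro) (use ext in \<open>auto simp: category_op dom.category_axioms cod.category_axioms\<close>)
qed

lemma nattr_op:
  assumes "nattr C D F G \<tau>"
  shows "nattr (op_cat C) (op_cat D) (op_functor G) (op_functor F) (op_nattrans \<tau>)"
proof -
  interpret nattr C D F G \<tau> by fact
  show ?thesis
    by (rule nattr_intro[OF funct_op funct_op])
      (use ext in \<open>auto simp: natural S.funct_axioms T.funct_axioms\<close>)
qed

lemma is_iso_op [simp]: "is_iso (op_cat C) f \<longleftrightarrow> is_iso C f"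
  by (auto simp: is_iso_def is_inverse_def)

lemma univ_from_op [simp]: "univ_from (op_functor U) X A h \<longleftrightarrow> univ_to U X A h"
  unfolding univ_from_def univ_to_def by (simp add: hom_op conj_commute conj_left_commute)

context funct
begin

lemma univ_to_arr:
  assumes "univ_to F X A e"
  shows "A \<in> Obj C" "e \<in> Arr D" "Cod D e = X" "Dom D e = FO F A" "X \<in> Obj D"
  using assms by (auto simp: univ_to_def)

lemmas op = funct_op[OF funct_axioms]

lemma univ_toE:
  assumes "univ_to F X A e" "g \<in> Arr D" "Cod D g = X" "Dom D g = FO F B" "B \<in> Obj C"
  obtains f where "f \<in> Arr C" "Cod C f = A" "Dom C f = B" "e \<cdot>\<^bsub>D\<^esub> FA F f = g"
  using funct.univ_fromE[OF op, of X A e g B] assms by auto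

lemma univ_to_eq:
  assumes "univ_to F X A e" "f \<in> Arr C" "f' \<in> Arr C" "Cod C f = A" "Cod C f' = A"
    "Dom C f = Dom C f'" "e \<cdot>\<^bsub>D\<^esub> FA F f = e \<cdot>\<^bsub>D\<^esub> FA F f'"
  shows "f = f'"
  using funct.univ_from_eq[OF op, of X A e f f'] assms by simp

lemma univ_toI:
  assumes "A \<in> Obj C" "e \<in> hom D (FO F A) X"
    "\<And>B g. \<lbrakk>B \<in> Obj C; g \<in> Arr D; Cod D g = X; Dom D g = FO F B\<rbrakk>
       \<Longrightarrow> \<exists>f \<in> hom C B A. e \<cdot>\<^bsub>D\<^esub> FA F f = g"
    "\<And>f f'. \<lbrakk>f \<in> Arr C; f' \<in> Arr C; Cod C f = A; Cod C f' = A; Dom C f = Dom C f';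
       e \<cdot>\<^bsub>D\<^esub> FA F f = e \<cdot>\<^bsub>D\<^esub> FA F f'\<rbrakk> \<Longrightarrow> f = f'"
  shows "univ_to F X A e"
proof -
  have "univ_from (op_functor F) X A e"
  proof (rule funct.univ_fromI[OF op])
    show "\<exists>f \<in> hom (op_cat C) A B. FA (op_functor F) f \<cdot>\<^bsub>op_cat D\<^esub> e = g"
      if "B \<in> Obj (op_cat C)" "g \<in> Arr (op_cat D)" "Dom (op_cat D) g = X"
        "Cod (op_cat D) g = FO (op_functor F) B" for B g
      using assms(3)[of B g] that by (simp add: hom_op del: in_hom)
  qed (use assms in auto)
  then show ?thesis by simp
qed

lemma univ_to_along_iso:
  assumes "univ_to F X A e" "is_iso C f" "Cod C f = A" "Dom C f = B"
  shows "univ_to F X B (e \<cdot>\<^bsub>D\<^esub> FA F f)"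
  using funct.univ_from_along_iso[OF op, of X A e f B] assms by simp

lemma univ_to_postcomp_iso:
  assumes "univ_to F X A e" "is_iso D s" "Dom D s = X" "Cod D s = Y"
  shows "univ_to F Y A (s \<cdot>\<^bsub>D\<^esub> e)"
  using funct.univ_from_precomp_iso[OF op, of X A e s Y] assms by simp

lemma univ_to_unique:
  assumes "univ_to F X A e" "univ_to F X B e'"
  obtains f where "is_iso C f" "Cod C f = A" "Dom C f = B" "e \<cdot>\<^bsub>D\<^esub> FA F f = e'"
  using funct.univ_from_unique[OF op, of X A e B e'] assms by auto

end

section \<open>Adjunctions and mates\<close>

locale adj = L: funct C D L + R: funct D C R +
    unit: nattr C C "id_functor C" "R \<circ>\<^sub>F L" \<eta> + counit: nattr D D "L \<circ>\<^sub>F R" "id_functor D" \<epsilon>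
  for C :: "('o, 'a) cat" and D :: "('p, 'b) cat" and L R \<eta> \<epsilon> +
  assumes triangle_left: "x \<in> Obj C \<Longrightarrow> NC \<epsilon> (FO L x) \<cdot>\<^bsub>D\<^esub> FA L (NC \<eta> x) = Ide D (FO L x)"
    and triangle_right: "y \<in> Obj D \<Longrightarrow> FA R (NC \<epsilon> y) \<cdot>\<^bsub>C\<^esub> NC \<eta> (FO R y) = Ide C (FO R y)"

lemma adjI:
  assumes "adjunction L R \<eta> \<epsilon>" "Src L = C" "Tgt L = D"
  shows "adj C D L R \<eta> \<epsilon>"
proof -
  interpret L: funct C D L
    using assms by (intro functI) (auto simp: adjunction_def functor_between_def)
  interpret R: funct D C R
    using assms by (intro functI) (auto simp: adjunction_def functor_between_def)
  interpret unit: nattr C C "id_functor C" "R \<circ>\<^sub>F L" \<eta>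
    using assms by (intro nattrI) (auto simp: adjunction_def)
  interpret counit: nattr D D "L \<circ>\<^sub>F R" "id_functor D" \<epsilon>
    using assms by (intro nattrI) (auto simp: adjunction_def)
  have eq: "NC ((\<epsilon> \<rhd> L) \<circ>\<^sub>N (L \<lhd> \<eta>)) x = NC (id_nattrans L) x"
      "NC ((R \<lhd> \<epsilon>) \<circ>\<^sub>N (\<eta> \<rhd> R)) y = NC (id_nattrans R) y" for x y
    using assms(1) by (auto simp: adjunction_def)
  show ?thesis
  proof
    show "NC \<epsilon> (FO L x) \<cdot>\<^bsub>D\<^esub> FA L (NC \<eta> x) = Ide D (FO L x)" if "x \<in> Obj C" for x
      using eq(1)[of x] that by simp
    show "FA R (NC \<epsilon> y) \<cdot>\<^bsub>C\<^esub> NC \<eta> (FO R y) = Ide C (FO R y)" if "y \<in> Obj D" for y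
      using eq(2)[of y] that by simp
  qed
qed

context adj
begin

lemma adjunction: "adjunction L R \<eta> \<epsilon>"
proof -
  have "(\<epsilon> \<rhd> L) \<circ>\<^sub>N (L \<lhd> \<eta>) = id_nattrans L"
    by (rule nattrans_eqI[of C D L L]) (auto simp: triangle_left intro!: nattrI simp: nattrans_between_def)
  moreover have "(R \<lhd> \<epsilon>) \<circ>\<^sub>N (\<eta> \<rhd> R) = id_nattrans R"
    by (rule nattrans_eqI[of D C R R]) (auto simp: triangle_right intro!: nattrI simp: nattrans_between_def)
  ultimately show ?thesis
    by (simp add: adjunction_def unit.between counit.between)
qed

lemma op: "adj (op_cat D) (op_cat C) (op_functor R) (op_functor L) (op_nattrans \<epsilon>) (op_nattrans \<eta>)"
proof -
  interpret R: funct "op_cat D" "op_cat C" "op_functor R" by (rule R.op)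
  interpret L: funct "op_cat C" "op_cat D" "op_functor L" by (rule L.op)
  interpret unit': nattr "op_cat D" "op_cat D" "id_functor (op_cat D)"
      "op_functor L \<circ>\<^sub>F op_functor R" "op_nattrans \<epsilon>"
    using nattr_op[OF counit.nattr_axioms] by (simp add: op_functor_comp op_functor_id)
  interpret counit': nattr "op_cat C" "op_cat C" "op_functor R \<circ>\<^sub>F op_functor L"
      "id_functor (op_cat C)" "op_nattrans \<eta>"
    using nattr_op[OF unit.nattr_axioms] by (simp add: op_functor_comp op_functor_id)
  show ?thesis by unfold_locales (auto simp: triangle_left triangle_right)
qed

lemma transpose_transpose:
  assumes "w \<in> Arr C" "Dom C w = X" "Cod C w = FO R B" "B \<in> Obj D"
  shows "FA R (NC \<epsilon> B \<cdot>\<^bsub>D\<^esub> FA L w) \<cdot>\<^bsub>C\<^esub> NC \<eta> X = w"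
proof -
  have X: "X \<in> Obj C" using assms by auto
  have "FA R (FA L w) \<cdot>\<^bsub>C\<^esub> NC \<eta> X = NC \<eta> (FO R B) \<cdot>\<^bsub>C\<^esub> w"
    using unit.natural[of w X "FO R B"] assms by simp
  then have "FA R (NC \<epsilon> B \<cdot>\<^bsub>D\<^esub> FA L w) \<cdot>\<^bsub>C\<^esub> NC \<eta> X = FA R (NC \<epsilon> B) \<cdot>\<^bsub>C\<^esub> NC \<eta> (FO R B) \<cdot>\<^bsub>C\<^esub> w"
    using assms X by simp
  also have "\<dots> = w"
    using L.dom.reassoc1[OF triangle_right, of B w] assms by simp
  finally show ?thesis .
qed

lemma unit_universal: "X \<in> Obj C \<Longrightarrow> univ_from R X (FO L X) (NC \<eta> X)"
proof (rule R.univ_fromI)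
  fix B g assume X: "X \<in> Obj C" and g: "B \<in> Obj D" "g \<in> Arr C" "Dom C g = X" "Cod C g = FO R B"
  show "\<exists>f \<in> hom D (FO L X) B. FA R f \<cdot>\<^bsub>C\<^esub> NC \<eta> X = g"
    by (rule bexI, rule transpose_transpose[OF g(2-4,1)]) (use g X in auto)
next
  fix f f' assume X: "X \<in> Obj C" and f: "f \<in> Arr D" "f' \<in> Arr D" "Dom D f = FO L X" "Dom D f' = FO L X"
    "Cod D f = Cod D f'" "FA R f \<cdot>\<^bsub>C\<^esub> NC \<eta> X = FA R f' \<cdot>\<^bsub>C\<^esub> NC \<eta> X"
  have *: "NC \<epsilon> (Cod D k) \<cdot>\<^bsub>D\<^esub> FA L (FA R k \<cdot>\<^bsub>C\<^esub> NC \<eta> X) = k" if k: "k \<in> Arr D" "Dom D k = FO L X" for k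
  proof -
    have "NC \<epsilon> (Cod D k) \<cdot>\<^bsub>D\<^esub> FA L (FA R k) \<cdot>\<^bsub>D\<^esub> FA L (NC \<eta> X) =
        k \<cdot>\<^bsub>D\<^esub> NC \<epsilon> (FO L X) \<cdot>\<^bsub>D\<^esub> FA L (NC \<eta> X)"
      by (rule L.cod.reassoc) (use counit.natural[of k "FO L X"] X k in auto)
    then show ?thesis using X k by (simp add: triangle_left)
  qed
  show "f = f'" using *[OF f(1,3)] *[OF f(2,4)] unfolding f(5,6) by (rule trans[OF sym])
qed auto

text \<open>
  The transpose of \<open>w\<close> is the unique arrow that carries the unit to \<open>w\<close>, and the unit is universal.
\<close>

lemma transpose_iso_iff:
  assumes w: "w \<in> Arr C" "Dom C w = X" "Cod C w = FO R B" "B \<in> Obj D"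
  shows "is_iso D (NC \<epsilon> B \<cdot>\<^bsub>D\<^esub> FA L w) \<longleftrightarrow> univ_from R X B w" (is "is_iso D ?t \<longleftrightarrow> _")
proof
  have X: "X \<in> Obj C" using w by auto
  note u = unit_universal[OF X]
  {
    assume "is_iso D ?t"
    then show "univ_from R X B w"
      using R.univ_from_along_iso[OF u, of ?t B] transpose_transpose[OF w] w X by simp
  next
    assume "univ_from R X B w"
    then obtain f where f: "is_iso D f" "Dom D f = FO L X" "Cod D f = B" "FA R f \<cdot>\<^bsub>C\<^esub> NC \<eta> X = w"
      using R.univ_from_unique[OF u] by metis
    have "f = ?t"
      by (rule R.univ_from_eq[OF u]) (use f transpose_transpose[OF w] w X in auto)
    then show "is_iso D ?t" using f by simp
  }
qed

lemma ess_image_iff: "A \<in> ess_image L \<longleftrightarrow> (\<exists>X h. univ_from R X A h)"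
proof
  assume "A \<in> ess_image L"
  then obtain X f where "X \<in> Obj C" "is_iso D f" "Dom D f = FO L X" "Cod D f = A"
    unfolding ess_image_def by (auto elim: L.cod.iso_objsE)
  then show "\<exists>X h. univ_from R X A h"
    using R.univ_from_along_iso[OF unit_universal] by blast
next
  assume "\<exists>X h. univ_from R X A h"
  then obtain X h where h: "univ_from R X A h" by blast
  then have X: "X \<in> Obj C" by (rule R.univ_from_arr)
  from R.univ_from_unique[OF unit_universal[OF X] h]
  obtain f where "is_iso D f" "Dom D f = FO L X" "Cod D f = A" by metis
  moreover have "A \<in> Obj D" using h by (rule R.univ_from_arr)
  ultimately show "A \<in> ess_image L"
    using X L.cod.iso_objsI[of f] unfolding ess_image_def by auto
qed

end

lemma (in adj) counit_universal: "Y \<in> Obj D \<Longrightarrow> univ_to L Y (FO R Y) (NC \<epsilon> Y)"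
  using adj.unit_universal[OF op, of Y] by simp

lemma (in adj) cotranspose_iso_iff:
  assumes "w \<in> Arr D" "Cod D w = Y" "Dom D w = FO L B" "B \<in> Obj C"
  shows "is_iso C (FA R w \<cdot>\<^bsub>C\<^esub> NC \<eta> B) \<longleftrightarrow> univ_to L Y B w"
  using adj.transpose_iso_iff[OF op, of w Y B] assms by simp

lemma (in adj) ess_image_right_iff: "A \<in> ess_image R \<longleftrightarrow> (\<exists>Y e. univ_to L Y A e)"
proof -
  have "iso_objs C x y" if "iso_objs (op_cat C) x y" for x y
  proof -
    from that obtain f where "is_iso C f" "Dom C f = y" "Cod C f = x"
      by (auto simp: iso_objs_def)
    then show ?thesis using L.dom.iso_objsI[of "inv_arr C f"] by simp
  qed
  moreover have "iso_objs (op_cat C) x y" if "iso_objs C x y" for x y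
  proof -
    from that obtain f where "is_iso C f" "Dom C f = x" "Cod C f = y"
      by (auto simp: iso_objs_def)
    then show ?thesis
      using category.iso_objsI[OF category_op[OF L.dom.category_axioms], of "inv_arr C f"] by simp
  qed
  ultimately have "iso_objs (op_cat C) = iso_objs C" by blast
  then have "ess_image (op_functor R) = ess_image R"
    by (simp add: ess_image_def)
  then show ?thesis using adj.ess_image_iff[OF op, of A] by simp
qed

lemma (in funct) left_adjoint_from_universal:
  assumes u: "\<And>X. X \<in> Obj D \<Longrightarrow> univ_from F X (l X) (h X)"
  shows "\<exists>L \<eta> \<epsilon>. adjunction L F \<eta> \<epsilon> \<and> (\<forall>X \<in> Obj D. NC \<eta> X = h X)"
proof -
  have [simp]: "l X \<in> Obj C" "h X \<in> Arr D" "Dom D (h X) = X" "Cod D (h X) = FO F (l X)"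
    if "X \<in> Obj D" for X
    using univ_from_arr[OF u[OF that]] by auto
  define t where "t X B g = (THE f. f \<in> hom C (l X) B \<and> FA F f \<cdot>\<^bsub>D\<^esub> h X = g)" for X B g
  have t: "t X B g \<in> hom C (l X) B \<and> FA F (t X B g) \<cdot>\<^bsub>D\<^esub> h X = g"
    if "X \<in> Obj D" "B \<in> Obj C" "g \<in> Arr D" "Dom D g = X" "Cod D g = FO F B" for X B g
    unfolding t_def by (rule theI') (use u[OF that(1)] that in \<open>auto simp: univ_from_def\<close>)
  then have [simp]: "t X B g \<in> Arr C" "Dom C (t X B g) = l X" "Cod C (t X B g) = B"
      "FA F (t X B g) \<cdot>\<^bsub>D\<^esub> h X = g"
    if "X \<in> Obj D" "B \<in> Obj C" "g \<in> Arr D" "Dom D g = X" "Cod D g = FO F B" for X B g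
    using that by auto
  note eqI = univ_from_eq[OF u]
  define La where "La f = t (Dom D f) (l (Cod D f)) (h (Cod D f) \<cdot>\<^bsub>D\<^esub> f)" for f
  have La [simp]: "La f \<in> Arr C" "Dom C (La f) = l (Dom D f)" "Cod C (La f) = l (Cod D f)"
      "FA F (La f) \<cdot>\<^bsub>D\<^esub> h (Dom D f) = h (Cod D f) \<cdot>\<^bsub>D\<^esub> f" if "f \<in> Arr D" for f
    using that unfolding La_def by auto
  define L where "L = \<lparr>Src = D, Tgt = C, FO = restrict l (Obj D), FA = restrict La (Arr D)\<rparr>"
  define \<eta> where "\<eta> = \<lparr>NSrc = id_functor D, NTgt = F \<circ>\<^sub>F L, NC = restrict h (Obj D)\<rparr>"
  define \<epsilon> where "\<epsilon> = \<lparr>NSrc = L \<circ>\<^sub>F F, NTgt = id_functor C,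
    NC = (\<lambda>B \<in> Obj C. t (FO F B) B (Ide D (FO F B)))\<rparr>"
  have L_simps [simp]: "Src L = D" "Tgt L = C" "\<And>X. X \<in> Obj D \<Longrightarrow> FO L X = l X"
      "\<And>f. f \<in> Arr D \<Longrightarrow> FA L f = La f"
    by (simp_all add: L_def)
  interpret L: funct D C L
  proof (rule funct_intro)
    show "FA L (Ide D X) = Ide C (FO L X)" if "X \<in> Obj D" for X
      using that by simp (rule eqI, use La(4)[of "Ide D X"] that in auto)
    show "FA L (g \<cdot>\<^bsub>D\<^esub> f) = FA L g \<cdot>\<^bsub>C\<^esub> FA L f"
      if "f \<in> Arr D" "g \<in> Arr D" "Cod D f = Dom D g" for f g
    proof -
      have 1: "FA F (La g) \<cdot>\<^bsub>D\<^esub> h (Cod D f) = h (Cod D g) \<cdot>\<^bsub>D\<^esub> g" using La(4)[of g] that by simp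
      have "La (g \<cdot>\<^bsub>D\<^esub> f) = La g \<cdot>\<^bsub>C\<^esub> La f"
        by (rule eqI[of "Dom D f"])
          (use that La(4)[of "g \<cdot>\<^bsub>D\<^esub> f"] cod.reassoc[OF 1, of f] in auto)
      then show ?thesis using that by simp
    qed
  qed (auto simp: L_def cod.category_axioms dom.category_axioms)
  interpret \<eta>: nattr D D "id_functor D" "F \<circ>\<^sub>F L" \<eta>
    by (rule nattr_intro)
      (auto simp: \<eta>_def cod.category_axioms intro: funct_id funct_comp L.funct_axioms funct_axioms)
  interpret \<epsilon>: nattr C C "L \<circ>\<^sub>F F" "id_functor C" \<epsilon>
  proof (rule nattr_intro)
    fix f assume f: "f \<in> Arr C"
    let ?X = "Dom C f" and ?Y = "Cod C f"
    let ?tX = "t (FO F ?X) ?X (Ide D (FO F ?X))" and ?tY = "t (FO F ?Y) ?Y (Ide D (FO F ?Y))"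
    have 1: "FA F ?tY \<cdot>\<^bsub>D\<^esub> FA F (La (FA F f)) \<cdot>\<^bsub>D\<^esub> h (FO F ?X) = FA F f"
      using f La(4)[of "FA F f"] cod.reassoc1[of "FA F ?tY" "h (FO F ?Y)" "Ide D (FO F ?Y)" "FA F f"]
      by simp
    have "?tY \<cdot>\<^bsub>C\<^esub> La (FA F f) = f \<cdot>\<^bsub>C\<^esub> ?tX"
      by (rule eqI[of "FO F ?X"]) (use f 1 in auto)
    then show "NC \<epsilon> ?Y \<cdot>\<^bsub>C\<^esub> FA (L \<circ>\<^sub>F F) f = FA (id_functor C) f \<cdot>\<^bsub>C\<^esub> NC \<epsilon> ?X"
      using f by (simp add: \<epsilon>_def)
  qed (auto simp: \<epsilon>_def dom.category_axioms intro: funct_id funct_comp L.funct_axioms funct_axioms)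
  interpret adj D C L F \<eta> \<epsilon>
  proof
    fix X assume X: "X \<in> Obj D"
    let ?t = "t (FO F (l X)) (l X) (Ide D (FO F (l X)))"
    have "FA F ?t \<cdot>\<^bsub>D\<^esub> FA F (La (h X)) \<cdot>\<^bsub>D\<^esub> h X = h X"
      using X La(4)[of "h X"] cod.reassoc1[of "FA F ?t" "h (FO F (l X))" "Ide D (FO F (l X))" "h X"]
      by simp
    then have "?t \<cdot>\<^bsub>C\<^esub> La (h X) = Ide C (l X)"
      by (intro eqI[of X]) (use X in auto)
    then show "NC \<epsilon> (FO L X) \<cdot>\<^bsub>C\<^esub> FA L (NC \<eta> X) = Ide C (FO L X)"
      using X by (simp add: \<epsilon>_def \<eta>_def)
  qed (auto simp: \<epsilon>_def \<eta>_def)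
  have "\<forall>X \<in> Obj D. NC \<eta> X = h X" by (simp add: \<eta>_def)
  then show ?thesis using adjunction by blast
qed

lemma (in funct) right_adjoint_from_universal:
  assumes "\<And>X. X \<in> Obj D \<Longrightarrow> univ_to F X (r X) (e X)"
  shows "\<exists>R \<eta> \<epsilon>. adjunction F R \<eta> \<epsilon> \<and> (\<forall>X \<in> Obj D. NC \<epsilon> X = e X)"
proof -
  have "\<exists>L \<eta> \<epsilon>. adjunction L (op_functor F) \<eta> \<epsilon> \<and> (\<forall>X \<in> Obj (op_cat D). NC \<eta> X = e X)"
    by (rule funct.left_adjoint_from_universal[OF op]) (use assms in auto)
  then obtain L \<eta> \<epsilon> where a: "adjunction L (op_functor F) \<eta> \<epsilon>" "\<forall>X \<in> Obj D. NC \<eta> X = e X"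
    by auto
  then have "Src L = op_cat D" "Tgt L = op_cat C" by (auto simp: adjunction_def)
  then interpret adj "op_cat D" "op_cat C" L "op_functor F" \<eta> \<epsilon>
    using a by (intro adjI)
  show ?thesis
    using adj.adjunction[OF op] a(2) by (auto intro!: exI)
qed

lemma (in funct) left_adjoint_iff:
  "(\<exists>L \<eta> \<epsilon>. adjunction L F \<eta> \<epsilon>) \<longleftrightarrow> (\<forall>X \<in> Obj D. \<exists>A h. univ_from F X A h)"
proof
  assume "\<exists>L \<eta> \<epsilon>. adjunction L F \<eta> \<epsilon>"
  then obtain L \<eta> \<epsilon> where a: "adjunction L F \<eta> \<epsilon>" by blast
  then have "Src L = D" "Tgt L = C" by (auto simp: adjunction_def)
  then interpret adj D C L F \<eta> \<epsilon> using a by (intro adjI)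
  show "\<forall>X \<in> Obj D. \<exists>A h. univ_from F X A h" using unit_universal by blast
next
  assume "\<forall>X \<in> Obj D. \<exists>A h. univ_from F X A h"
  then obtain l h where "\<And>X. X \<in> Obj D \<Longrightarrow> univ_from F X (l X) (h X)" by metis
  then show "\<exists>L \<eta> \<epsilon>. adjunction L F \<eta> \<epsilon>" using left_adjoint_from_universal by blast
qed

lemma (in funct) right_adjoint_iff:
  "(\<exists>R \<eta> \<epsilon>. adjunction F R \<eta> \<epsilon>) \<longleftrightarrow> (\<forall>X \<in> Obj D. \<exists>A e. univ_to F X A e)"
proof
  assume "\<exists>R \<eta> \<epsilon>. adjunction F R \<eta> \<epsilon>"
  then obtain R \<eta> \<epsilon> where a: "adjunction F R \<eta> \<epsilon>" by blast
  then interpret adj C D F R \<eta> \<epsilon> by (intro adjI) auto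
  show "\<forall>X \<in> Obj D. \<exists>A e. univ_to F X A e" using counit_universal by blast
next
  assume "\<forall>X \<in> Obj D. \<exists>A e. univ_to F X A e"
  then obtain r e where "\<And>X. X \<in> Obj D \<Longrightarrow> univ_to F X (r X) (e X)" by metis
  then show "\<exists>R \<eta> \<epsilon>. adjunction F R \<eta> \<epsilon>" using right_adjoint_from_universal by blast
qed

text \<open>
  The component of the mate at \<open>X\<close> is the transpose of \<open>\<beta> \<circ> P \<eta>\<close> at \<open>X\<close>, so it is invertible iff
  the latter is universal. Since any two universal arrows from \<open>X\<close> differ by an isomorphism of their
  targets, this holds for the unit iff it holds for every universal arrow; in particular it is independent
  of the choice of the adjoints.
\<close>

lemma left_mate_iso_iff:
  assumes a: "adjunction L U \<eta> \<epsilon>" "adjunction L' U' \<eta>' \<epsilon>'"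
    and U: "funct C D U" "funct C' D' U'" and P: "funct D D' P" and K: "funct C C' K"
    and \<beta>: "nattr C D' (P \<circ>\<^sub>F U) (U' \<circ>\<^sub>F K) \<beta>"
  shows "is_nat_iso ((\<epsilon>' \<rhd> (K \<circ>\<^sub>F L)) \<circ>\<^sub>N (L' \<lhd> \<beta> \<rhd> L) \<circ>\<^sub>N ((L' \<circ>\<^sub>F P) \<lhd> \<eta>)) \<longleftrightarrow>
    (\<forall>X A h. univ_from U X A h \<longrightarrow>
       univ_from U' (FO P X) (FO K A) (NC \<beta> A \<cdot>\<^bsub>D'\<^esub> FA P h))"
proof -
  interpret U: funct C D U by fact
  interpret U': funct C' D' U' by fact
  interpret P: funct D D' P by fact
  interpret K: funct C C' K by fact
  interpret \<beta>: nattr C D' "P \<circ>\<^sub>F U" "U' \<circ>\<^sub>F K" \<beta> by fact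
  have "Src L = D" "Tgt L = C" "Src L' = D'" "Tgt L' = C'" using a by (auto simp: adjunction_def)
  then interpret A: adj D C L U \<eta> \<epsilon> + A': adj D' C' L' U' \<eta>' \<epsilon>'
    using a by (auto intro: adjI)
  let ?m = "(\<epsilon>' \<rhd> (K \<circ>\<^sub>F L)) \<circ>\<^sub>N (L' \<lhd> \<beta> \<rhd> L) \<circ>\<^sub>N ((L' \<circ>\<^sub>F P) \<lhd> \<eta>)"
  let ?w = "\<lambda>X. NC \<beta> (FO L X) \<cdot>\<^bsub>D'\<^esub> FA P (NC \<eta> X)"
  have "is_nattrans ?m" by simp
  then have "is_nat_iso ?m \<longleftrightarrow> (\<forall>X \<in> Obj D. is_iso C' (NC \<epsilon>' (FO K (FO L X)) \<cdot>\<^bsub>C'\<^esub> FA L' (?w X)))"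
    by (simp add: is_nat_iso_def)
  also have "\<dots> \<longleftrightarrow> (\<forall>X \<in> Obj D. univ_from U' (FO P X) (FO K (FO L X)) (?w X))"
    by (intro ball_cong refl A'.transpose_iso_iff) auto
  also have "\<dots> \<longleftrightarrow> (\<forall>X A h. univ_from U X A h \<longrightarrow>
       univ_from U' (FO P X) (FO K A) (NC \<beta> A \<cdot>\<^bsub>D'\<^esub> FA P h))" (is "?l \<longleftrightarrow> ?r")
  proof
    assume l: ?l
    show ?r
    proof (intro allI impI)
      fix X A h assume h: "univ_from U X A h"
      then have X: "X \<in> Obj D" and [simp]: "h \<in> Arr D" "Dom D h = X"
        using U.univ_from_arr by auto
      obtain f where f: "is_iso C f" "Dom C f = FO L X" "Cod C f = A" "FA U f \<cdot>\<^bsub>D\<^esub> NC \<eta> X = h"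
        using U.univ_from_unique[OF A.unit_universal[OF X] h] .
      have "univ_from U' (FO P X) (FO K A) (FA U' (FA K f) \<cdot>\<^bsub>D'\<^esub> ?w X)"
        by (rule U'.univ_from_along_iso) (use l X f in auto)
      moreover have "FA U' (FA K f) \<cdot>\<^bsub>D'\<^esub> ?w X = NC \<beta> A \<cdot>\<^bsub>D'\<^esub> FA P h"
        using X f \<beta>.natural[of f "FO L X" A]
          U'.cod.reassoc[of "FA U' (FA K f)" "NC \<beta> (FO L X)" "NC \<beta> A" "FA P (FA U f)" "FA P (NC \<eta> X)"]
        by (auto simp flip: f(4))
      ultimately show "univ_from U' (FO P X) (FO K A) (NC \<beta> A \<cdot>\<^bsub>D'\<^esub> FA P h)" by simp
    qed
  qed (use A.unit_universal in blast)
  finally show ?thesis .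
qed

lemma right_mate_iso_iff:
  assumes a: "adjunction U R \<eta> \<epsilon>" "adjunction U' R' \<eta>' \<epsilon>'"
    and U: "funct C D U" "funct C' D' U'" and P: "funct D D' P" and K: "funct C C' K"
    and \<beta>: "nattr C D' (U' \<circ>\<^sub>F K) (P \<circ>\<^sub>F U) \<beta>"
  shows "is_nat_iso (((R' \<circ>\<^sub>F P) \<lhd> \<epsilon>) \<circ>\<^sub>N (R' \<lhd> \<beta> \<rhd> R) \<circ>\<^sub>N (\<eta>' \<rhd> (K \<circ>\<^sub>F R))) \<longleftrightarrow>
    (\<forall>X A e. univ_to U X A e \<longrightarrow>
       univ_to U' (FO P X) (FO K A) (FA P e \<cdot>\<^bsub>D'\<^esub> NC \<beta> A))" (is "is_nat_iso ?m \<longleftrightarrow> _")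
proof -
  interpret U: funct C D U by fact
  interpret U': funct C' D' U' by fact
  interpret P: funct D D' P by fact
  interpret K: funct C C' K by fact
  interpret \<beta>: nattr C D' "U' \<circ>\<^sub>F K" "P \<circ>\<^sub>F U" \<beta> by fact
  interpret A: adj C D U R \<eta> \<epsilon> + A': adj C' D' U' R' \<eta>' \<epsilon>'
    using a by (auto intro: adjI)
  \<comment> \<open>The mate of the opposite data has the same components.\<close>
  let ?o = "((op_nattrans \<eta>' \<rhd> (op_functor K \<circ>\<^sub>F op_functor R)) \<circ>\<^sub>N
    (op_functor R' \<lhd> op_nattrans \<beta> \<rhd> op_functor R) \<circ>\<^sub>N
    ((op_functor R' \<circ>\<^sub>F op_functor P) \<lhd> op_nattrans \<epsilon>))"
  interpret AO: adj "op_cat D" "op_cat C" "op_functor R" "op_functor U" "op_nattrans \<epsilon>" "op_nattrans \<eta>"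
    by (rule A.op)
  interpret AO': adj "op_cat D'" "op_cat C'" "op_functor R'" "op_functor U'" "op_nattrans \<epsilon>'" "op_nattrans \<eta>'"
    by (rule A'.op)
  interpret PO: funct "op_cat D" "op_cat D'" "op_functor P" by (rule P.op)
  interpret KO: funct "op_cat C" "op_cat C'" "op_functor K" by (rule K.op)
  interpret \<beta>O: nattr "op_cat C" "op_cat D'" "op_functor P \<circ>\<^sub>F op_functor U"
      "op_functor U' \<circ>\<^sub>F op_functor K" "op_nattrans \<beta>"
    using nattr_op[OF \<beta>] by (simp add: op_functor_comp)
  have "is_nattrans ?m" "is_nattrans ?o" by (simp_all add: op_functor_comp op_functor_id)
  then have "is_nat_iso ?m \<longleftrightarrow> is_nat_iso ?o"
    by (simp add: is_nat_iso_def)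
  then show ?thesis
    using left_mate_iso_iff[OF AO.adjunction AO'.adjunction AO.R.funct_axioms AO'.R.funct_axioms
        PO.funct_axioms KO.funct_axioms \<beta>O.nattr_axioms]
    by simp
qed

section \<open>Equivalences of categories\<close>

context funct
begin

definition fully_faithful :: bool where
  "fully_faithful \<longleftrightarrow> (\<forall>X \<in> Obj C. \<forall>Y \<in> Obj C. \<forall>g \<in> hom D (FO F X) (FO F Y).
     \<exists>!f. f \<in> hom C X Y \<and> FA F f = g)"

definition ess_surjective :: bool where
  "ess_surjective \<longleftrightarrow> (\<forall>Y \<in> Obj D. \<exists>X \<in> Obj C. iso_objs D (FO F X) Y)"

lemma fully_faithfulE:
  assumes "fully_faithful" "X \<in> Obj C" "Y \<in> Obj C" "g \<in> hom D (FO F X) (FO F Y)"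
  obtains f where "f \<in> hom C X Y" "FA F f = g"
  using assms unfolding fully_faithful_def by blast

lemma fully_faithful_eq:
  assumes ff: "fully_faithful" and f: "f \<in> Arr C" "f' \<in> Arr C" "Dom C f = Dom C f'"
    "Cod C f = Cod C f'" "FA F f = FA F f'"
  shows "f = f'"
proof -
  have "\<exists>!k. k \<in> hom C (Dom C f) (Cod C f) \<and> FA F k = FA F f"
    using ff f(1) unfolding fully_faithful_def by simp
  then show ?thesis using f by auto
qed

text \<open>
  For a fully faithful functor, an invertible arrow onto \<open>Y\<close> is a value of the right adjoint at \<open>Y\<close>.
  An equivalence therefore has its quasi-inverse as a right adjoint with invertible unit and counit.
\<close>

lemma iso_universal:
  assumes ff: "fully_faithful" and s: "is_iso D s" "Dom D s = FO F A" "Cod D s = Y" and A: "A \<in> Obj C"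
  shows "univ_to F Y A s"
proof (rule univ_toI)
  fix B g assume g: "B \<in> Obj C" "g \<in> Arr D" "Cod D g = Y" "Dom D g = FO F B"
  obtain f where "f \<in> hom C B A" "FA F f = inv_arr D s \<cdot>\<^bsub>D\<^esub> g"
    by (rule fully_faithfulE[OF ff, of B A "inv_arr D s \<cdot>\<^bsub>D\<^esub> g"]) (use A s g in auto)
  then show "\<exists>f \<in> hom C B A. s \<cdot>\<^bsub>D\<^esub> FA F f = g"
    using s g by (intro bexI[where x = f]) auto
next
  fix f f' assume f: "f \<in> Arr C" "f' \<in> Arr C" "Cod C f = A" "Cod C f' = A" "Dom C f = Dom C f'"
    "s \<cdot>\<^bsub>D\<^esub> FA F f = s \<cdot>\<^bsub>D\<^esub> FA F f'"
  then have "FA F f = FA F f'" using s by (subst (asm) cod.iso_cancel_left) auto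
  then show "f = f'" using f by (intro fully_faithful_eq[OF ff]) auto
qed (use s A in auto)

lemma is_equivalence_iff: "is_equivalence F \<longleftrightarrow> fully_faithful \<and> ess_surjective"
proof
  assume "is_equivalence F"
  then obtain G \<eta> \<epsilon> where *: "functor_between G D C" "is_nat_iso \<eta>" "NSrc \<eta> = id_functor C"
      "NTgt \<eta> = G \<circ>\<^sub>F F" "is_nat_iso \<epsilon>" "NSrc \<epsilon> = F \<circ>\<^sub>F G" "NTgt \<epsilon> = id_functor D"
    unfolding is_equivalence_def by auto
  interpret G: funct D C G using *(1) by (rule functI)
  interpret \<eta>: nattr C C "id_functor C" "G \<circ>\<^sub>F F" \<eta>
    by (rule nattrI) (use * in \<open>auto simp: nattrans_between_def is_nat_iso_def\<close>)
  interpret \<epsilon>: nattr D D "F \<circ>\<^sub>F G" "id_functor D" \<epsilon>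
    by (rule nattrI) (use * in \<open>auto simp: nattrans_between_def is_nat_iso_def\<close>)
  have iso [simp]: "is_iso C (NC \<eta> X)" if "X \<in> Obj C" for X
    using *(2) that by (simp add: is_nat_iso_iff[OF \<eta>.nattr_axioms])
  have iso' [simp]: "is_iso D (NC \<epsilon> Y)" if "Y \<in> Obj D" for Y
    using *(5) that by (simp add: is_nat_iso_iff[OF \<epsilon>.nattr_axioms])
  have G_faithful: "g = g'" if g: "g \<in> hom D X Y" "g' \<in> hom D X Y" "FA G g = FA G g'" for g g' X Y
  proof -
    have XY: "X \<in> Obj D" "Y \<in> Obj D" using g by auto
    have "g \<cdot>\<^bsub>D\<^esub> NC \<epsilon> X = g' \<cdot>\<^bsub>D\<^esub> NC \<epsilon> X"
      using \<epsilon>.natural[of g X Y] \<epsilon>.natural[of g' X Y] g by simp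
    then show ?thesis using g XY by (subst (asm) cod.iso_cancel_right) auto
  qed
  have F_faithful: "f = f'" if f: "f \<in> hom C X Y" "f' \<in> hom C X Y" "FA F f = FA F f'" for f f' X Y
  proof -
    have XY: "X \<in> Obj C" "Y \<in> Obj C" using f by auto
    have "NC \<eta> Y \<cdot>\<^bsub>C\<^esub> f = NC \<eta> Y \<cdot>\<^bsub>C\<^esub> f'"
      using \<eta>.natural[of f X Y] \<eta>.natural[of f' X Y] f by simp
    then show ?thesis using f XY by (subst (asm) dom.iso_cancel_left) auto
  qed
  have "fully_faithful"
    unfolding fully_faithful_def
  proof (intro ballI)
    fix X Y g assume X: "X \<in> Obj C" and Y: "Y \<in> Obj C" and g: "g \<in> hom D (FO F X) (FO F Y)"
    let ?f = "inv_arr C (NC \<eta> Y) \<cdot>\<^bsub>C\<^esub> FA G g \<cdot>\<^bsub>C\<^esub> NC \<eta> X"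
    have f: "?f \<in> hom C X Y" using X Y g by auto
    have "FA G (FA F ?f) \<cdot>\<^bsub>C\<^esub> NC \<eta> X = NC \<eta> Y \<cdot>\<^bsub>C\<^esub> ?f"
      using \<eta>.natural[of ?f X Y] f X Y by simp
    also have "\<dots> = FA G g \<cdot>\<^bsub>C\<^esub> NC \<eta> X" using X Y g by simp
    finally have "FA G (FA F ?f) = FA G g"
      using X Y g f by (subst (asm) dom.iso_cancel_right) auto
    then have "FA F ?f = g"
      using f g by (intro G_faithful[of _ "FO F X" "FO F Y"]) auto
    then show "\<exists>!f. f \<in> hom C X Y \<and> FA F f = g"
      using f by (intro ex1I[of _ ?f] conjI F_faithful[of _ X Y]) simp_all
  qed
  moreover have "ess_surjective"
    unfolding ess_surjective_def
  proof
    fix Y assume Y: "Y \<in> Obj D"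
    then show "\<exists>X \<in> Obj C. iso_objs D (FO F X) Y"
      using cod.iso_objsI[OF iso'[OF Y]] by (intro bexI[where x = "FO G Y"]) auto
  qed
  ultimately show "fully_faithful \<and> ess_surjective" ..
next
  assume ff: "fully_faithful \<and> ess_surjective"
  then have "\<forall>Y \<in> Obj D. \<exists>X s. X \<in> Obj C \<and> is_iso D s \<and> Dom D s = FO F X \<and> Cod D s = Y"
    unfolding ess_surjective_def by (metis cod.iso_objsE)
  then obtain r s where rs: "\<And>Y. Y \<in> Obj D \<Longrightarrow> r Y \<in> Obj C \<and> is_iso D (s Y) \<and>
      Dom D (s Y) = FO F (r Y) \<and> Cod D (s Y) = Y"
    by metis
  have "\<exists>R \<eta> \<epsilon>. adjunction F R \<eta> \<epsilon> \<and> (\<forall>Y \<in> Obj D. NC \<epsilon> Y = s Y)"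
    by (rule right_adjoint_from_universal[of r s]) (use ff rs iso_universal in blast)
  then obtain R \<eta> \<epsilon> where a: "adjunction F R \<eta> \<epsilon>" and \<epsilon>: "\<And>Y. Y \<in> Obj D \<Longrightarrow> NC \<epsilon> Y = s Y"
    by blast
  interpret adj C D F R \<eta> \<epsilon> using a by (intro adjI) auto
  have "is_iso C (NC \<eta> X)" if X: "X \<in> Obj C" for X
    using cotranspose_iso_iff[of "Ide D (FO F X)" "FO F X" X]
      iso_universal[of "Ide D (FO F X)" X "FO F X"] ff X by simp
  then have "is_nat_iso \<eta>" by (simp add: is_nat_iso_iff[OF unit.nattr_axioms])
  moreover have "is_nat_iso \<epsilon>" using \<epsilon> rs by (simp add: is_nat_iso_iff[OF counit.nattr_axioms])
  ultimately show "is_equivalence F"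
    unfolding is_equivalence_def src_tgt
    using is_functor R.between unit.src_tgt counit.src_tgt by blast
qed

end

text \<open>
  A functor into a product of categories, seen as the family of its components. In this form the modules
  over the factors are compared with the modules over the product one factor at a time.
\<close>

locale functor_family = dom: category C for C :: "('o, 'a) cat" +
  fixes I :: "'i set" and E :: "'i \<Rightarrow> ('p, 'b) cat" and F :: "'i \<Rightarrow> ('o, 'a, 'p, 'b) fnct"
  assumes family: "i \<in> I \<Longrightarrow> funct C (E i) (F i)"
begin

definition jointly_fully_faithful :: bool where
  "jointly_fully_faithful \<longleftrightarrow> (\<forall>X \<in> Obj C. \<forall>Y \<in> Obj C. \<forall>g.
     (\<forall>i \<in> I. g i \<in> hom (E i) (FO (F i) X) (FO (F i) Y)) \<longrightarrow>
     (\<exists>!f. f \<in> hom C X Y \<and> (\<forall>i \<in> I. FA (F i) f = g i)))"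

definition jointly_ess_surjective :: bool where
  "jointly_ess_surjective \<longleftrightarrow> (\<forall>Y. (\<forall>i \<in> I. Y i \<in> Obj (E i)) \<longrightarrow>
     (\<exists>X \<in> Obj C. \<forall>i \<in> I. iso_objs (E i) (FO (F i) X) (Y i)))"

lemma jointly_fullE:
  assumes jointly_fully_faithful "X \<in> Obj C" "Y \<in> Obj C"
    "\<And>i. i \<in> I \<Longrightarrow> g i \<in> hom (E i) (FO (F i) X) (FO (F i) Y)"
  obtains f where "f \<in> hom C X Y" "\<And>i. i \<in> I \<Longrightarrow> FA (F i) f = g i"
  using assms unfolding jointly_fully_faithful_def by metis

lemma jointly_faithful:
  assumes j: jointly_fully_faithful and f: "f \<in> Arr C" "f' \<in> Arr C" "Dom C f = Dom C f'"
    "Cod C f = Cod C f'" "\<And>i. i \<in> I \<Longrightarrow> FA (F i) f = FA (F i) f'"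
  shows "f = f'"
proof -
  have "FA (F i) f \<in> hom (E i) (FO (F i) (Dom C f)) (FO (F i) (Cod C f))" if i: "i \<in> I" for i
  proof -
    interpret F: funct C "E i" "F i" using i by (rule family)
    show ?thesis using f by simp
  qed
  then have "\<exists>!k. k \<in> hom C (Dom C f) (Cod C f) \<and> (\<forall>i \<in> I. FA (F i) k = FA (F i) f)"
    using j f(1) unfolding jointly_fully_faithful_def by simp
  then show ?thesis using f by auto
qed

abbreviation "Pr \<equiv> prod_cat I (\<lambda>i. Tgt (F i))"

lemma Tgt_F [simp]: "i \<in> I \<Longrightarrow> Tgt (F i) = E i"
  using family funct.src_tgt by blast

lemma prod_simps:
  "Obj Pr = (\<Pi>\<^sub>E i\<in>I. Obj (E i))" "Arr Pr = (\<Pi>\<^sub>E i\<in>I. Arr (E i))"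
  "Dom Pr f = (\<lambda>i\<in>I. Dom (E i) (f i))" "Cod Pr f = (\<lambda>i\<in>I. Cod (E i) (f i))"
  "Ide Pr X = (\<lambda>i\<in>I. Ide (E i) (X i))" "g \<cdot>\<^bsub>Pr\<^esub> f = (\<lambda>i\<in>I. g i \<cdot>\<^bsub>E i\<^esub> f i)"
  by (auto simp: prod_cat_def intro!: PiE_cong)

lemma cat_E: "i \<in> I \<Longrightarrow> category (E i)"
  using family funct_def by blast

lemma prod_hom_iff: "f \<in> hom Pr X Y \<longleftrightarrow> f \<in> extensional I \<and> X \<in> extensional I \<and> Y \<in> extensional I \<and>
    (\<forall>i \<in> I. f i \<in> hom (E i) (X i) (Y i))"
  by (auto simp: prod_simps PiE_iff extensional_def fun_eq_iff)

lemma category_prod: "category Pr"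
proof
  fix f X Y assume f: "f \<in> hom Pr X Y"
  then show "Ide Pr Y \<cdot>\<^bsub>Pr\<^esub> f = f" "f \<cdot>\<^bsub>Pr\<^esub> Ide Pr X = f"
    unfolding prod_hom_iff prod_simps
    by (auto intro!: extensionalityI[of _ I] simp: category.ide_simps[OF cat_E])
  fix g Z assume g: "g \<in> hom Pr Y Z"
  show "g \<cdot>\<^bsub>Pr\<^esub> f \<in> hom Pr X Z"
    using f g unfolding prod_hom_iff by (simp add: prod_simps category.comp_simps[OF cat_E])
  fix h W assume h: "h \<in> hom Pr Z W"
  show "h \<cdot>\<^bsub>Pr\<^esub> g \<cdot>\<^bsub>Pr\<^esub> f = (h \<cdot>\<^bsub>Pr\<^esub> g) \<cdot>\<^bsub>Pr\<^esub> f"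
    using f g h unfolding prod_hom_iff
    by (auto intro!: extensionalityI[of _ I] simp: prod_simps category.assoc[OF cat_E])
qed (auto simp: prod_simps PiE_iff category.obj_simps[OF cat_E] extensional_def fun_eq_iff)

lemma funct_tuple: "funct C Pr (tuple_functor C I F)"
proof (rule funct_intro)
  show "FA (tuple_functor C I F) f \<in>
      hom Pr (FO (tuple_functor C I F) (Dom C f)) (FO (tuple_functor C I F) (Cod C f))"
    if f: "f \<in> Arr C" for f
    using f unfolding prod_hom_iff by (simp add: tuple_functor_def funct.arr[OF family])
qed (auto simp: dom.category_axioms category_prod tuple_functor_def prod_simps fun_eq_iff
    funct.obj[OF family] funct.ide[OF family] funct.comp[OF family])

sublocale tuple: funct C Pr "tuple_functor C I F" by (rule funct_tuple)

lemma tuple_simps: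
  "X \<in> Obj C \<Longrightarrow> FO (tuple_functor C I F) X = (\<lambda>i\<in>I. FO (F i) X)"
  "f \<in> Arr C \<Longrightarrow> FA (tuple_functor C I F) f = (\<lambda>i\<in>I. FA (F i) f)"
  by (simp_all add: tuple_functor_def)

lemma prod_iso_iff: "iso_objs Pr X Y \<longleftrightarrow> X \<in> extensional I \<and> Y \<in> extensional I \<and>
    (\<forall>i \<in> I. iso_objs (E i) (X i) (Y i))"
proof
  assume "iso_objs Pr X Y"
  then obtain s r where s: "s \<in> hom Pr X Y" and sr: "is_inverse Pr s r"
    unfolding iso_objs_def is_iso_def by blast
  then have r: "r \<in> hom Pr Y X"
    by (simp add: category.is_inverse_iff[OF category_prod])
  have "iso_objs (E i) (X i) (Y i)" if i: "i \<in> I" for i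
  proof -
    have si: "s i \<in> hom (E i) (X i) (Y i)" "r i \<in> hom (E i) (Y i) (X i)"
      using s r i unfolding prod_hom_iff by auto
    have "r \<cdot>\<^bsub>Pr\<^esub> s = Ide Pr X" "s \<cdot>\<^bsub>Pr\<^esub> r = Ide Pr Y"
      using sr s by (auto simp: category.is_inverse_iff[OF category_prod])
    from fun_cong[OF this(1), of i] fun_cong[OF this(2), of i]
    have "is_iso (E i) (s i)"
      using si i by (intro category.is_isoI[OF cat_E, of i _ "r i"]) (auto simp: prod_simps)
    then show ?thesis using si unfolding iso_objs_def by blast
  qed
  then show "X \<in> extensional I \<and> Y \<in> extensional I \<and> (\<forall>i \<in> I. iso_objs (E i) (X i) (Y i))"
    using s unfolding prod_hom_iff by blast
next
  assume *: "X \<in> extensional I \<and> Y \<in> extensional I \<and> (\<forall>i \<in> I. iso_objs (E i) (X i) (Y i))"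
  then have "\<forall>i \<in> I. \<exists>s. s \<in> hom (E i) (X i) (Y i) \<and> is_iso (E i) s"
    unfolding iso_objs_def by blast
  then obtain s where s: "\<And>i. i \<in> I \<Longrightarrow> s i \<in> hom (E i) (X i) (Y i) \<and> is_iso (E i) (s i)" by metis
  let ?s = "\<lambda>i\<in>I. s i" and ?r = "\<lambda>i\<in>I. inv_arr (E i) (s i)"
  have sh: "?s \<in> hom Pr X Y" and rh: "?r \<in> hom Pr Y X"
    unfolding prod_hom_iff using * s by (auto simp: category.inv_simps[OF cat_E])
  have "is_iso Pr ?s"
  proof (rule category.is_isoI[OF category_prod])
    have "Dom Pr ?s = X" "Cod Pr ?s = Y" using sh by simp_all
    then show "?r \<cdot>\<^bsub>Pr\<^esub> ?s = Ide Pr (Dom Pr ?s)" "?s \<cdot>\<^bsub>Pr\<^esub> ?r = Ide Pr (Cod Pr ?s)"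
      using s by (auto simp: prod_simps category.inv_simps[OF cat_E] intro!: restrict_ext)
  qed (use sh rh in auto)
  then show "iso_objs Pr X Y" using sh unfolding iso_objs_def by blast
qed

lemma is_equivalence_tuple_iff:
  "is_equivalence (tuple_functor C I F) \<longleftrightarrow> jointly_fully_faithful \<and> jointly_ess_surjective"
proof -
  have "tuple.fully_faithful \<longleftrightarrow> jointly_fully_faithful"
  proof
    assume ff: "tuple.fully_faithful"
    show "jointly_fully_faithful"
      unfolding jointly_fully_faithful_def
    proof (intro ballI allI impI)
      fix X Y g
      assume X: "X \<in> Obj C" "Y \<in> Obj C" and g: "\<forall>i\<in>I. g i \<in> hom (E i) (FO (F i) X) (FO (F i) Y)"
      have "restrict g I \<in> hom Pr (FO (tuple_functor C I F) X) (FO (tuple_functor C I F) Y)"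
        unfolding prod_hom_iff using X g by (simp add: tuple_simps)
      then have "\<exists>!f. f \<in> hom C X Y \<and> FA (tuple_functor C I F) f = restrict g I"
        using ff X unfolding tuple.fully_faithful_def by blast
      moreover have "f \<in> hom C X Y \<and> FA (tuple_functor C I F) f = restrict g I \<longleftrightarrow>
          f \<in> hom C X Y \<and> (\<forall>i \<in> I. FA (F i) f = g i)" for f
        by (auto simp: tuple_simps fun_eq_iff restrict_def)
      ultimately show "\<exists>!f. f \<in> hom C X Y \<and> (\<forall>i\<in>I. FA (F i) f = g i)" by simp
    qed
  next
    assume jf: "jointly_fully_faithful"
    show "tuple.fully_faithful"
      unfolding tuple.fully_faithful_def
    proof (intro ballI)
      fix X Y g
      assume X: "X \<in> Obj C" "Y \<in> Obj C"
        and g: "g \<in> hom Pr (FO (tuple_functor C I F) X) (FO (tuple_functor C I F) Y)"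
      then have gi: "g \<in> extensional I" "\<forall>i\<in>I. g i \<in> hom (E i) (FO (F i) X) (FO (F i) Y)"
        unfolding prod_hom_iff by (auto simp: tuple_simps)
      then have "\<exists>!f. f \<in> hom C X Y \<and> (\<forall>i \<in> I. FA (F i) f = g i)"
        using jf X unfolding jointly_fully_faithful_def by blast
      moreover have "f \<in> hom C X Y \<and> FA (tuple_functor C I F) f = g \<longleftrightarrow>
          f \<in> hom C X Y \<and> (\<forall>i \<in> I. FA (F i) f = g i)" for f
        using gi(1) by (auto simp: tuple_simps intro!: extensionalityI[of _ I])
      ultimately show "\<exists>!f. f \<in> hom C X Y \<and> FA (tuple_functor C I F) f = g" by simp
    qed
  qed
  moreover have "tuple.ess_surjective \<longleftrightarrow> jointly_ess_surjective"
  proof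
    assume es: "tuple.ess_surjective"
    show "jointly_ess_surjective"
      unfolding jointly_ess_surjective_def
    proof (intro allI impI)
      fix Y assume Y: "\<forall>i \<in> I. Y i \<in> Obj (E i)"
      then have "restrict Y I \<in> Obj Pr" by (simp add: prod_simps)
      then obtain X where "X \<in> Obj C" "iso_objs Pr (FO (tuple_functor C I F) X) (restrict Y I)"
        using es unfolding tuple.ess_surjective_def by blast
      then show "\<exists>X \<in> Obj C. \<forall>i \<in> I. iso_objs (E i) (FO (F i) X) (Y i)"
        unfolding prod_iso_iff by (auto simp: tuple_simps)
    qed
  next
    assume es: "jointly_ess_surjective"
    show "tuple.ess_surjective"
      unfolding tuple.ess_surjective_def
    proof
      fix Y assume "Y \<in> Obj Pr"
      then have Y: "Y \<in> extensional I" "\<forall>i \<in> I. Y i \<in> Obj (E i)"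
        by (auto simp: prod_simps PiE_iff)
      then obtain X where "X \<in> Obj C" "\<forall>i \<in> I. iso_objs (E i) (FO (F i) X) (Y i)"
        using es unfolding jointly_ess_surjective_def by blast
      then show "\<exists>X \<in> Obj C. iso_objs Pr (FO (tuple_functor C I F) X) Y"
        unfolding prod_iso_iff using Y by (intro bexI[of _ X]) (auto simp: tuple_simps)
    qed
  qed
  ultimately show ?thesis by (simp add: tuple.is_equivalence_iff)
qed

end

section \<open>Modules over a monad\<close>

locale em_monad = T: funct C C T + mult: nattr C C "T \<circ>\<^sub>F T" T \<mu> + unit: nattr C C "id_functor C" T \<eta>
  for C :: "('o, 'a) cat" and T \<mu> \<eta> +
  assumes mult_assoc: "X \<in> Obj C \<Longrightarrow> NC \<mu> X \<cdot>\<^bsub>C\<^esub> FA T (NC \<mu> X) = NC \<mu> X \<cdot>\<^bsub>C\<^esub> NC \<mu> (FO T X)"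
    and unit_left: "X \<in> Obj C \<Longrightarrow> NC \<mu> X \<cdot>\<^bsub>C\<^esub> FA T (NC \<eta> X) = Ide C (FO T X)"
    and unit_right: "X \<in> Obj C \<Longrightarrow> NC \<mu> X \<cdot>\<^bsub>C\<^esub> NC \<eta> (FO T X) = Ide C (FO T X)"
begin

abbreviation Mods where "Mods \<equiv> em_cat T \<mu> \<eta>"

lemma mod_iff:
  "A \<in> Obj Mods \<longleftrightarrow> fst A \<in> Obj C \<and> snd A \<in> Arr C \<and> Dom C (snd A) = FO T (fst A) \<and>
     Cod C (snd A) = fst A \<and> snd A \<cdot>\<^bsub>C\<^esub> NC \<eta> (fst A) = Ide C (fst A) \<and>
     snd A \<cdot>\<^bsub>C\<^esub> NC \<mu> (fst A) = snd A \<cdot>\<^bsub>C\<^esub> FA T (snd A)"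
  by (auto simp: em_cat_def Let_def split: prod.splits)

lemma linear_iff:
  "(A, f, B) \<in> Arr Mods \<longleftrightarrow> A \<in> Obj Mods \<and> B \<in> Obj Mods \<and> f \<in> Arr C \<and> Dom C f = fst A \<and>
     Cod C f = fst B \<and> f \<cdot>\<^bsub>C\<^esub> snd A = snd B \<cdot>\<^bsub>C\<^esub> FA T f"
  by (auto simp: em_cat_def Let_def split: prod.splits)

lemma Mods_simps [simp]:
  "Dom Mods (A, f, B) = A" "Cod Mods (A, f, B) = B" "Ide Mods A = (A, Ide C (fst A), A)"
  "(B', g, B'') \<cdot>\<^bsub>Mods\<^esub> (A, f, A') = (A, g \<cdot>\<^bsub>C\<^esub> f, B'')"
  by (simp_all add: em_cat_def Let_def)

lemma mod_simps [simp]: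
  assumes "A \<in> Obj Mods"
  shows "fst A \<in> Obj C" "snd A \<in> Arr C" "Dom C (snd A) = FO T (fst A)" "Cod C (snd A) = fst A"
    "snd A \<cdot>\<^bsub>C\<^esub> NC \<eta> (fst A) = Ide C (fst A)"
  using assms by (auto simp: mod_iff)

lemma mod_mult: "A \<in> Obj Mods \<Longrightarrow> snd A \<cdot>\<^bsub>C\<^esub> NC \<mu> (fst A) = snd A \<cdot>\<^bsub>C\<^esub> FA T (snd A)"
  using mod_iff by blast

lemma modI:
  assumes "X \<in> Obj C" "l \<in> hom C (FO T X) X" "l \<cdot>\<^bsub>C\<^esub> NC \<eta> X = Ide C X"
    "l \<cdot>\<^bsub>C\<^esub> NC \<mu> X = l \<cdot>\<^bsub>C\<^esub> FA T l"
  shows "(X, l) \<in> Obj Mods"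
  using assms unfolding mod_iff by simp

lemma arrE:
  assumes "t \<in> Arr Mods" "Dom Mods t = A" "Cod Mods t = B"
  obtains f where "t = (A, f, B)" "(A, f, B) \<in> Arr Mods"
  using assms by (cases t) auto

lemma category_Mods: "category Mods"
proof
  show "t \<in> hom Mods A B \<Longrightarrow> s \<in> hom Mods B K \<Longrightarrow> s \<cdot>\<^bsub>Mods\<^esub> t \<in> hom Mods A K" for t s A B K
  proof -
    assume "t \<in> hom Mods A B" "s \<in> hom Mods B K"
    then obtain f g where t: "t = (A, f, B)" "s = (B, g, K)"
      and fg: "(A, f, B) \<in> Arr Mods" "(B, g, K) \<in> Arr Mods"
      using arrE[of t A B] arrE[of s B K] unfolding in_hom by metis
    have "g \<cdot>\<^bsub>C\<^esub> f \<cdot>\<^bsub>C\<^esub> snd A = g \<cdot>\<^bsub>C\<^esub> snd B \<cdot>\<^bsub>C\<^esub> FA T f" using fg by (simp add: linear_iff)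
    also have "\<dots> = snd K \<cdot>\<^bsub>C\<^esub> FA T g \<cdot>\<^bsub>C\<^esub> FA T f"
      by (rule T.dom.reassoc) (use fg in \<open>auto simp: linear_iff\<close>)
    finally show ?thesis using t fg by (simp add: linear_iff)
  qed
qed (auto simp: linear_iff split_paired_all)

sublocale Mods: category Mods by (rule category_Mods)

text \<open>
  Invert the linear map on both sides of the equation that says that it is linear.
\<close>

lemma is_iso_linear:
  assumes f: "(A, f, B) \<in> Arr Mods" and i: "is_iso C f"
  shows "(B, inv_arr C f, A) \<in> Arr Mods" "is_inverse Mods (A, f, B) (B, inv_arr C f, A)"
proof -
  note [simp] = f[unfolded linear_iff, THEN conjunct1] f[unfolded linear_iff, THEN conjunct2, THEN conjunct1]
  have [simp]: "Dom C f = fst A" "Cod C f = fst B" and eq: "f \<cdot>\<^bsub>C\<^esub> snd A = snd B \<cdot>\<^bsub>C\<^esub> FA T f"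
    using f by (auto simp: linear_iff)
  have "inv_arr C f \<cdot>\<^bsub>C\<^esub> snd B = inv_arr C f \<cdot>\<^bsub>C\<^esub> (snd B \<cdot>\<^bsub>C\<^esub> FA T f) \<cdot>\<^bsub>C\<^esub> FA T (inv_arr C f)"
    using i by (simp add: T.inv)
  also have "\<dots> = snd A \<cdot>\<^bsub>C\<^esub> FA T (inv_arr C f)"
    using i by (simp flip: eq)
  finally show *: "(B, inv_arr C f, A) \<in> Arr Mods"
    using f i by (simp add: linear_iff)
  then show "is_inverse Mods (A, f, B) (B, inv_arr C f, A)"
    using f i by (simp add: Mods.is_inverse_iff)
qed

lemma is_iso_Mods: "(A, f, B) \<in> Arr Mods \<Longrightarrow> is_iso Mods (A, f, B) \<longleftrightarrow> is_iso C f"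
proof
  assume f: "(A, f, B) \<in> Arr Mods"
  show "is_iso C f \<Longrightarrow> is_iso Mods (A, f, B)"
    using is_iso_linear[OF f] unfolding is_iso_def by blast
  assume "is_iso Mods (A, f, B)"
  then obtain t where t: "is_inverse Mods (A, f, B) t" unfolding is_iso_def by blast
  then obtain g where "t = (B, g, A)" "(B, g, A) \<in> Arr Mods"
    using arrE[of t B A] unfolding Mods.is_inverse_iff Mods_simps by metis
  then show "is_iso C f"
    using t f by (intro T.dom.is_isoI[of f g]) (auto simp: Mods.is_inverse_iff linear_iff)
qed

end

section \<open>Lifting a functor to modules\<close>

text \<open>
  If \<open>\<gamma>\<close> compares \<open>F \<circ> T\<close> with \<open>T' \<circ> F\<close>, a \<open>T\<close>-module \<open>(X, l)\<close> gives the \<open>T'\<close>-module \<open>F X\<close> with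
  action \<open>F l \<circ> \<gamma>\<^sup>-\<^sup>1\<close>.
\<close>

definition lift_obj :: "('p, 'b) cat \<Rightarrow> ('o, 'a, 'p, 'b) fnct \<Rightarrow> ('o, 'a, 'p, 'b) nattrans \<Rightarrow>
    'o \<times> 'a \<Rightarrow> 'p \<times> 'b" where
  "lift_obj C' F \<gamma> = (\<lambda>(X, l). (FO F X, FA F l \<cdot>\<^bsub>C'\<^esub> inv_arr C' (NC \<gamma> X)))"

lemma lift_obj_simps [simp]:
  "fst (lift_obj C' F \<gamma> A) = FO F (fst A)"
  "snd (lift_obj C' F \<gamma> A) = FA F (snd A) \<cdot>\<^bsub>C'\<^esub> inv_arr C' (NC \<gamma> (fst A))"
  by (simp_all add: lift_obj_def split: prod.splits)

text \<open>
  A morphism of monads with invertible comparison \<open>\<gamma>\<close>; pullback functors of a prederivator with a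
  monad are of this form. The inverse of \<open>\<gamma>\<close> is written \<open>\<delta>\<close>.
\<close>

locale monad_mor = M: em_monad C T \<mu> \<eta> + M': em_monad C' T' \<mu>' \<eta>' + F: funct C C' F +
    \<gamma>: nattr C C' "F \<circ>\<^sub>F T" "T' \<circ>\<^sub>F F" \<gamma>
  for C :: "('o, 'a) cat" and T \<mu> \<eta> and C' :: "('p, 'b) cat" and T' \<mu>' \<eta>' and F \<gamma> +
  assumes \<gamma>_iso: "X \<in> Obj C \<Longrightarrow> is_iso C' (NC \<gamma> X)"
    and \<gamma>_unit: "X \<in> Obj C \<Longrightarrow> NC \<gamma> X \<cdot>\<^bsub>C'\<^esub> FA F (NC \<eta> X) = NC \<eta>' (FO F X)"
    and \<gamma>_mult: "X \<in> Obj C \<Longrightarrow> NC \<gamma> X \<cdot>\<^bsub>C'\<^esub> FA F (NC \<mu> X) =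
          NC \<mu>' (FO F X) \<cdot>\<^bsub>C'\<^esub> FA T' (NC \<gamma> X) \<cdot>\<^bsub>C'\<^esub> NC \<gamma> (FO T X)"
begin

abbreviation \<delta> where "\<delta> X \<equiv> inv_arr C' (NC \<gamma> X)"

lemma \<gamma>_simps [simp]:
  assumes "X \<in> Obj C"
  shows "is_iso C' (NC \<gamma> X)" "NC \<gamma> X \<in> Arr C'" "Dom C' (NC \<gamma> X) = FO F (FO T X)"
    "Cod C' (NC \<gamma> X) = FO T' (FO F X)"
  using \<gamma>_iso[OF assms] \<gamma>.cpt[of X] assms by auto

lemma \<gamma>_natural:
  assumes "f \<in> Arr C" "Cod C f = Y"
  shows "NC \<gamma> Y \<cdot>\<^bsub>C'\<^esub> FA F (FA T f) = FA T' (FA F f) \<cdot>\<^bsub>C'\<^esub> NC \<gamma> (Dom C f)"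
    and "\<lbrakk>g \<in> Arr C'; Cod C' g = FO F (FO T (Dom C f))\<rbrakk> \<Longrightarrow>
      NC \<gamma> Y \<cdot>\<^bsub>C'\<^esub> FA F (FA T f) \<cdot>\<^bsub>C'\<^esub> g = FA T' (FA F f) \<cdot>\<^bsub>C'\<^esub> NC \<gamma> (Dom C f) \<cdot>\<^bsub>C'\<^esub> g"
proof -
  show 1: "NC \<gamma> Y \<cdot>\<^bsub>C'\<^esub> FA F (FA T f) = FA T' (FA F f) \<cdot>\<^bsub>C'\<^esub> NC \<gamma> (Dom C f)"
    using \<gamma>.natural[of f "Dom C f" Y] assms by simp
  show "NC \<gamma> Y \<cdot>\<^bsub>C'\<^esub> FA F (FA T f) \<cdot>\<^bsub>C'\<^esub> g = FA T' (FA F f) \<cdot>\<^bsub>C'\<^esub> NC \<gamma> (Dom C f) \<cdot>\<^bsub>C'\<^esub> g"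
    if "g \<in> Arr C'" "Cod C' g = FO F (FO T (Dom C f))"
    by (rule M'.T.dom.reassoc[OF 1]) (use assms that in auto)
qed

lemma \<delta>_natural:
  assumes "f \<in> Arr C" "Dom C f = X"
  shows "FA F (FA T f) \<cdot>\<^bsub>C'\<^esub> \<delta> X = \<delta> (Cod C f) \<cdot>\<^bsub>C'\<^esub> FA T' (FA F f)"
    and "\<lbrakk>g \<in> Arr C'; Cod C' g = FO T' (FO F X)\<rbrakk> \<Longrightarrow>
      FA F (FA T f) \<cdot>\<^bsub>C'\<^esub> \<delta> X \<cdot>\<^bsub>C'\<^esub> g = \<delta> (Cod C f) \<cdot>\<^bsub>C'\<^esub> FA T' (FA F f) \<cdot>\<^bsub>C'\<^esub> g"
proof -
  interpret \<delta>: nattr C C' "T' \<circ>\<^sub>F F" "F \<circ>\<^sub>F T" "inv_nattrans \<gamma>"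
    by (rule nattr_inv[OF \<gamma>.nattr_axioms]) simp
  show 1: "FA F (FA T f) \<cdot>\<^bsub>C'\<^esub> \<delta> X = \<delta> (Cod C f) \<cdot>\<^bsub>C'\<^esub> FA T' (FA F f)"
    using \<delta>.natural[of f X] assms by auto
  show "FA F (FA T f) \<cdot>\<^bsub>C'\<^esub> \<delta> X \<cdot>\<^bsub>C'\<^esub> g = \<delta> (Cod C f) \<cdot>\<^bsub>C'\<^esub> FA T' (FA F f) \<cdot>\<^bsub>C'\<^esub> g"
    if "g \<in> Arr C'" "Cod C' g = FO T' (FO F X)"
    by (rule M'.T.dom.reassoc[OF 1]) (use assms that in auto)
qed

lemma \<delta>_unit:
  assumes "X \<in> Obj C"
  shows "\<delta> X \<cdot>\<^bsub>C'\<^esub> NC \<eta>' (FO F X) = FA F (NC \<eta> X)"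
  using assms by (simp flip: \<gamma>_unit)

lemma \<delta>_mult:
  assumes "X \<in> Obj C"
  shows "\<delta> X \<cdot>\<^bsub>C'\<^esub> NC \<mu>' (FO F X) = FA F (NC \<mu> X) \<cdot>\<^bsub>C'\<^esub> \<delta> (FO T X) \<cdot>\<^bsub>C'\<^esub> FA T' (\<delta> X)"
proof -
  have "FA F (NC \<mu> X) = \<delta> X \<cdot>\<^bsub>C'\<^esub> NC \<gamma> X \<cdot>\<^bsub>C'\<^esub> FA F (NC \<mu> X)"
    using assms by simp
  then show ?thesis using assms by (simp add: \<gamma>_mult M'.T.inv)
qed

definition lift :: "('o \<times> 'a, ('o \<times> 'a) \<times> 'a \<times> ('o \<times> 'a), 'p \<times> 'b, ('p \<times> 'b) \<times> 'b \<times> ('p \<times> 'b)) fnct"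
  where "lift = \<lparr>Src = M.Mods, Tgt = M'.Mods, FO = (\<lambda>A \<in> Obj M.Mods. lift_obj C' F \<gamma> A),
    FA = (\<lambda>(A, f, B) \<in> Arr M.Mods. (lift_obj C' F \<gamma> A, FA F f, lift_obj C' F \<gamma> B))\<rparr>"

lemma lift_simps [simp]:
  "Src lift = M.Mods" "Tgt lift = M'.Mods" "A \<in> Obj M.Mods \<Longrightarrow> FO lift A = lift_obj C' F \<gamma> A"
  "(A, f, B) \<in> Arr M.Mods \<Longrightarrow> FA lift (A, f, B) = (lift_obj C' F \<gamma> A, FA F f, lift_obj C' F \<gamma> B)"
  by (simp_all add: lift_def)

lemma lift_obj [simp]:
  assumes "A \<in> Obj M.Mods"
  shows "lift_obj C' F \<gamma> A \<in> Obj M'.Mods"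
proof -
  let ?X = "fst A" and ?a = "snd A"
  have "(FA F ?a \<cdot>\<^bsub>C'\<^esub> \<delta> ?X) \<cdot>\<^bsub>C'\<^esub> NC \<eta>' (FO F ?X) = Ide C' (FO F ?X)"
    using assms by (simp add: \<delta>_unit flip: F.comp)
  moreover have "FA F ?a \<cdot>\<^bsub>C'\<^esub> \<delta> ?X \<cdot>\<^bsub>C'\<^esub> NC \<mu>' (FO F ?X) =
      FA F ?a \<cdot>\<^bsub>C'\<^esub> \<delta> ?X \<cdot>\<^bsub>C'\<^esub> FA T' (FA F ?a) \<cdot>\<^bsub>C'\<^esub> FA T' (\<delta> ?X)"
  proof -
    have "FA F ?a \<cdot>\<^bsub>C'\<^esub> \<delta> ?X \<cdot>\<^bsub>C'\<^esub> NC \<mu>' (FO F ?X) =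
        FA F ?a \<cdot>\<^bsub>C'\<^esub> FA F (NC \<mu> ?X) \<cdot>\<^bsub>C'\<^esub> \<delta> (FO T ?X) \<cdot>\<^bsub>C'\<^esub> FA T' (\<delta> ?X)"
      using assms by (simp add: \<delta>_mult)
    also have "\<dots> = FA F ?a \<cdot>\<^bsub>C'\<^esub> FA F (FA T ?a) \<cdot>\<^bsub>C'\<^esub> \<delta> (FO T ?X) \<cdot>\<^bsub>C'\<^esub> FA T' (\<delta> ?X)"
      by (rule M'.T.dom.reassoc) (use assms in \<open>auto simp: M.mod_mult simp flip: F.comp\<close>)
    also have "\<dots> = FA F ?a \<cdot>\<^bsub>C'\<^esub> \<delta> ?X \<cdot>\<^bsub>C'\<^esub> FA T' (FA F ?a) \<cdot>\<^bsub>C'\<^esub> FA T' (\<delta> ?X)"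
      using assms by (simp add: \<delta>_natural)
    finally show ?thesis .
  qed
  ultimately have "(FO F ?X, FA F ?a \<cdot>\<^bsub>C'\<^esub> \<delta> ?X) \<in> Obj M'.Mods"
    using assms by (intro M'.modI) (simp_all add: M'.T.inv)
  then show ?thesis by (simp add: lift_obj_def case_prod_beta)
qed

lemma lift_arr [simp]:
  assumes "(A, f, B) \<in> Arr M.Mods"
  shows "(lift_obj C' F \<gamma> A, FA F f, lift_obj C' F \<gamma> B) \<in> Arr M'.Mods"
proof -
  have "FA F f \<cdot>\<^bsub>C'\<^esub> FA F (snd A) \<cdot>\<^bsub>C'\<^esub> \<delta> (fst A) = FA F (snd B) \<cdot>\<^bsub>C'\<^esub> FA F (FA T f) \<cdot>\<^bsub>C'\<^esub> \<delta> (fst A)"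
    by (rule M'.T.dom.reassoc) (use assms in \<open>auto simp: M.linear_iff simp flip: F.comp\<close>)
  also have "\<dots> = FA F (snd B) \<cdot>\<^bsub>C'\<^esub> \<delta> (fst B) \<cdot>\<^bsub>C'\<^esub> FA T' (FA F f)"
    using assms by (simp add: M.linear_iff \<delta>_natural)
  finally show ?thesis
    using assms by (simp add: M.linear_iff M'.linear_iff)
qed

lemma funct_lift: "funct M.Mods M'.Mods lift"
proof (rule funct_intro)
  show "FA lift (s \<cdot>\<^bsub>M.Mods\<^esub> t) = FA lift s \<cdot>\<^bsub>M'.Mods\<^esub> FA lift t"
    if "t \<in> Arr M.Mods" "s \<in> Arr M.Mods" "Cod M.Mods t = Dom M.Mods s" for t s
  proof -
    note ts_arr = that
    from that obtain A f B g K where ts: "t = (A, f, B)" "s = (B, g, K)"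
        and a: "(A, f, B) \<in> Arr M.Mods" "(B, g, K) \<in> Arr M.Mods"
      using M.arrE[OF ts_arr(1) refl refl] M.arrE[OF ts_arr(2) refl refl] by metis
    have "(A, g \<cdot>\<^bsub>C\<^esub> f, K) \<in> Arr M.Mods" using M.Mods.comp_simps(1)[OF that] ts by simp
    then show ?thesis using ts a by (simp add: M.linear_iff)
  qed
  show "FA lift t \<in> hom M'.Mods (FO lift (Dom M.Mods t)) (FO lift (Cod M.Mods t))"
    if t: "t \<in> Arr M.Mods" for t
  proof -
    obtain A f B where "t = (A, f, B)" by (rule prod_cases3)
    then show ?thesis using t by simp (simp add: M.linear_iff)
  qed
  show "FA lift (Ide M.Mods A) = Ide M'.Mods (FO lift A)" if "A \<in> Obj M.Mods" for A
    using that M.Mods.obj_simps(3)[of A] by simp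
qed (auto simp: lift_def M.category_Mods M'.category_Mods)

sublocale lift: funct M.Mods M'.Mods lift by (rule funct_lift)

text \<open>
  The factorization of a linear map through \<open>e\<close> is linear, because both sides of the equation in
  question become equal after composition with \<open>e\<close>.
\<close>

lemma univ_to_lift:
  assumes t: "(lift_obj C' F \<gamma> A, e, X) \<in> Arr M'.Mods" and A: "A \<in> Obj M.Mods"
    and e: "univ_to F (fst X) (fst A) e"
  shows "univ_to lift X A (lift_obj C' F \<gamma> A, e, X)"
proof (rule lift.univ_toI)
  note [simp] = F.univ_to_arr[OF e]
  fix B s
  assume B: "B \<in> Obj M.Mods" and s: "s \<in> Arr M'.Mods" "Cod M'.Mods s = X" "Dom M'.Mods s = FO lift B"
  then obtain g where sg: "s = (lift_obj C' F \<gamma> B, g, X)"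
    and g: "(lift_obj C' F \<gamma> B, g, X) \<in> Arr M'.Mods"
    using M'.arrE[of s "lift_obj C' F \<gamma> B" X] lift_simps(3) by metis
  then have [simp]: "g \<in> Arr C'" "Dom C' g = FO F (fst B)" "Cod C' g = fst X"
    by (auto simp: M'.linear_iff)
  obtain f where f: "f \<in> Arr C" "Cod C f = fst A" "Dom C f = fst B" "e \<cdot>\<^bsub>C'\<^esub> FA F f = g"
    by (rule F.univ_toE[OF e, of g "fst B"]) (use B in auto)
  \<comment> \<open>Linearity of a map out of a lifted module, with the inverse of \<open>\<gamma>\<close> cancelled.\<close>
  have lin: "k \<cdot>\<^bsub>C'\<^esub> FA F (snd K) = snd X \<cdot>\<^bsub>C'\<^esub> FA T' k \<cdot>\<^bsub>C'\<^esub> NC \<gamma> (fst K)"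
    if "(lift_obj C' F \<gamma> K, k, X) \<in> Arr M'.Mods" "K \<in> Obj M.Mods" for k K
  proof -
    have k: "X \<in> Obj M'.Mods" "k \<in> Arr C'" "Dom C' k = FO F (fst K)" "Cod C' k = fst X"
      and eq: "k \<cdot>\<^bsub>C'\<^esub> FA F (snd K) \<cdot>\<^bsub>C'\<^esub> \<delta> (fst K) = snd X \<cdot>\<^bsub>C'\<^esub> FA T' k"
      using that by (auto simp: M'.linear_iff)
    have "k \<cdot>\<^bsub>C'\<^esub> FA F (snd K) = (k \<cdot>\<^bsub>C'\<^esub> FA F (snd K) \<cdot>\<^bsub>C'\<^esub> \<delta> (fst K)) \<cdot>\<^bsub>C'\<^esub> NC \<gamma> (fst K)"
      using k that by simp
    also have "\<dots> = (snd X \<cdot>\<^bsub>C'\<^esub> FA T' k) \<cdot>\<^bsub>C'\<^esub> NC \<gamma> (fst K)"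
      by (simp only: eq)
    finally show ?thesis using k that by simp
  qed
  have X: "X \<in> Obj M'.Mods" using t by (simp add: M'.linear_iff)
  have "f \<cdot>\<^bsub>C\<^esub> snd B = snd A \<cdot>\<^bsub>C\<^esub> FA T f"
  proof (rule F.univ_to_eq[OF e])
    have "e \<cdot>\<^bsub>C'\<^esub> FA F (f \<cdot>\<^bsub>C\<^esub> snd B) = g \<cdot>\<^bsub>C'\<^esub> FA F (snd B)"
      using f B M'.T.dom.reassoc1[OF f(4)] by simp
    also have "\<dots> = snd X \<cdot>\<^bsub>C'\<^esub> FA T' g \<cdot>\<^bsub>C'\<^esub> NC \<gamma> (fst B)"
      using lin g B by blast
    also have "\<dots> = snd X \<cdot>\<^bsub>C'\<^esub> FA T' e \<cdot>\<^bsub>C'\<^esub> NC \<gamma> (fst A) \<cdot>\<^bsub>C'\<^esub> FA F (FA T f)"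
      using f X B A by (simp add: \<gamma>_natural flip: f(4))
    also have "\<dots> = e \<cdot>\<^bsub>C'\<^esub> FA F (snd A) \<cdot>\<^bsub>C'\<^esub> FA F (FA T f)"
      using f A X M'.T.dom.reassoc[OF lin[OF t A], of "FA F (FA T f)"] by simp
    finally show "e \<cdot>\<^bsub>C'\<^esub> FA F (f \<cdot>\<^bsub>C\<^esub> snd B) = e \<cdot>\<^bsub>C'\<^esub> FA F (snd A \<cdot>\<^bsub>C\<^esub> FA T f)"
      using f A by simp
  qed (use f A B in auto)
  then have "(B, f, A) \<in> Arr M.Mods" using A B f by (simp add: M.linear_iff)
  then show "\<exists>r \<in> hom M.Mods B A. (lift_obj C' F \<gamma> A, e, X) \<cdot>\<^bsub>M'.Mods\<^esub> FA lift r = s"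
    using sg f by (intro bexI[where x = "(B, f, A)"]) auto
next
  fix r r'
  assume r: "r \<in> Arr M.Mods" "r' \<in> Arr M.Mods" "Cod M.Mods r = A" "Cod M.Mods r' = A"
    "Dom M.Mods r = Dom M.Mods r'"
    "(lift_obj C' F \<gamma> A, e, X) \<cdot>\<^bsub>M'.Mods\<^esub> FA lift r = (lift_obj C' F \<gamma> A, e, X) \<cdot>\<^bsub>M'.Mods\<^esub> FA lift r'"
  then obtain B f f' where rf: "r = (B, f, A)" "r' = (B, f', A)"
    and f: "(B, f, A) \<in> Arr M.Mods" "(B, f', A) \<in> Arr M.Mods"
    using M.arrE[OF r(1) refl r(3)] M.arrE[OF r(2) refl r(4)] by metis
  have "f = f'" by (rule F.univ_to_eq[OF e]) (use r(6) rf f in \<open>auto simp: M.linear_iff\<close>)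
  then show "r = r'" using rf by simp
qed (use t A in auto)

text \<open>
  The action on \<open>A\<close> is the factorization through \<open>e\<close> of the action on \<open>X\<close>, and the module laws
  follow from uniqueness of factorizations.
\<close>

lemma univ_to_lift_exists:
  assumes X: "X \<in> Obj M'.Mods" and e: "univ_to F (fst X) A e"
  obtains a where "(A, a) \<in> Obj M.Mods" "(lift_obj C' F \<gamma> (A, a), e, X) \<in> Arr M'.Mods"
proof -
  note [simp] = F.univ_to_arr[OF e]
  let ?x = "snd X"
  let ?g = "?x \<cdot>\<^bsub>C'\<^esub> FA T' e \<cdot>\<^bsub>C'\<^esub> NC \<gamma> A"
  obtain a where a: "a \<in> Arr C" "Cod C a = A" "Dom C a = FO T A" "e \<cdot>\<^bsub>C'\<^esub> FA F a = ?g"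
    by (rule F.univ_toE[OF e, of ?g "FO T A"]) (use X in auto)
  note ea = M'.T.dom.reassoc1[OF a(4)]
  have "a \<cdot>\<^bsub>C\<^esub> NC \<eta> A = Ide C A"
  proof (rule F.univ_to_eq[OF e])
    have "e \<cdot>\<^bsub>C'\<^esub> FA F (a \<cdot>\<^bsub>C\<^esub> NC \<eta> A) = ?x \<cdot>\<^bsub>C'\<^esub> FA T' e \<cdot>\<^bsub>C'\<^esub> NC \<eta>' (FO F A)"
      using a X by (simp add: ea \<gamma>_unit)
    also have "\<dots> = ?x \<cdot>\<^bsub>C'\<^esub> NC \<eta>' (fst X) \<cdot>\<^bsub>C'\<^esub> e"
      using M'.unit.natural[of e "FO F A" "fst X"] X by simp
    also have "\<dots> = e"
      using M'.T.dom.reassoc1[OF M'.mod_simps(5)[OF X], of e] X by simp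
    finally show "e \<cdot>\<^bsub>C'\<^esub> FA F (a \<cdot>\<^bsub>C\<^esub> NC \<eta> A) = e \<cdot>\<^bsub>C'\<^esub> FA F (Ide C A)" by simp
  qed (use a in auto)
  moreover have "a \<cdot>\<^bsub>C\<^esub> NC \<mu> A = a \<cdot>\<^bsub>C\<^esub> FA T a"
  proof (rule F.univ_to_eq[OF e])
    let ?r = "FA T' (NC \<gamma> A) \<cdot>\<^bsub>C'\<^esub> NC \<gamma> (FO T A)"
    have "e \<cdot>\<^bsub>C'\<^esub> FA F (a \<cdot>\<^bsub>C\<^esub> NC \<mu> A) = ?x \<cdot>\<^bsub>C'\<^esub> FA T' e \<cdot>\<^bsub>C'\<^esub> NC \<mu>' (FO F A) \<cdot>\<^bsub>C'\<^esub> ?r"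
      using a X by (simp add: ea \<gamma>_mult)
    also have "\<dots> = ?x \<cdot>\<^bsub>C'\<^esub> NC \<mu>' (fst X) \<cdot>\<^bsub>C'\<^esub> FA T' (FA T' e) \<cdot>\<^bsub>C'\<^esub> ?r"
      using M'.mult.natural[of e "FO F A" "fst X"] X
        M'.T.dom.reassoc[of "FA T' e" "NC \<mu>' (FO F A)" "NC \<mu>' (fst X)" "FA T' (FA T' e)" ?r] by simp
    also have "\<dots> = ?x \<cdot>\<^bsub>C'\<^esub> FA T' ?x \<cdot>\<^bsub>C'\<^esub> FA T' (FA T' e) \<cdot>\<^bsub>C'\<^esub> ?r"
      by (rule M'.T.dom.reassoc) (use X in \<open>auto simp: M'.mod_mult\<close>)
    also have "\<dots> = ?x \<cdot>\<^bsub>C'\<^esub> FA T' ?g \<cdot>\<^bsub>C'\<^esub> NC \<gamma> (FO T A)"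
      using X by simp
    also have "\<dots> = ?x \<cdot>\<^bsub>C'\<^esub> FA T' (e \<cdot>\<^bsub>C'\<^esub> FA F a) \<cdot>\<^bsub>C'\<^esub> NC \<gamma> (FO T A)"
      by (simp only: a(4))
    also have "\<dots> = ?x \<cdot>\<^bsub>C'\<^esub> FA T' e \<cdot>\<^bsub>C'\<^esub> NC \<gamma> A \<cdot>\<^bsub>C'\<^esub> FA F (FA T a)"
      using X a(1-3) by (simp add: \<gamma>_natural)
    also have "\<dots> = e \<cdot>\<^bsub>C'\<^esub> FA F (a \<cdot>\<^bsub>C\<^esub> FA T a)"
      using X a(1-3) by (simp add: ea)
    finally show "e \<cdot>\<^bsub>C'\<^esub> FA F (a \<cdot>\<^bsub>C\<^esub> NC \<mu> A) = e \<cdot>\<^bsub>C'\<^esub> FA F (a \<cdot>\<^bsub>C\<^esub> FA T a)" .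
  qed (use a in auto)
  ultimately have A: "(A, a) \<in> Obj M.Mods" using a by (intro M.modI) auto
  moreover have "(lift_obj C' F \<gamma> (A, a), e, X) \<in> Arr M'.Mods"
    using A X lift_obj[OF A] a ea[of "\<delta> A"] by (simp add: M'.linear_iff)
  ultimately show ?thesis by (rule that)
qed

text \<open>
  Any universal arrow of modules is isomorphic to one obtained by lifting, whose underlying arrow is
  universal by construction.
\<close>

lemma univ_to_underlying:
  assumes ex: "\<And>Y. Y \<in> Obj C' \<Longrightarrow> \<exists>B e. univ_to F Y B e" and t: "univ_to lift X A t"
  obtains e where "t = (lift_obj C' F \<gamma> A, e, X)" "univ_to F (fst X) (fst A) e"
proof -
  note [simp] = lift.univ_to_arr[OF t]
  have X: "X \<in> Obj M'.Mods" using lift.univ_to_arr(5)[OF t] .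
  then obtain B e where e: "univ_to F (fst X) B e" using ex by (meson M'.mod_simps(1))
  obtain b where b: "(B, b) \<in> Obj M.Mods" "(lift_obj C' F \<gamma> (B, b), e, X) \<in> Arr M'.Mods"
    by (rule univ_to_lift_exists[OF X e])
  have "univ_to lift X (B, b) (lift_obj C' F \<gamma> (B, b), e, X)"
    by (rule univ_to_lift) (use b e in auto)
  then obtain s where s: "is_iso M.Mods s" "Cod M.Mods s = (B, b)" "Dom M.Mods s = A"
      "(lift_obj C' F \<gamma> (B, b), e, X) \<cdot>\<^bsub>M'.Mods\<^esub> FA lift s = t"
    using lift.univ_to_unique t by metis
  then obtain f where f: "s = (A, f, (B, b))" "(A, f, (B, b)) \<in> Arr M.Mods"
    using M.arrE[OF M.Mods.inv_simps(1)[OF s(1)] s(3,2)] by metis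
  then have "is_iso C f" using s M.is_iso_Mods by simp
  then have "univ_to F (fst X) (fst A) (e \<cdot>\<^bsub>C'\<^esub> FA F f)"
    by (intro F.univ_to_along_iso[OF e]) (use f in \<open>auto simp: M.linear_iff\<close>)
  then show ?thesis using that s(4) f by auto
qed

end

text \<open>
  For left adjoints the action on \<open>A\<close> has to be defined on \<open>T A\<close>, so one needs to know the maps out of
  \<open>T A\<close>. The monads are therefore required to preserve universal arrows.
\<close>

locale cocontinuous_monad_mor = monad_mor +
  assumes preserves: "univ_from F X A h \<Longrightarrow>
    univ_from F (FO T' X) (FO T A) (inv_arr C' (NC \<gamma> A) \<cdot>\<^bsub>C'\<^esub> FA T' h)"
begin

lemma univ_from_lift:
  assumes t: "(X, h, lift_obj C' F \<gamma> A) \<in> Arr M'.Mods" and A: "A \<in> Obj M.Mods"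
    and h: "univ_from F (fst X) (fst A) h"
  shows "univ_from lift X A (X, h, lift_obj C' F \<gamma> A)"
proof (rule lift.univ_fromI)
  note [simp] = F.univ_from_arr[OF h]
  have X: "X \<in> Obj M'.Mods" using t by (simp add: M'.linear_iff)
  fix B s
  assume B: "B \<in> Obj M.Mods" and s: "s \<in> Arr M'.Mods" "Dom M'.Mods s = X" "Cod M'.Mods s = FO lift B"
  then obtain g where sg: "s = (X, g, lift_obj C' F \<gamma> B)"
    and g: "(X, g, lift_obj C' F \<gamma> B) \<in> Arr M'.Mods"
    using M'.arrE[of s X "lift_obj C' F \<gamma> B"] lift_simps(3) by metis
  then have [simp]: "g \<in> Arr C'" "Cod C' g = FO F (fst B)" "Dom C' g = fst X"
    by (auto simp: M'.linear_iff)
  obtain f where f: "f \<in> Arr C" "Dom C f = fst A" "Cod C f = fst B" "FA F f \<cdot>\<^bsub>C'\<^esub> h = g"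
    by (rule F.univ_fromE[OF h, of g "fst B"]) (use B in auto)
  have "f \<cdot>\<^bsub>C\<^esub> snd A = snd B \<cdot>\<^bsub>C\<^esub> FA T f"
  proof (rule F.univ_from_eq[OF preserves[OF h]])
    let ?k = "\<delta> (fst A) \<cdot>\<^bsub>C'\<^esub> FA T' h"
    have "FA F (f \<cdot>\<^bsub>C\<^esub> snd A) \<cdot>\<^bsub>C'\<^esub> ?k = FA F f \<cdot>\<^bsub>C'\<^esub> h \<cdot>\<^bsub>C'\<^esub> snd X"
      using f A t by (simp add: M'.linear_iff)
    also have "\<dots> = g \<cdot>\<^bsub>C'\<^esub> snd X"
      using M'.T.dom.reassoc1[OF f(4), of "snd X"] f X by simp
    also have "\<dots> = FA F (snd B) \<cdot>\<^bsub>C'\<^esub> \<delta> (fst B) \<cdot>\<^bsub>C'\<^esub> FA T' g"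
      using g X B by (simp add: M'.linear_iff)
    also have "\<dots> = FA F (snd B \<cdot>\<^bsub>C\<^esub> FA T f) \<cdot>\<^bsub>C'\<^esub> ?k"
      using f B A by (simp add: \<delta>_natural flip: f(4))
    finally show "FA F (f \<cdot>\<^bsub>C\<^esub> snd A) \<cdot>\<^bsub>C'\<^esub> ?k = FA F (snd B \<cdot>\<^bsub>C\<^esub> FA T f) \<cdot>\<^bsub>C'\<^esub> ?k" .
  qed (use f A B in auto)
  then have "(A, f, B) \<in> Arr M.Mods" using A B f by (simp add: M.linear_iff)
  then show "\<exists>r \<in> hom M.Mods A B. FA lift r \<cdot>\<^bsub>M'.Mods\<^esub> (X, h, lift_obj C' F \<gamma> A) = s"
    using sg f by (intro bexI[where x = "(A, f, B)"]) auto
next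
  fix r r'
  assume r: "r \<in> Arr M.Mods" "r' \<in> Arr M.Mods" "Dom M.Mods r = A" "Dom M.Mods r' = A"
    "Cod M.Mods r = Cod M.Mods r'"
    "FA lift r \<cdot>\<^bsub>M'.Mods\<^esub> (X, h, lift_obj C' F \<gamma> A) = FA lift r' \<cdot>\<^bsub>M'.Mods\<^esub> (X, h, lift_obj C' F \<gamma> A)"
  then obtain B f f' where rf: "r = (A, f, B)" "r' = (A, f', B)"
    and f: "(A, f, B) \<in> Arr M.Mods" "(A, f', B) \<in> Arr M.Mods"
    using M.arrE[OF r(1) r(3) refl] M.arrE[OF r(2) r(4) refl] by metis
  have "f = f'" by (rule F.univ_from_eq[OF h]) (use r(6) rf f in \<open>auto simp: M.linear_iff\<close>)
  then show "r = r'" using rf by simp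
qed (use t A in auto)

text \<open>
  The two sides of the associativity law are maps out of \<open>T (T A)\<close>, which is why universality is
  preserved twice here.
\<close>

lemma univ_from_lift_exists:
  assumes X: "X \<in> Obj M'.Mods" and h: "univ_from F (fst X) A h"
  obtains a where "(A, a) \<in> Obj M.Mods" "(X, h, lift_obj C' F \<gamma> (A, a)) \<in> Arr M'.Mods"
proof -
  note [simp] = F.univ_from_arr[OF h]
  let ?x = "snd X"
  let ?k = "\<delta> A \<cdot>\<^bsub>C'\<^esub> FA T' h"
  note k = preserves[OF h]
  obtain a where a: "a \<in> Arr C" "Dom C a = FO T A" "Cod C a = A" "FA F a \<cdot>\<^bsub>C'\<^esub> ?k = h \<cdot>\<^bsub>C'\<^esub> ?x"
    by (rule F.univ_fromE[OF k, of "h \<cdot>\<^bsub>C'\<^esub> ?x" A]) (use X in auto)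
  have ak: "FA F a \<cdot>\<^bsub>C'\<^esub> \<delta> A \<cdot>\<^bsub>C'\<^esub> FA T' h \<cdot>\<^bsub>C'\<^esub> g = h \<cdot>\<^bsub>C'\<^esub> ?x \<cdot>\<^bsub>C'\<^esub> g"
    if "g \<in> Arr C'" "Cod C' g = FO T' (fst X)" for g
    using M'.T.dom.reassoc[OF a(4), of g] that X a(1-3) by simp
  have "a \<cdot>\<^bsub>C\<^esub> NC \<eta> A = Ide C A"
  proof (rule F.univ_from_eq[OF h])
    have "FA F (a \<cdot>\<^bsub>C\<^esub> NC \<eta> A) \<cdot>\<^bsub>C'\<^esub> h = FA F a \<cdot>\<^bsub>C'\<^esub> \<delta> A \<cdot>\<^bsub>C'\<^esub> NC \<eta>' (FO F A) \<cdot>\<^bsub>C'\<^esub> h"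
      using a M'.T.dom.reassoc1[OF \<delta>_unit, of A h] by simp
    also have "\<dots> = FA F a \<cdot>\<^bsub>C'\<^esub> \<delta> A \<cdot>\<^bsub>C'\<^esub> FA T' h \<cdot>\<^bsub>C'\<^esub> NC \<eta>' (fst X)"
      using M'.unit.natural[of h "fst X" "FO F A"] X by simp
    also have "\<dots> = h" using ak[of "NC \<eta>' (fst X)"] X by simp
    finally show "FA F (a \<cdot>\<^bsub>C\<^esub> NC \<eta> A) \<cdot>\<^bsub>C'\<^esub> h = FA F (Ide C A) \<cdot>\<^bsub>C'\<^esub> h" by simp
  qed (use a in auto)
  moreover have "a \<cdot>\<^bsub>C\<^esub> NC \<mu> A = a \<cdot>\<^bsub>C\<^esub> FA T a"
  proof (rule F.univ_from_eq[OF preserves[OF k]])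
    let ?l = "\<delta> (FO T A) \<cdot>\<^bsub>C'\<^esub> FA T' ?k"
    have "FA F (a \<cdot>\<^bsub>C\<^esub> NC \<mu> A) \<cdot>\<^bsub>C'\<^esub> ?l =
        FA F a \<cdot>\<^bsub>C'\<^esub> (FA F (NC \<mu> A) \<cdot>\<^bsub>C'\<^esub> \<delta> (FO T A) \<cdot>\<^bsub>C'\<^esub> FA T' (\<delta> A)) \<cdot>\<^bsub>C'\<^esub> FA T' (FA T' h)"
      using a X by simp
    also have "\<dots> = FA F a \<cdot>\<^bsub>C'\<^esub> (\<delta> A \<cdot>\<^bsub>C'\<^esub> NC \<mu>' (FO F A)) \<cdot>\<^bsub>C'\<^esub> FA T' (FA T' h)"
      by (simp only: \<delta>_mult[OF F.univ_from_arr(1)[OF h]])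
    also have "\<dots> = FA F a \<cdot>\<^bsub>C'\<^esub> \<delta> A \<cdot>\<^bsub>C'\<^esub> FA T' h \<cdot>\<^bsub>C'\<^esub> NC \<mu>' (fst X)"
      using M'.mult.natural[of h "fst X" "FO F A"] X a by simp
    also have "\<dots> = h \<cdot>\<^bsub>C'\<^esub> ?x \<cdot>\<^bsub>C'\<^esub> FA T' ?x"
      using ak[of "NC \<mu>' (fst X)"] X by (simp add: M'.mod_mult)
    also have "\<dots> = FA F a \<cdot>\<^bsub>C'\<^esub> \<delta> A \<cdot>\<^bsub>C'\<^esub> FA T' (FA F a \<cdot>\<^bsub>C'\<^esub> ?k)"
      using ak[of "FA T' ?x"] X a by simp
    also have "\<dots> = FA F (a \<cdot>\<^bsub>C\<^esub> FA T a) \<cdot>\<^bsub>C'\<^esub> ?l"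
      using X a(1-3) by (simp add: \<delta>_natural)
    finally show "FA F (a \<cdot>\<^bsub>C\<^esub> NC \<mu> A) \<cdot>\<^bsub>C'\<^esub> ?l = FA F (a \<cdot>\<^bsub>C\<^esub> FA T a) \<cdot>\<^bsub>C'\<^esub> ?l" .
  qed (use a in auto)
  ultimately have A: "(A, a) \<in> Obj M.Mods" using a by (intro M.modI) auto
  moreover have "(X, h, lift_obj C' F \<gamma> (A, a)) \<in> Arr M'.Mods"
    using A X lift_obj[OF A] a by (simp add: M'.linear_iff)
  ultimately show ?thesis by (rule that)
qed

lemma univ_from_underlying:
  assumes ex: "\<And>Y. Y \<in> Obj C' \<Longrightarrow> \<exists>B h. univ_from F Y B h" and t: "univ_from lift X A t"
  obtains h where "t = (X, h, lift_obj C' F \<gamma> A)" "univ_from F (fst X) (fst A) h"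
proof -
  note [simp] = lift.univ_from_arr[OF t]
  have X: "X \<in> Obj M'.Mods" using lift.univ_from_arr(5)[OF t] .
  then obtain B h where h: "univ_from F (fst X) B h" using ex by (meson M'.mod_simps(1))
  obtain b where b: "(B, b) \<in> Obj M.Mods" "(X, h, lift_obj C' F \<gamma> (B, b)) \<in> Arr M'.Mods"
    by (rule univ_from_lift_exists[OF X h])
  have "univ_from lift X (B, b) (X, h, lift_obj C' F \<gamma> (B, b))"
    by (rule univ_from_lift) (use b h in auto)
  then obtain s where s: "is_iso M.Mods s" "Dom M.Mods s = (B, b)" "Cod M.Mods s = A"
      "FA lift s \<cdot>\<^bsub>M'.Mods\<^esub> (X, h, lift_obj C' F \<gamma> (B, b)) = t"
    using lift.univ_from_unique t by metis
  then obtain f where f: "s = ((B, b), f, A)" "((B, b), f, A) \<in> Arr M.Mods"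
    using M.arrE[OF M.Mods.inv_simps(1)[OF s(1)] s(2,3)] by metis
  then have "is_iso C f" using s M.is_iso_Mods by simp
  then have "univ_from F (fst X) (fst A) (FA F f \<cdot>\<^bsub>C'\<^esub> h)"
    by (intro F.univ_from_along_iso[OF h]) (use f in \<open>auto simp: M.linear_iff\<close>)
  then show ?thesis using that s(4) f by auto
qed

end

section \<open>Prederivators on a diagram category\<close>

locale dia_prederivator = diagram_category Dia + prederivator Dia D
  for Dia :: "'u small_cat set" and D :: "('u, 'o, 'a) prederivator"
begin

lemma dia_functorI: "\<lbrakk>is_functor u; Src u \<in> Dia; Tgt u \<in> Dia\<rbrakk> \<Longrightarrow> dia_functor Dia u"
  by (simp add: dia_functor_def)

lemma dia_functor_simps [simp]:
  "dia_functor Dia u \<Longrightarrow> is_functor u" "dia_functor Dia u \<Longrightarrow> Src u \<in> Dia"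
  "dia_functor Dia u \<Longrightarrow> Tgt u \<in> Dia"
  unfolding dia_functor_def by blast+

lemma dia_funct: "dia_functor Dia u \<Longrightarrow> funct (Src u) (Tgt u) u"
  using is_functor_funct dia_functor_simps(1) by blast

lemma dia_functor_comp [simp]:
  "\<lbrakk>dia_functor Dia u; dia_functor Dia v; Src v = Tgt u\<rbrakk> \<Longrightarrow> dia_functor Dia (v \<circ>\<^sub>F u)"
  by (rule dia_functorI) simp_all

lemma dia_functor_id [simp]: "J \<in> Dia \<Longrightarrow> dia_functor Dia (id_functor J)"
  using funct.is_functor[OF funct_id[OF is_category]] by (simp add: dia_functorI)

lemma dia_nattransI: "\<lbrakk>is_nattrans \<alpha>; dia_functor Dia (NSrc \<alpha>)\<rbrakk> \<Longrightarrow> dia_nattrans Dia \<alpha>"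
  by (simp add: dia_nattrans_def)

lemma dia_nattrans_parallel:
  assumes "dia_nattrans Dia \<alpha>"
  shows "is_nattrans \<alpha>" "dia_functor Dia (NSrc \<alpha>)" "dia_functor Dia (NTgt \<alpha>)"
    "Src (NTgt \<alpha>) = Src (NSrc \<alpha>)" "Tgt (NTgt \<alpha>) = Tgt (NSrc \<alpha>)"
  using assms unfolding dia_nattrans_def is_nattrans_def dia_functor_def by auto

lemma pull: "dia_functor Dia u \<Longrightarrow> funct (Val D (Tgt u)) (Val D (Src u)) (Pull D u)"
  using pull_functor by (rule functI)

lemma pull2:
  "dia_nattrans Dia \<alpha> \<Longrightarrow> nattr (Val D (Tgt (NSrc \<alpha>))) (Val D (Src (NSrc \<alpha>)))
     (Pull D (NSrc \<alpha>)) (Pull D (NTgt \<alpha>)) (Pull2 D \<alpha>)"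
  using pull2_nattrans[of \<alpha>] pull[of "NSrc \<alpha>"] dia_nattrans_parallel(2)[of \<alpha>]
  by (auto intro!: nattrI simp: funct.src_tgt)

end

section \<open>The prederivator of modules\<close>

text \<open>
  The restriction functor along \<open>u : J \<rightarrow> K\<close> as a morphism of monads from \<open>K\<close> to \<open>J\<close>. The categories
  are parameters of their own, so that they can be kept in simplified form.
\<close>

locale restriction = monad_mor "Val D K" "Cpt M K" "\<mu> K" "S K" "Val D J" "Cpt M J" "\<mu> J" "S J"
    "Pull D u" "Gam M u"
  for D :: "('u, 'o, 'a) prederivator" and M :: "('u, 'o, 'a, 'o, 'a) pder_map"
    and \<mu> S :: "('u, 'o, 'a, 'o, 'a) pder_2cell" and u :: "'u small_functor" and J K

locale cocontinuous_restriction = restriction +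
  cocontinuous_monad_mor "Val D K" "Cpt M K" "\<mu> K" "S K" "Val D J" "Cpt M J" "\<mu> J" "S J"
    "Pull D u" "Gam M u"

locale prederivator_monad = dia_prederivator Dia D
  for Dia :: "'u small_cat set" and D :: "('u, 'o, 'a) prederivator" +
  fixes M :: "('u, 'o, 'a, 'o, 'a) pder_map" and \<mu> S :: "('u, 'o, 'a, 'o, 'a) pder_2cell"
  assumes monad: "monad_on Dia D M \<mu> S"
begin

lemma monad_at: "J \<in> Dia \<Longrightarrow> em_monad (Val D J) (Cpt M J) (\<mu> J) (S J)"
proof -
  assume J: "J \<in> Dia"
  have *: "functor_between (Cpt M J) (Val D J) (Val D J)"
    "nattrans_between (\<mu> J) (Cpt M J \<circ>\<^sub>F Cpt M J) (Cpt M J)"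
    "nattrans_between (S J) (id_functor (Val D J)) (Cpt M J)"
    and eq: "\<mu> J \<circ>\<^sub>N (Cpt M J \<lhd> \<mu> J) = \<mu> J \<circ>\<^sub>N (\<mu> J \<rhd> Cpt M J)"
    "\<mu> J \<circ>\<^sub>N (Cpt M J \<lhd> S J) = id_nattrans (Cpt M J)"
    "\<mu> J \<circ>\<^sub>N (S J \<rhd> Cpt M J) = id_nattrans (Cpt M J)"
    using monad J unfolding monad_on_def is_pder_map_def is_pder_2cell_def pder_comp_def pder_id_def
    by auto
  interpret T: funct "Val D J" "Val D J" "Cpt M J" using *(1) by (rule functI)
  interpret m: nattr "Val D J" "Val D J" "Cpt M J \<circ>\<^sub>F Cpt M J" "Cpt M J" "\<mu> J"
    using *(2) by (rule nattrI) auto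
  interpret s: nattr "Val D J" "Val D J" "id_functor (Val D J)" "Cpt M J" "S J"
    using *(3) by (rule nattrI) auto
  show ?thesis
  proof
    fix X assume X: "X \<in> Obj (Val D J)"
    show "NC (\<mu> J) X \<cdot>\<^bsub>Val D J\<^esub> FA (Cpt M J) (NC (\<mu> J) X) =
        NC (\<mu> J) X \<cdot>\<^bsub>Val D J\<^esub> NC (\<mu> J) (FO (Cpt M J) X)"
      using arg_cong[OF eq(1), of "\<lambda>t. NC t X"] X by simp
    show "NC (\<mu> J) X \<cdot>\<^bsub>Val D J\<^esub> FA (Cpt M J) (NC (S J) X) = Ide (Val D J) (FO (Cpt M J) X)"
      using arg_cong[OF eq(2), of "\<lambda>t. NC t X"] X by simp
    show "NC (\<mu> J) X \<cdot>\<^bsub>Val D J\<^esub> NC (S J) (FO (Cpt M J) X) = Ide (Val D J) (FO (Cpt M J) X)"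
      using arg_cong[OF eq(3), of "\<lambda>t. NC t X"] X by simp
  qed
qed

lemma restriction_along:
  assumes u: "dia_functor Dia u"
  shows "restriction D M \<mu> S u (Src u) (Tgt u)"
proof -
  let ?J = "Src u" and ?K = "Tgt u"
  interpret K: em_monad "Val D ?K" "Cpt M ?K" "\<mu> ?K" "S ?K" using u by (intro monad_at) simp
  interpret J: em_monad "Val D ?J" "Cpt M ?J" "\<mu> ?J" "S ?J" using u by (intro monad_at) simp
  interpret F: funct "Val D ?K" "Val D ?J" "Pull D u" using u by (rule pull)
  have g: "is_nat_iso (Gam M u)" "NSrc (Gam M u) = Pull D u \<circ>\<^sub>F Cpt M ?K"
      "NTgt (Gam M u) = Cpt M ?J \<circ>\<^sub>F Pull D u"
    and eq: "Gam M u \<circ>\<^sub>N (Pull D u \<lhd> S ?K) = (S ?J \<rhd> Pull D u) \<circ>\<^sub>N id_nattrans (Pull D u)"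
      "Gam M u \<circ>\<^sub>N (Pull D u \<lhd> \<mu> ?K) = (\<mu> ?J \<rhd> Pull D u) \<circ>\<^sub>N
        (Cpt M ?J \<lhd> Gam M u) \<circ>\<^sub>N (Gam M u \<rhd> Cpt M ?K)"
    using monad u unfolding monad_on_def is_pder_map_def is_pder_2cell_def pder_comp_def pder_id_def
    by auto
  interpret \<gamma>: nattr "Val D ?K" "Val D ?J" "Pull D u \<circ>\<^sub>F Cpt M ?K" "Cpt M ?J \<circ>\<^sub>F Pull D u" "Gam M u"
    by (rule nattrI) (use g in \<open>auto simp: nattrans_between_def is_nat_iso_def\<close>)
  show ?thesis
  proof
    fix X assume X: "X \<in> Obj (Val D ?K)"
    show "is_iso (Val D ?J) (NC (Gam M u) X)"
      using g(1) X by (simp add: is_nat_iso_iff[OF \<gamma>.nattr_axioms])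
    show "NC (Gam M u) X \<cdot>\<^bsub>Val D ?J\<^esub> FA (Pull D u) (NC (S ?K) X) = NC (S ?J) (FO (Pull D u) X)"
      using arg_cong[OF eq(1), of "\<lambda>t. NC t X"] X by simp
    show "NC (Gam M u) X \<cdot>\<^bsub>Val D ?J\<^esub> FA (Pull D u) (NC (\<mu> ?K) X) =
        NC (\<mu> ?J) (FO (Pull D u) X) \<cdot>\<^bsub>Val D ?J\<^esub> FA (Cpt M ?J) (NC (Gam M u) X) \<cdot>\<^bsub>Val D ?J\<^esub>
        NC (Gam M u) (FO (Cpt M ?K) X)"
      using arg_cong[OF eq(2), of "\<lambda>t. NC t X"] X by simp
  qed
qed

abbreviation N where "N \<equiv> module_prederivator D M \<mu> S"

abbreviation lift_along where
  "lift_along u \<equiv> lift_obj (Val D (Src u)) (Pull D u) (Gam M u)"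

lemma N_simps [simp]:
  "Val N J = em_cat (Cpt M J) (\<mu> J) (S J)"
  "NSrc (Pull2 N \<alpha>) = Pull N (NSrc \<alpha>)" "NTgt (Pull2 N \<alpha>) = Pull N (NTgt \<alpha>)"
  "A \<in> Obj (em_cat (Cpt M (Tgt (NSrc \<alpha>))) (\<mu> (Tgt (NSrc \<alpha>))) (S (Tgt (NSrc \<alpha>)))) \<Longrightarrow>
     NC (Pull2 N \<alpha>) A = (lift_along (NSrc \<alpha>) A, NC (Pull2 D \<alpha>) (fst A), lift_along (NTgt \<alpha>) A)"
  by (simp_all add: module_prederivator_def module_val_def module_pull_obj_def lift_obj_def)

lemma Pull_N:
  assumes "dia_functor Dia u"
  shows "Pull N u = monad_mor.lift (Cpt M (Tgt u)) (\<mu> (Tgt u)) (S (Tgt u))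
    (Val D (Src u)) (Cpt M (Src u)) (\<mu> (Src u)) (S (Src u)) (Pull D u) (Gam M u)"
  by (simp add: monad_mor.lift_def[OF restriction.axioms[OF restriction_along[OF assms]]] module_prederivator_def module_pull_def
      module_val_def module_pull_obj_def lift_obj_def)

lemma pull_N: "dia_functor Dia u \<Longrightarrow> funct (Val N (Tgt u)) (Val N (Src u)) (Pull N u)"
  using monad_mor.funct_lift[OF restriction.axioms[OF restriction_along]] by (simp add: Pull_N)

lemma Pull_N_simps [simp]:
  assumes "dia_functor Dia u"
  shows "A \<in> Obj (em_cat (Cpt M (Tgt u)) (\<mu> (Tgt u)) (S (Tgt u))) \<Longrightarrow> FO (Pull N u) A = lift_along u A"
    "(A, f, B) \<in> Arr (em_cat (Cpt M (Tgt u)) (\<mu> (Tgt u)) (S (Tgt u))) \<Longrightarrow>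
      FA (Pull N u) (A, f, B) = (lift_along u A, FA (Pull D u) f, lift_along u B)"
  using monad_mor.lift_simps[OF restriction.axioms[OF restriction_along[OF assms]]] by (simp_all add: Pull_N assms)

lemma lift_along_id [simp]:
  assumes J: "J \<in> Dia" and A: "A \<in> Obj (em_cat (Cpt M J) (\<mu> J) (S J))"
  shows "lift_obj (Val D J) (Pull D (id_functor J)) (Gam M (id_functor J)) A = A"
proof -
  interpret em_monad "Val D J" "Cpt M J" "\<mu> J" "S J" using J by (rule monad_at)
  have "Gam M (id_functor J) = id_nattrans (Cpt M J)"
    using monad J by (auto simp: monad_on_def is_pder_map_def)
  then show ?thesis using A by (intro prod_eqI) (simp_all add: pull_id J)
qed

lemma Gam_comp:
  assumes u: "dia_functor Dia u" and v: "dia_functor Dia v" and uv: "Tgt u = Src v"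
    and X: "X \<in> Obj (Val D (Tgt v))"
  shows "NC (Gam M (v \<circ>\<^sub>F u)) X =
    NC (Gam M u) (FO (Pull D v) X) \<cdot>\<^bsub>Val D (Src u)\<^esub> FA (Pull D u) (NC (Gam M v) X)"
proof -
  interpret v: restriction D M \<mu> S v "Src v" "Tgt v"
    by (rule restriction_along[OF v])
  interpret u: funct "Val D (Src v)" "Val D (Src u)" "Pull D u"
    using pull[OF u] uv by simp
  have "Gam M (v \<circ>\<^sub>F u) = (Gam M u \<rhd> Pull D v) \<circ>\<^sub>N (Pull D u \<lhd> Gam M v)"
    using monad u v uv by (auto simp: monad_on_def is_pder_map_def)
  then show ?thesis using X by simp
qed

lemma lift_along_comp [simp]:
  assumes u: "dia_functor Dia u" and v: "dia_functor Dia v" and uv: "Src v = Tgt u"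
    and A: "A \<in> Obj (em_cat (Cpt M (Tgt v)) (\<mu> (Tgt v)) (S (Tgt v)))"
  shows "lift_obj (Val D (Src u)) (Pull D (v \<circ>\<^sub>F u)) (Gam M (v \<circ>\<^sub>F u)) A =
    lift_along u (lift_along v A)"
proof -
  interpret v: restriction D M \<mu> S v "Src v" "Tgt v"
    by (rule restriction_along[OF v])
  interpret u: restriction D M \<mu> S u "Src u" "Src v"
    using restriction_along[OF u] uv by simp
  show ?thesis
    using A by (intro prod_eqI) (simp_all add: pull_comp[OF u v uv[symmetric]] Gam_comp[OF u v uv[symmetric]] uv[symmetric] u.F.inv)
qed

lemma Gam_natural:
  assumes \<alpha>: "dia_nattrans Dia \<alpha>" and X: "X \<in> Obj (Val D (Tgt (NSrc \<alpha>)))"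
  shows "NC (Gam M (NTgt \<alpha>)) X \<cdot>\<^bsub>Val D (Src (NSrc \<alpha>))\<^esub> NC (Pull2 D \<alpha>) (FO (Cpt M (Tgt (NSrc \<alpha>))) X) =
    FA (Cpt M (Src (NSrc \<alpha>))) (NC (Pull2 D \<alpha>) X) \<cdot>\<^bsub>Val D (Src (NSrc \<alpha>))\<^esub> NC (Gam M (NSrc \<alpha>)) X"
proof -
  let ?u = "NSrc \<alpha>" and ?v = "NTgt \<alpha>"
  have uv: "dia_functor Dia ?u" "dia_functor Dia ?v" "Src ?v = Src ?u" "Tgt ?v = Tgt ?u"
    using dia_nattrans_parallel[OF \<alpha>] by auto
  interpret u: restriction D M \<mu> S "?u" "Src ?u" "Tgt ?u"
    by (rule restriction_along[OF uv(1)])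
  interpret v: restriction D M \<mu> S "?v" "Src ?u" "Tgt ?u"
    using restriction_along[OF uv(2)] uv by simp
  interpret \<alpha>: nattr "Val D (Tgt ?u)" "Val D (Src ?u)" "Pull D ?u" "Pull D ?v" "Pull2 D \<alpha>"
    by (rule pull2[OF \<alpha>])
  have "Gam M ?v \<circ>\<^sub>N (Pull2 D \<alpha> \<rhd> Cpt M (Tgt ?u)) = (Cpt M (Src ?u) \<lhd> Pull2 D \<alpha>) \<circ>\<^sub>N Gam M ?u"
    using monad \<alpha> by (auto simp: monad_on_def is_pder_map_def)
  from arg_cong[OF this, of "\<lambda>t. NC t X"] show ?thesis using X by simp
qed

text \<open>
  Linearity of the components combines their naturality with the compatibility of \<open>Gam M\<close> with 2-cells.
\<close>

lemma pull2_N: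
  assumes \<alpha>: "dia_nattrans Dia \<alpha>"
  shows "nattr (Val N (Tgt (NSrc \<alpha>))) (Val N (Src (NSrc \<alpha>))) (Pull N (NSrc \<alpha>)) (Pull N (NTgt \<alpha>)) (Pull2 N \<alpha>)"
proof -
  let ?u = "NSrc \<alpha>" and ?v = "NTgt \<alpha>"
  have uv [simp]: "dia_functor Dia ?u" "dia_functor Dia ?v" "Src ?v = Src ?u" "Tgt ?v = Tgt ?u"
    using dia_nattrans_parallel[OF \<alpha>] by auto
  interpret u: restriction D M \<mu> S "?u" "Src ?u" "Tgt ?u"
    by (rule restriction_along) simp
  interpret v: restriction D M \<mu> S "?v" "Src ?u" "Tgt ?u"
    using restriction_along[of ?v] by simp
  interpret \<alpha>: nattr "Val D (Tgt ?u)" "Val D (Src ?u)" "Pull D ?u" "Pull D ?v" "Pull2 D \<alpha>"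
    by (rule pull2[OF \<alpha>])
  have lin: "(lift_along ?u A, NC (Pull2 D \<alpha>) (fst A), lift_obj (Val D (Src ?u)) (Pull D ?v) (Gam M ?v) A)
      \<in> Arr u.M'.Mods" if A: "A \<in> Obj u.M.Mods" for A
  proof -
    let ?X = "fst A" and ?a = "snd A"
    let ?C = "Val D (Src ?u)"
    have "NC (Pull2 D \<alpha>) ?X \<cdot>\<^bsub>?C\<^esub> FA (Pull D ?u) ?a \<cdot>\<^bsub>?C\<^esub> u.\<delta> ?X =
        FA (Pull D ?v) ?a \<cdot>\<^bsub>?C\<^esub> NC (Pull2 D \<alpha>) (FO (Cpt M (Tgt ?u)) ?X) \<cdot>\<^bsub>?C\<^esub> u.\<delta> ?X"
      by (rule u.M'.T.dom.reassoc[OF \<alpha>.natural]) (use A in auto)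
    also have "\<dots> = FA (Pull D ?v) ?a \<cdot>\<^bsub>?C\<^esub> v.\<delta> ?X \<cdot>\<^bsub>?C\<^esub>
        (NC (Gam M ?v) ?X \<cdot>\<^bsub>?C\<^esub> NC (Pull2 D \<alpha>) (FO (Cpt M (Tgt ?u)) ?X)) \<cdot>\<^bsub>?C\<^esub> u.\<delta> ?X"
      using A by simp
    also have "\<dots> = FA (Pull D ?v) ?a \<cdot>\<^bsub>?C\<^esub> v.\<delta> ?X \<cdot>\<^bsub>?C\<^esub> FA (Cpt M (Src ?u)) (NC (Pull2 D \<alpha>) ?X)"
      using A by (simp add: Gam_natural[OF \<alpha>])
    finally show ?thesis
      using A u.lift_obj[OF A] v.lift_obj[OF A] by (simp add: u.M'.linear_iff)
  qed
  have "nattr u.M.Mods u.M'.Mods (Pull N ?u) (Pull N ?v) (Pull2 N \<alpha>)"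
  proof (rule nattr_intro)
    show "funct u.M.Mods u.M'.Mods (Pull N ?u)" "funct u.M.Mods u.M'.Mods (Pull N ?v)"
      using pull_N[of ?u] pull_N[of ?v] by simp_all
    show "NC (Pull2 N \<alpha>) \<in> extensional (Obj u.M.Mods)"
      by (simp add: module_prederivator_def module_val_def)
    show "NC (Pull2 N \<alpha>) A \<in> hom u.M'.Mods (FO (Pull N ?u) A) (FO (Pull N ?v) A)"
      if "A \<in> Obj u.M.Mods" for A
      using that lin by simp
    show "NC (Pull2 N \<alpha>) (Cod u.M.Mods t) \<cdot>\<^bsub>u.M'.Mods\<^esub> FA (Pull N ?u) t =
        FA (Pull N ?v) t \<cdot>\<^bsub>u.M'.Mods\<^esub> NC (Pull2 N \<alpha>) (Dom u.M.Mods t)" if t: "t \<in> Arr u.M.Mods" for t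
    proof -
      obtain A f B where "t = (A, f, B)" by (rule prod_cases3)
      then show ?thesis
        using t \<alpha>.natural[of f "fst A" "fst B"] by simp (simp add: u.M.linear_iff)
    qed
  qed auto
  then show ?thesis by simp
qed

lemma prederivator_N: "prederivator Dia N"
proof (rule prederivator.intro)
  show "category (Val N J)" if "J \<in> Dia" for J
    using em_monad.category_Mods[OF monad_at[OF that]] by simp
  show "functor_between (Pull N u) (Val N (Tgt u)) (Val N (Src u))" if "dia_functor Dia u" for u
    using pull_N[OF that] by (rule funct.between)
  show "nattrans_between (Pull2 N \<alpha>) (Pull N (NSrc \<alpha>)) (Pull N (NTgt \<alpha>))"
    if "dia_nattrans Dia \<alpha>" for \<alpha>
    using pull2_N[OF that] by (rule nattr.between)
  show "Pull N (id_functor J) = id_functor (Val N J)" if J: "J \<in> Dia" for J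
  proof (rule fnct_eqI)
    interpret em_monad "Val D J" "Cpt M J" "\<mu> J" "S J" using J by (rule monad_at)
    show "funct (Val N J) (Val N J) (Pull N (id_functor J))" using pull_N[of "id_functor J"] J by simp
    show "funct (Val N J) (Val N J) (id_functor (Val N J))" by (simp add: funct_id category_Mods)
    show "FO (Pull N (id_functor J)) A = FO (id_functor (Val N J)) A" if "A \<in> Obj (Val N J)" for A
      using J that by simp
    show "FA (Pull N (id_functor J)) t = FA (id_functor (Val N J)) t" if "t \<in> Arr (Val N J)" for t
    proof -
      obtain A f B where t: "t = (A, f, B)" by (rule prod_cases3)
      then have "A \<in> Obj Mods" "B \<in> Obj Mods" "FA (Pull D (id_functor J)) f = f"
        using that J by (auto simp: linear_iff pull_id)
      then show ?thesis using J t that by simp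
    qed
  qed
  show Pull_comp: "Pull N (v \<circ>\<^sub>F u) = Pull N u \<circ>\<^sub>F Pull N v"
    if u: "dia_functor Dia u" and v: "dia_functor Dia v" and uv: "Tgt u = Src v" for u v
  proof (rule fnct_eqI)
    interpret v: restriction D M \<mu> S v "Src v" "Tgt v"
      by (rule restriction_along[OF v])
    interpret nv: funct "Val N (Tgt v)" "Val N (Src v)" "Pull N v" by (rule pull_N[OF v])
    show "funct (Val N (Tgt v)) (Val N (Src u)) (Pull N (v \<circ>\<^sub>F u))"
      using pull_N[of "v \<circ>\<^sub>F u"] u v uv by simp
    show "funct (Val N (Tgt v)) (Val N (Src u)) (Pull N u \<circ>\<^sub>F Pull N v)"
      by (rule funct_comp[OF pull_N[OF v]]) (use pull_N[OF u] uv in simp)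
    show "FO (Pull N (v \<circ>\<^sub>F u)) A = FO (Pull N u \<circ>\<^sub>F Pull N v) A" if "A \<in> Obj (Val N (Tgt v))" for A
      using that u v uv by simp
    show "FA (Pull N (v \<circ>\<^sub>F u)) t = FA (Pull N u \<circ>\<^sub>F Pull N v) t" if "t \<in> Arr (Val N (Tgt v))" for t
    proof -
      obtain A f B where t: "t = (A, f, B)" by (rule prod_cases3)
      then have "A \<in> Obj v.M.Mods" "B \<in> Obj v.M.Mods" "f \<in> Arr (Val D (Tgt v))"
        using that by (auto simp: v.M.linear_iff)
      moreover from this have "FA (Pull D (v \<circ>\<^sub>F u)) f = FA (Pull D u) (FA (Pull D v) f)"
        by (simp add: pull_comp[OF u v uv])
      ultimately show ?thesis using t that u v uv by simp
    qed
  qed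
  show "Pull2 N (id_nattrans u) = id_nattrans (Pull N u)" if u: "dia_functor Dia u" for u
  proof (rule nattrans_eqI)
    interpret u: restriction D M \<mu> S u "Src u" "Tgt u"
      by (rule restriction_along[OF u])
    interpret nu: funct "Val N (Tgt u)" "Val N (Src u)" "Pull N u" by (rule pull_N[OF u])
    have "dia_nattrans Dia (id_nattrans u)" using u by (intro dia_nattransI) simp_all
    from pull2_N[OF this]
    show "nattr (Val N (Tgt u)) (Val N (Src u)) (Pull N u) (Pull N u) (Pull2 N (id_nattrans u))" by simp
    show "nattr (Val N (Tgt u)) (Val N (Src u)) (Pull N u) (Pull N u) (id_nattrans (Pull N u))"
      by (rule nattr_id[OF pull_N[OF u]])
    show "NC (Pull2 N (id_nattrans u)) A = NC (id_nattrans (Pull N u)) A" if "A \<in> Obj (Val N (Tgt u))" for A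
      using that u by (simp add: pull2_id)
  qed
  show "Pull2 N (\<beta> \<circ>\<^sub>N \<alpha>) = Pull2 N \<beta> \<circ>\<^sub>N Pull2 N \<alpha>"
    if \<alpha>: "dia_nattrans Dia \<alpha>" and \<beta>: "dia_nattrans Dia \<beta>" and eq: "NTgt \<alpha> = NSrc \<beta>" for \<alpha> \<beta>
  proof (rule nattrans_eqI)
    let ?J = "Src (NSrc \<alpha>)" and ?K = "Tgt (NSrc \<alpha>)"
    have [simp]: "Src (NSrc \<beta>) = ?J" "Tgt (NSrc \<beta>) = ?K" "dia_functor Dia (NSrc \<alpha>)"
      using dia_nattrans_parallel[OF \<alpha>] eq by auto
    interpret u: restriction D M \<mu> S "NSrc \<alpha>" "?J" "?K"
      by (rule restriction_along) simp
    interpret \<alpha>: nattr "Val D ?K" "Val D ?J" "Pull D (NSrc \<alpha>)" "Pull D (NTgt \<alpha>)" "Pull2 D \<alpha>"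
      by (rule pull2[OF \<alpha>])
    have "dia_nattrans Dia (\<beta> \<circ>\<^sub>N \<alpha>)" using dia_nattrans_parallel[OF \<alpha>] dia_nattrans_parallel[OF \<beta>] eq by (intro dia_nattransI) simp_all
    from pull2_N[OF this] show "nattr (Val N ?K) (Val N ?J) (Pull N (NSrc \<alpha>)) (Pull N (NTgt \<beta>)) (Pull2 N (\<beta> \<circ>\<^sub>N \<alpha>))"
      by simp
    show "nattr (Val N ?K) (Val N ?J) (Pull N (NSrc \<alpha>)) (Pull N (NTgt \<beta>)) (Pull2 N \<beta> \<circ>\<^sub>N Pull2 N \<alpha>)"
      by (rule nattr_vcomp[OF pull2_N[OF \<alpha>]]) (use pull2_N[OF \<beta>] eq in simp)
    interpret n: nattr "Val N ?K" "Val N ?J" "Pull N (NSrc \<alpha>)" "Pull N (NTgt \<alpha>)" "Pull2 N \<alpha>"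
      by (rule pull2_N[OF \<alpha>])
    show "NC (Pull2 N (\<beta> \<circ>\<^sub>N \<alpha>)) A = NC (Pull2 N \<beta> \<circ>\<^sub>N Pull2 N \<alpha>) A" if A: "A \<in> Obj (Val N ?K)" for A
      using A eq by (simp add: pull2_vcomp[OF \<alpha> \<beta>])
  qed
  show "Pull2 N (v \<lhd> \<alpha>) = Pull2 N \<alpha> \<rhd> Pull N v"
    if \<alpha>: "dia_nattrans Dia \<alpha>" and v: "dia_functor Dia v" and eq: "Tgt (NSrc \<alpha>) = Src v" for \<alpha> v
  proof (rule nattrans_eqI)
    let ?J = "Src (NSrc \<alpha>)"
    note par [simp] = dia_nattrans_parallel[OF \<alpha>]
    interpret v: restriction D M \<mu> S v "Src v" "Tgt v"
      by (rule restriction_along[OF v])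
    interpret nv: funct "Val N (Tgt v)" "Val N (Src v)" "Pull N v" by (rule pull_N[OF v])
    interpret \<alpha>: nattr "Val D (Src v)" "Val D ?J" "Pull D (NSrc \<alpha>)" "Pull D (NTgt \<alpha>)" "Pull2 D \<alpha>"
      using pull2[OF \<alpha>] eq by simp
    have pc [simp]: "Pull N (v \<circ>\<^sub>F NSrc \<alpha>) = Pull N (NSrc \<alpha>) \<circ>\<^sub>F Pull N v"
        "Pull N (v \<circ>\<^sub>F NTgt \<alpha>) = Pull N (NTgt \<alpha>) \<circ>\<^sub>F Pull N v"
      using Pull_comp v eq by simp_all
    have "dia_nattrans Dia (v \<lhd> \<alpha>)"
      using v eq by (intro dia_nattransI) simp_all
    from pull2_N[OF this]
    show "nattr (Val N (Tgt v)) (Val N ?J) (Pull N (NSrc \<alpha>) \<circ>\<^sub>F Pull N v)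
        (Pull N (NTgt \<alpha>) \<circ>\<^sub>F Pull N v) (Pull2 N (v \<lhd> \<alpha>))"
      by simp
    show "nattr (Val N (Tgt v)) (Val N ?J) (Pull N (NSrc \<alpha>) \<circ>\<^sub>F Pull N v)
        (Pull N (NTgt \<alpha>) \<circ>\<^sub>F Pull N v) (Pull2 N \<alpha> \<rhd> Pull N v)"
      by (rule nattr_whisker_right) (use pull2_N[OF \<alpha>] eq pull_N[OF v] in auto)
    show "NC (Pull2 N (v \<lhd> \<alpha>)) A = NC (Pull2 N \<alpha> \<rhd> Pull N v) A" if A: "A \<in> Obj (Val N (Tgt v))" for A
      using A eq v lift_along_comp[of "NTgt \<alpha>" v A] by (simp add: pull2_whisker_left[OF \<alpha> v])
  qed
  show "Pull2 N (\<beta> \<rhd> u) = Pull N u \<lhd> Pull2 N \<beta>"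
    if u: "dia_functor Dia u" and \<beta>: "dia_nattrans Dia \<beta>" and eq: "Tgt u = Src (NSrc \<beta>)" for u \<beta>
  proof (rule nattrans_eqI)
    let ?J = "Src (NSrc \<beta>)" and ?K = "Tgt (NSrc \<beta>)"
    note par [simp] = dia_nattrans_parallel[OF \<beta>]
    interpret v: restriction D M \<mu> S "NSrc \<beta>" "?J" "?K"
      by (rule restriction_along) simp
    interpret \<beta>: nattr "Val D ?K" "Val D ?J" "Pull D (NSrc \<beta>)" "Pull D (NTgt \<beta>)" "Pull2 D \<beta>"
      by (rule pull2[OF \<beta>])
    interpret n: nattr "Val N ?K" "Val N ?J" "Pull N (NSrc \<beta>)" "Pull N (NTgt \<beta>)" "Pull2 N \<beta>"
      by (rule pull2_N[OF \<beta>])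
    have pc [simp]: "Pull N (NSrc \<beta> \<circ>\<^sub>F u) = Pull N u \<circ>\<^sub>F Pull N (NSrc \<beta>)"
        "Pull N (NTgt \<beta> \<circ>\<^sub>F u) = Pull N u \<circ>\<^sub>F Pull N (NTgt \<beta>)"
      using Pull_comp u eq by simp_all
    have "dia_nattrans Dia (\<beta> \<rhd> u)"
      using u eq by (intro dia_nattransI) simp_all
    from pull2_N[OF this]
    show "nattr (Val N ?K) (Val N (Src u)) (Pull N u \<circ>\<^sub>F Pull N (NSrc \<beta>))
        (Pull N u \<circ>\<^sub>F Pull N (NTgt \<beta>)) (Pull2 N (\<beta> \<rhd> u))"
      by simp
    show "nattr (Val N ?K) (Val N (Src u)) (Pull N u \<circ>\<^sub>F Pull N (NSrc \<beta>))
        (Pull N u \<circ>\<^sub>F Pull N (NTgt \<beta>)) (Pull N u \<lhd> Pull2 N \<beta>)"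
      by (rule nattr_whisker_left) (use pull2_N[OF \<beta>] eq pull_N[OF u] in auto)
    show "NC (Pull2 N (\<beta> \<rhd> u)) A = NC (Pull N u \<lhd> Pull2 N \<beta>) A" if A: "A \<in> Obj (Val N ?K)" for A
    proof -
      have "(lift_along (NSrc \<beta>) A, NC (Pull2 D \<beta>) (fst A), lift_along (NTgt \<beta>) A) \<in> Arr v.M'.Mods"
        using n.cpt(1)[of A] A by simp
      then show ?thesis
        using A eq u lift_along_comp[of u "NTgt \<beta>" A] by (simp add: pull2_whisker_right[OF u \<beta>])
    qed
  qed
qed

end

section \<open>The derivator axioms in terms of universal arrows\<close>

lemma one_cat_simps [simp]:
  "Obj one_cat = {undefined}" "Arr one_cat = {undefined}" "Dom one_cat f = undefined"
  "Cod one_cat f = undefined" "Ide one_cat x = undefined" "g \<cdot>\<^bsub>one_cat\<^esub> f = undefined"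
  by (simp_all add: one_cat_def)

lemma category_one: "category one_cat"
  by unfold_locales auto

lemma funct_to_one: "category P \<Longrightarrow> funct P one_cat (to_one P)"
  by (rule funct_intro) (auto simp: category_one to_one_def category.obj_simps category.comp_simps)

lemma funct_point: "category K \<Longrightarrow> k \<in> Obj K \<Longrightarrow> funct one_cat K (point K k)"
  by (rule funct_intro) (auto simp: category_one point_def category.obj_simps category.ide_simps)

lemma to_one_simps [simp]:
  "Src (to_one P) = P" "Tgt (to_one P) = one_cat" "x \<in> Obj P \<Longrightarrow> FO (to_one P) x = undefined"
  "f \<in> Arr P \<Longrightarrow> FA (to_one P) f = undefined"
  by (simp_all add: to_one_def)

lemma point_simps [simp]:
  "Src (point K k) = one_cat" "Tgt (point K k) = K" "FO (point K k) undefined = k"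
  "FA (point K k) undefined = Ide K k"
  by (simp_all add: point_def)

lemma funct_comma_proj:
  assumes "category Q" "category J"
    and "\<And>x. x \<in> Obj Q \<Longrightarrow> fst x \<in> Obj J \<and> Ide Q x = (x, Ide J (fst x), x)"
    and "\<And>f. f \<in> Arr Q \<Longrightarrow> fst (snd f) \<in> hom J (fst (Dom Q f)) (fst (Cod Q f))"
    and "\<And>f g. fst (snd (g \<cdot>\<^bsub>Q\<^esub> f)) = fst (snd g) \<cdot>\<^bsub>J\<^esub> fst (snd f)"
  shows "funct Q J (comma_proj Q J)"
proof -
  interpret Q: category Q by fact
  have "(x, Ide J (fst x), x) \<in> Arr Q" if "x \<in> Obj Q" for x
    using Q.obj_simps(3)[OF that] assms(3)[OF that] by simp
  then show ?thesis
    by (intro funct_intro) (use assms in \<open>auto simp: comma_proj_def\<close>)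
qed

lemma funct_coslice_proj:
  assumes "category (coslice_cat u k)" "category (Src u)"
  shows "funct (coslice_cat u k) (Src u) (comma_proj (coslice_cat u k) (Src u))"
  using assms by (rule funct_comma_proj) (auto simp: coslice_cat_def split: prod.splits)

lemma funct_slice_proj:
  assumes "category (slice_cat u k)" "category (Src u)"
  shows "funct (slice_cat u k) (Src u) (comma_proj (slice_cat u k) (Src u))"
  using assms by (rule funct_comma_proj) (auto simp: slice_cat_def split: prod.splits)

lemma cat_iso_funct: "cat_iso_between \<phi> P Q \<Longrightarrow> funct P Q \<phi>"
  by (intro functI) (auto simp: cat_iso_between_def is_cat_iso_def functor_between_def)

definition coslice_pr :: "'u small_functor \<Rightarrow> 'u \<Rightarrow> ('u, 'u, 'u \<times> 'u, ('u \<times> 'u) \<times> 'u \<times> ('u \<times> 'u)) fnct \<Rightarrow>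
    'u small_functor" where
  "coslice_pr u k \<phi> = comma_proj (coslice_cat u k) (Src u) \<circ>\<^sub>F \<phi>"

definition coslice_cell :: "'u small_functor \<Rightarrow> 'u \<Rightarrow>
    ('u, 'u, 'u \<times> 'u, ('u \<times> 'u) \<times> 'u \<times> ('u \<times> 'u)) fnct \<Rightarrow> 'u small_nattrans" where
  "coslice_cell u k \<phi> = \<lparr>NSrc = point (Tgt u) k \<circ>\<^sub>F to_one (Src \<phi>), NTgt = u \<circ>\<^sub>F coslice_pr u k \<phi>,
     NC = (\<lambda>p \<in> Obj (Src \<phi>). snd (FO \<phi> p))\<rparr>"

definition slice_pr :: "'u small_functor \<Rightarrow> 'u \<Rightarrow> ('u, 'u, 'u \<times> 'u, ('u \<times> 'u) \<times> 'u \<times> ('u \<times> 'u)) fnct \<Rightarrow>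
    'u small_functor" where
  "slice_pr u k \<phi> = comma_proj (slice_cat u k) (Src u) \<circ>\<^sub>F \<phi>"

definition slice_cell :: "'u small_functor \<Rightarrow> 'u \<Rightarrow>
    ('u, 'u, 'u \<times> 'u, ('u \<times> 'u) \<times> 'u \<times> ('u \<times> 'u)) fnct \<Rightarrow> 'u small_nattrans" where
  "slice_cell u k \<phi> = \<lparr>NSrc = u \<circ>\<^sub>F slice_pr u k \<phi>, NTgt = point (Tgt u) k \<circ>\<^sub>F to_one (Src \<phi>),
     NC = (\<lambda>p \<in> Obj (Src \<phi>). snd (FO \<phi> p))\<rparr>"

context diagram_category
begin

lemma one_in_Dia [simp]: "one_cat \<in> Dia"
  by (rule finite_posets) (simp add: finite_poset_def category_one)

lemma dia_to_one [simp]: "P \<in> Dia \<Longrightarrow> dia_functor Dia (to_one P)"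
  using funct.is_functor[OF funct_to_one[OF is_category]] by (simp add: dia_functor_def)

lemma dia_point [simp]: "K \<in> Dia \<Longrightarrow> k \<in> Obj K \<Longrightarrow> dia_functor Dia (point K k)"
  using funct.is_functor[OF funct_point[OF is_category]] by (simp add: dia_functor_def)

lemma coslice_projection_cell:
  assumes u: "dia_functor Dia u" and k: "k \<in> Obj (Tgt u)" and P: "P \<in> Dia"
    and \<phi>: "cat_iso_between \<phi> P (coslice_cat u k)"
  shows "dia_functor Dia (coslice_pr u k \<phi>)" "Src (coslice_pr u k \<phi>) = P"
    "Tgt (coslice_pr u k \<phi>) = Src u" "dia_nattrans Dia (coslice_cell u k \<phi>)"
    "NSrc (coslice_cell u k \<phi>) = point (Tgt u) k \<circ>\<^sub>F to_one P"
    "NTgt (coslice_cell u k \<phi>) = u \<circ>\<^sub>F coslice_pr u k \<phi>"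
proof -
  interpret \<phi>: funct P "coslice_cat u k" \<phi> using \<phi> by (rule cat_iso_funct)
  obtain J K where JK: "funct J K u" using u is_functor_funct unfolding dia_functor_def by blast
  then interpret u: funct J K u .
  interpret pr: funct "coslice_cat u k" J "comma_proj (coslice_cat u k) J"
    using funct_coslice_proj[OF \<phi>.cod.category_axioms] u.dom.category_axioms by simp
  have d: "J \<in> Dia" "K \<in> Dia" using u by (auto simp: dia_functor_def)
  have k': "k \<in> Obj K" using k by simp
  show src: "Src (coslice_pr u k \<phi>) = P" "Tgt (coslice_pr u k \<phi>) = Src u"
    by (simp_all add: coslice_pr_def comma_proj_def)
  interpret q: funct P J "coslice_pr u k \<phi>"
    unfolding coslice_pr_def u.src_tgt by (rule funct_comp[OF \<phi>.funct_axioms pr.funct_axioms])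
  show "dia_functor Dia (coslice_pr u k \<phi>)" using P d by (simp add: dia_functor_def)
  show ends: "NSrc (coslice_cell u k \<phi>) = point (Tgt u) k \<circ>\<^sub>F to_one P"
      "NTgt (coslice_cell u k \<phi>) = u \<circ>\<^sub>F coslice_pr u k \<phi>"
    by (simp_all add: coslice_cell_def)
  have q: "FO (coslice_pr u k \<phi>) p = fst (FO \<phi> p)" if "p \<in> Obj P" for p
    using that \<phi>.obj[OF that] by (simp add: coslice_pr_def comma_proj_def)
  have "nattr P K (point K k \<circ>\<^sub>F to_one P) (u \<circ>\<^sub>F coslice_pr u k \<phi>) (coslice_cell u k \<phi>)"
  proof (rule nattr_intro)
    show "funct P K (point K k \<circ>\<^sub>F to_one P)"
      using funct_comp funct_to_one funct_point k' \<phi>.dom.category_axioms u.cod.category_axioms by metis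
    show "funct P K (u \<circ>\<^sub>F coslice_pr u k \<phi>)"
      by (rule funct_comp[OF q.funct_axioms u.funct_axioms])
    show "NC (coslice_cell u k \<phi>) p \<in> hom K (FO (point K k \<circ>\<^sub>F to_one P) p) (FO (u \<circ>\<^sub>F coslice_pr u k \<phi>) p)"
      if "p \<in> Obj P" for p
    proof -
      have "snd (FO \<phi> p) \<in> hom K k (FO u (fst (FO \<phi> p)))"
        using \<phi>.obj[OF that] unfolding coslice_cat_def by (simp add: case_prod_beta)
      then show ?thesis using that by (simp add: coslice_cell_def q)
    qed
    show "NC (coslice_cell u k \<phi>) (Cod P f) \<cdot>\<^bsub>K\<^esub> FA (point K k \<circ>\<^sub>F to_one P) f =
        FA (u \<circ>\<^sub>F coslice_pr u k \<phi>) f \<cdot>\<^bsub>K\<^esub> NC (coslice_cell u k \<phi>) (Dom P f)" if f: "f \<in> Arr P" for f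
    proof -
      obtain j a g j' a' where F: "FA \<phi> f = ((j, a), g, (j', a'))" by (metis prod_cases3 surj_pair)
      have "FO \<phi> (Dom P f) = (j, a)" "FO \<phi> (Cod P f) = (j', a')"
        using \<phi>.arr[OF f] F by (auto simp: coslice_cat_def)
      moreover have "a' = FA u g \<cdot>\<^bsub>K\<^esub> a" "a' \<in> hom K k (FO u j')"
        using \<phi>.arr(1)[OF f] F by (auto simp: coslice_cat_def)
      moreover have "FA (coslice_pr u k \<phi>) f = g"
        using f F \<phi>.arr(1)[OF f] by (simp add: coslice_pr_def comma_proj_def)
      ultimately show ?thesis using f by (simp add: coslice_cell_def)
    qed
  qed (auto simp: coslice_cell_def)
  then have "is_nattrans (coslice_cell u k \<phi>)" by (rule nattr.is_nattrans)
  moreover have "dia_functor Dia (point K k \<circ>\<^sub>F to_one P)"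
    using dia_point[OF d(2) k'] dia_to_one[OF P] unfolding dia_functor_def by simp
  ultimately show "dia_nattrans Dia (coslice_cell u k \<phi>)"
    using ends(1) by (simp add: dia_nattrans_def)
qed

lemma slice_projection_cell:
  assumes u: "dia_functor Dia u" and k: "k \<in> Obj (Tgt u)" and P: "P \<in> Dia"
    and \<phi>: "cat_iso_between \<phi> P (slice_cat u k)"
  shows "dia_functor Dia (slice_pr u k \<phi>)" "Src (slice_pr u k \<phi>) = P"
    "Tgt (slice_pr u k \<phi>) = Src u" "dia_nattrans Dia (slice_cell u k \<phi>)"
    "NSrc (slice_cell u k \<phi>) = u \<circ>\<^sub>F slice_pr u k \<phi>"
    "NTgt (slice_cell u k \<phi>) = point (Tgt u) k \<circ>\<^sub>F to_one P"
proof -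
  interpret \<phi>: funct P "slice_cat u k" \<phi> using \<phi> by (rule cat_iso_funct)
  obtain J K where JK: "funct J K u" using u is_functor_funct unfolding dia_functor_def by blast
  then interpret u: funct J K u .
  interpret pr: funct "slice_cat u k" J "comma_proj (slice_cat u k) J"
    using funct_slice_proj[OF \<phi>.cod.category_axioms] u.dom.category_axioms by simp
  have d: "J \<in> Dia" "K \<in> Dia" using u by (auto simp: dia_functor_def)
  have k': "k \<in> Obj K" using k by simp
  show src: "Src (slice_pr u k \<phi>) = P" "Tgt (slice_pr u k \<phi>) = Src u"
    by (simp_all add: slice_pr_def comma_proj_def)
  interpret q: funct P J "slice_pr u k \<phi>"
    unfolding slice_pr_def u.src_tgt by (rule funct_comp[OF \<phi>.funct_axioms pr.funct_axioms])
  show dq: "dia_functor Dia (slice_pr u k \<phi>)" using P d by (simp add: dia_functor_def)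
  show ends: "NSrc (slice_cell u k \<phi>) = u \<circ>\<^sub>F slice_pr u k \<phi>"
      "NTgt (slice_cell u k \<phi>) = point (Tgt u) k \<circ>\<^sub>F to_one P"
    by (simp_all add: slice_cell_def)
  have q: "FO (slice_pr u k \<phi>) p = fst (FO \<phi> p)" if "p \<in> Obj P" for p
    using that \<phi>.obj[OF that] by (simp add: slice_pr_def comma_proj_def)
  have "nattr P K (u \<circ>\<^sub>F slice_pr u k \<phi>) (point K k \<circ>\<^sub>F to_one P) (slice_cell u k \<phi>)"
  proof (rule nattr_intro)
    show "funct P K (point K k \<circ>\<^sub>F to_one P)"
      using funct_comp funct_to_one funct_point k' \<phi>.dom.category_axioms u.cod.category_axioms by metis
    show "funct P K (u \<circ>\<^sub>F slice_pr u k \<phi>)"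
      by (rule funct_comp[OF q.funct_axioms u.funct_axioms])
    show "NC (slice_cell u k \<phi>) p \<in> hom K (FO (u \<circ>\<^sub>F slice_pr u k \<phi>) p) (FO (point K k \<circ>\<^sub>F to_one P) p)"
      if "p \<in> Obj P" for p
    proof -
      have "snd (FO \<phi> p) \<in> hom K (FO u (fst (FO \<phi> p))) k"
        using \<phi>.obj[OF that] unfolding slice_cat_def by (simp add: case_prod_beta)
      then show ?thesis using that by (simp add: slice_cell_def q)
    qed
    show "NC (slice_cell u k \<phi>) (Cod P f) \<cdot>\<^bsub>K\<^esub> FA (u \<circ>\<^sub>F slice_pr u k \<phi>) f =
        FA (point K k \<circ>\<^sub>F to_one P) f \<cdot>\<^bsub>K\<^esub> NC (slice_cell u k \<phi>) (Dom P f)" if f: "f \<in> Arr P" for f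
    proof -
      obtain j a g j' a' where F: "FA \<phi> f = ((j, a), g, (j', a'))" by (metis prod_cases3 surj_pair)
      have "FO \<phi> (Dom P f) = (j, a)" "FO \<phi> (Cod P f) = (j', a')"
        using \<phi>.arr[OF f] F by (auto simp: slice_cat_def)
      moreover have "a = a' \<cdot>\<^bsub>K\<^esub> FA u g" "a \<in> hom K (FO u j) k"
        using \<phi>.arr(1)[OF f] F by (auto simp: slice_cat_def)
      moreover have "FA (slice_pr u k \<phi>) f = g"
        using f F \<phi>.arr(1)[OF f] by (simp add: slice_pr_def comma_proj_def)
      ultimately show ?thesis using f by (simp add: slice_cell_def)
    qed
  qed (auto simp: slice_cell_def)
  then have "is_nattrans (slice_cell u k \<phi>)" by (rule nattr.is_nattrans)
  moreover have "dia_functor Dia (u \<circ>\<^sub>F slice_pr u k \<phi>)"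
    using u dq unfolding dia_functor_def by simp
  ultimately show "dia_nattrans Dia (slice_cell u k \<phi>)"
    using ends(1) by (simp add: dia_nattrans_def)
qed

lemma coprod_leg:
  assumes J: "\<And>i. i \<in> I \<Longrightarrow> J i \<in> Dia" and P: "P \<in> Dia"
    and \<phi>: "cat_iso_between \<phi> (coprod_cat I J) P" and i: "i \<in> I"
  shows "dia_functor Dia (\<phi> \<circ>\<^sub>F coprod_incl I J i)"
proof -
  interpret \<phi>: funct "coprod_cat I J" P \<phi> using \<phi> by (rule cat_iso_funct)
  have "funct (J i) (coprod_cat I J) (coprod_incl I J i)"
    by (rule funct_intro[OF is_category[OF J[OF i]] \<phi>.dom.category_axioms])
      (use is_category[OF J[OF i]] i in \<open>auto simp: coprod_incl_def coprod_cat_def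
        category.obj_simps category.comp_simps\<close>)
  from funct_comp[OF this \<phi>.funct_axioms] show ?thesis
    using J[OF i] P by (simp add: dia_functor_def funct.is_functor coprod_incl_def)
qed

end

context dia_prederivator
begin

lemma der3L_iff: "der3L Dia D \<longleftrightarrow>
    (\<forall>u. dia_functor Dia u \<longrightarrow> (\<forall>X \<in> Obj (Val D (Src u)). \<exists>A e. univ_to (Pull D u) X A e))"
  unfolding der3L_def using funct.right_adjoint_iff[OF pull] by blast

lemma der3R_iff: "der3R Dia D \<longleftrightarrow>
    (\<forall>u. dia_functor Dia u \<longrightarrow> (\<forall>X \<in> Obj (Val D (Src u)). \<exists>A h. univ_from (Pull D u) X A h))"
  unfolding der3R_def using funct.left_adjoint_iff[OF pull] by blast

text \<open>
  Consider a 2-cell \<open>\<alpha> : v \<circ> w \<Rightarrow> u \<circ> p\<close>. Base change for right Kan extensions says that \<open>v\<^sup>*\<close> of a right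
  Kan extension along \<open>u\<close> is a right Kan extension along \<open>w\<close> of the restriction by \<open>p\<close>. It is stated
  for all universal arrows, so that it does not depend on chosen adjoints. For left Kan extensions
  the 2-cell goes the other way.
\<close>

definition base_change_to :: "'u small_functor \<Rightarrow> 'u small_functor \<Rightarrow> 'u small_functor \<Rightarrow>
    'u small_functor \<Rightarrow> 'u small_nattrans \<Rightarrow> bool" where
  "base_change_to u w p v \<alpha> \<longleftrightarrow> (\<forall>X A e. univ_to (Pull D u) X A e \<longrightarrow>
     univ_to (Pull D w) (FO (Pull D p) X) (FO (Pull D v) A)
       (FA (Pull D p) e \<cdot>\<^bsub>Val D (Src w)\<^esub> NC (Pull2 D \<alpha>) A))"

definition base_change_from :: "'u small_functor \<Rightarrow> 'u small_functor \<Rightarrow> 'u small_functor \<Rightarrow>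
    'u small_functor \<Rightarrow> 'u small_nattrans \<Rightarrow> bool" where
  "base_change_from u w p v \<alpha> \<longleftrightarrow> (\<forall>X A h. univ_from (Pull D u) X A h \<longrightarrow>
     univ_from (Pull D w) (FO (Pull D p) X) (FO (Pull D v) A)
       (NC (Pull2 D \<alpha>) A \<cdot>\<^bsub>Val D (Src w)\<^esub> FA (Pull D p) h))"

end

locale dia_square = dia_prederivator Dia D
  for Dia :: "'u small_cat set" and D :: "('u, 'o, 'a) prederivator" +
  fixes u w p v :: "'u small_functor" and \<alpha> :: "'u small_nattrans"
  assumes dia [simp]: "dia_functor Dia u" "dia_functor Dia w" "dia_functor Dia p" "dia_functor Dia v"
    and corners [simp]: "Src p = Src w" "Tgt p = Src u" "Tgt w = Src v" "Tgt v = Tgt u"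
    and cell: "dia_nattrans Dia \<alpha>"

locale right_square = dia_square +
  assumes ends: "NSrc \<alpha> = v \<circ>\<^sub>F w" "NTgt \<alpha> = u \<circ>\<^sub>F p"
begin

lemma pull2_cell:
  "nattr (Val D (Tgt u)) (Val D (Src w)) (Pull D w \<circ>\<^sub>F Pull D v) (Pull D p \<circ>\<^sub>F Pull D u) (Pull2 D \<alpha>)"
  using pull2[OF cell] by (simp add: ends pull_comp)

lemma mate_iso_iff:
  assumes "adjunction (Pull D u) R \<eta> \<epsilon>" "adjunction (Pull D w) R' \<eta>' \<epsilon>'"
  shows "is_nat_iso (((R' \<circ>\<^sub>F Pull D p) \<lhd> \<epsilon>) \<circ>\<^sub>N (R' \<lhd> Pull2 D \<alpha> \<rhd> R) \<circ>\<^sub>N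
    (\<eta>' \<rhd> (Pull D v \<circ>\<^sub>F R))) \<longleftrightarrow> base_change_to u w p v \<alpha>"
  unfolding base_change_to_def
  by (rule right_mate_iso_iff[OF assms pull _ _ _ pull2_cell])
    (use pull[of w] pull[of p] pull[of v] in simp_all)

end

locale left_square = dia_square +
  assumes ends: "NSrc \<alpha> = u \<circ>\<^sub>F p" "NTgt \<alpha> = v \<circ>\<^sub>F w"
begin

lemma pull2_cell:
  "nattr (Val D (Tgt u)) (Val D (Src w)) (Pull D p \<circ>\<^sub>F Pull D u) (Pull D w \<circ>\<^sub>F Pull D v) (Pull2 D \<alpha>)"
  using pull2[OF cell] by (simp add: ends pull_comp)

lemma mate_iso_iff:
  assumes "adjunction L (Pull D u) \<eta> \<epsilon>" "adjunction L' (Pull D w) \<eta>' \<epsilon>'"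
  shows "is_nat_iso ((\<epsilon>' \<rhd> (Pull D v \<circ>\<^sub>F L)) \<circ>\<^sub>N (L' \<lhd> Pull2 D \<alpha> \<rhd> L) \<circ>\<^sub>N
    ((L' \<circ>\<^sub>F Pull D p) \<lhd> \<eta>)) \<longleftrightarrow> base_change_from u w p v \<alpha>"
  unfolding base_change_from_def
  by (rule left_mate_iso_iff[OF assms pull _ _ _ pull2_cell])
    (use pull[of w] pull[of p] pull[of v] in simp_all)

end

context dia_prederivator
begin

lemma coslice_square:
  assumes "dia_functor Dia u" "k \<in> Obj (Tgt u)" "P \<in> Dia" "cat_iso_between \<phi> P (coslice_cat u k)"
  shows "right_square Dia D u (to_one P) (coslice_pr u k \<phi>) (point (Tgt u) k) (coslice_cell u k \<phi>)"
  using coslice_projection_cell[OF assms] assms by unfold_locales simp_all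

lemma slice_square:
  assumes "dia_functor Dia u" "k \<in> Obj (Tgt u)" "P \<in> Dia" "cat_iso_between \<phi> P (slice_cat u k)"
  shows "left_square Dia D u (to_one P) (slice_pr u k \<phi>) (point (Tgt u) k) (slice_cell u k \<phi>)"
  using slice_projection_cell[OF assms] assms by unfold_locales simp_all

text \<open>
  The existence of the Kan extensions is assumed because the axiom speaks of all adjoints and would
  be void if there were none.
\<close>

lemma der4L_iff:
  assumes "der3L Dia D"
  shows "der4L Dia D \<longleftrightarrow>
    (\<forall>u k P \<phi>. dia_functor Dia u \<and> k \<in> Obj (Tgt u) \<and> P \<in> Dia \<and> cat_iso_between \<phi> P (coslice_cat u k) \<longrightarrow>
      base_change_to u (to_one P) (coslice_pr u k \<phi>) (point (Tgt u) k) (coslice_cell u k \<phi>))"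
proof -
  have "(\<forall>R \<eta> \<epsilon> R' \<eta>' \<epsilon>'. adjunction (Pull D u) R \<eta> \<epsilon> \<and> adjunction (Pull D (to_one P)) R' \<eta>' \<epsilon>' \<longrightarrow>
      is_nat_iso (((R' \<circ>\<^sub>F Pull D (coslice_pr u k \<phi>)) \<lhd> \<epsilon>) \<circ>\<^sub>N
        (R' \<lhd> Pull2 D (coslice_cell u k \<phi>) \<rhd> R) \<circ>\<^sub>N (\<eta>' \<rhd> (Pull D (point (Tgt u) k) \<circ>\<^sub>F R)))) \<longleftrightarrow>
      base_change_to u (to_one P) (coslice_pr u k \<phi>) (point (Tgt u) k) (coslice_cell u k \<phi>)"
    if "dia_functor Dia u" "k \<in> Obj (Tgt u)" "P \<in> Dia" "cat_iso_between \<phi> P (coslice_cat u k)" for u k P \<phi>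
  proof -
    have "\<exists>R \<eta> \<epsilon>. adjunction (Pull D u) R \<eta> \<epsilon>" "\<exists>R' \<eta>' \<epsilon>'. adjunction (Pull D (to_one P)) R' \<eta>' \<epsilon>'"
      using assms that(1) dia_to_one[OF that(3)] unfolding der3L_def by blast+
    then show ?thesis using right_square.mate_iso_iff[OF coslice_square[OF that]] by blast
  qed
  then show ?thesis
    unfolding der4L_def Let_def coslice_pr_def[symmetric]
    by (simp add: coslice_cell_def cat_iso_between_def cong: conj_cong)
qed

lemma der4R_iff:
  assumes "der3R Dia D"
  shows "der4R Dia D \<longleftrightarrow>
    (\<forall>u k P \<phi>. dia_functor Dia u \<and> k \<in> Obj (Tgt u) \<and> P \<in> Dia \<and> cat_iso_between \<phi> P (slice_cat u k) \<longrightarrow>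
      base_change_from u (to_one P) (slice_pr u k \<phi>) (point (Tgt u) k) (slice_cell u k \<phi>))"
proof -
  have "(\<forall>L \<eta> \<epsilon> L' \<eta>' \<epsilon>'. adjunction L (Pull D u) \<eta> \<epsilon> \<and> adjunction L' (Pull D (to_one P)) \<eta>' \<epsilon>' \<longrightarrow>
      is_nat_iso ((\<epsilon>' \<rhd> (Pull D (point (Tgt u) k) \<circ>\<^sub>F L)) \<circ>\<^sub>N
        (L' \<lhd> Pull2 D (slice_cell u k \<phi>) \<rhd> L) \<circ>\<^sub>N ((L' \<circ>\<^sub>F Pull D (slice_pr u k \<phi>)) \<lhd> \<eta>))) \<longleftrightarrow>
      base_change_from u (to_one P) (slice_pr u k \<phi>) (point (Tgt u) k) (slice_cell u k \<phi>)"
    if "dia_functor Dia u" "k \<in> Obj (Tgt u)" "P \<in> Dia" "cat_iso_between \<phi> P (slice_cat u k)" for u k P \<phi>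
  proof -
    have "\<exists>L \<eta> \<epsilon>. adjunction L (Pull D u) \<eta> \<epsilon>" "\<exists>L' \<eta>' \<epsilon>'. adjunction L' (Pull D (to_one P)) \<eta>' \<epsilon>'"
      using assms that(1) dia_to_one[OF that(3)] unfolding der3R_def by blast+
    then show ?thesis using left_square.mate_iso_iff[OF slice_square[OF that]] by blast
  qed
  then show ?thesis
    unfolding der4R_def Let_def slice_pr_def[symmetric]
    by (simp add: slice_cell_def cat_iso_between_def cong: conj_cong)
qed

end

section \<open>Modules form a derivator\<close>

context prederivator_monad
begin

lemma dia_prederivator_N: "dia_prederivator Dia N"
  using diagram_category_axioms prederivator_N by (simp add: dia_prederivator_def)

text \<open>
  Pass to underlying objects, apply base change there, and lift the resulting universal arrow; the
  composite in question is linear, being a composite of linear maps.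
\<close>

lemma base_change_to_N:
  assumes sq: "right_square Dia D u w p v \<alpha>"
    and ex: "\<And>X. X \<in> Obj (Val D (Src u)) \<Longrightarrow> \<exists>A e. univ_to (Pull D u) X A e"
    and pres: "base_change_to u w p v \<alpha>"
  shows "dia_prederivator.base_change_to N u w p v \<alpha>"
  unfolding dia_prederivator.base_change_to_def[OF dia_prederivator_N]
proof (intro allI impI)
  fix X A t assume t: "univ_to (Pull N u) X A t"
  interpret right_square Dia D u w p v \<alpha> by fact
  interpret u: restriction D M \<mu> S u "Src u" "Tgt u" by (rule restriction_along) simp
  interpret w: restriction D M \<mu> S w "Src w" "Src v" using restriction_along[OF dia(2)] by simp
  interpret Nu: funct u.M.Mods u.M'.Mods "Pull N u" using pull_N[OF dia(1)] by simp
  interpret Np: funct u.M'.Mods w.M'.Mods "Pull N p" using pull_N[OF dia(3)] by simp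
  interpret Nv: funct u.M.Mods w.M.Mods "Pull N v" using pull_N[OF dia(4)] by simp
  interpret NS: right_square Dia N u w p v \<alpha>
    using dia_prederivator_N cell by (intro right_square.intro dia_square.intro
      dia_square_axioms.intro right_square_axioms.intro) (simp_all add: ends)
  interpret Na: nattr u.M.Mods w.M'.Mods "Pull N w \<circ>\<^sub>F Pull N v" "Pull N p \<circ>\<^sub>F Pull N u" "Pull2 N \<alpha>"
    using NS.pull2_cell by simp
  have t': "univ_to u.lift X A t" using t by (simp add: Pull_N[of u])
  then have A: "A \<in> Obj u.M.Mods" and X: "X \<in> Obj u.M'.Mods" and tX: "t \<in> Arr u.M'.Mods"
    using u.lift.univ_to_arr by auto
  obtain e where te: "t = (lift_along u A, e, X)" and e: "univ_to (Pull D u) (fst X) (fst A) e"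
    by (rule u.univ_to_underlying[OF ex t'])
  let ?A = "lift_along v A" and ?X = "lift_obj (Val D (Src w)) (Pull D p) (Gam M p) X"
  have v: "?A \<in> Obj w.M.Mods" using Nv.obj[OF A] A by simp
  have src: "lift_obj (Val D (Src w)) (Pull D (v \<circ>\<^sub>F w)) (Gam M (v \<circ>\<^sub>F w)) A = lift_along w ?A"
    by (rule lift_along_comp) (use A in simp_all)
  let ?t = "FA (Pull N p) t \<cdot>\<^bsub>w.M'.Mods\<^esub> NC (Pull2 N \<alpha>) A"
  have eq: "?t = (lift_along w ?A, FA (Pull D p) e \<cdot>\<^bsub>Val D (Src w)\<^esub> NC (Pull2 D \<alpha>) (fst A), ?X)"
    using A te tX by (simp add: ends src)
  have "?t \<in> Arr w.M'.Mods" using Na.cpt[OF A] Np.arr[of t] te tX A X by simp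
  then have "univ_to w.lift ?X ?A ?t"
    using v pres e unfolding eq by (intro w.univ_to_lift) (simp_all add: base_change_to_def)
  then show "univ_to (Pull N w) (FO (Pull N p) X) (FO (Pull N v) A)
      (FA (Pull N p) t \<cdot>\<^bsub>Val N (Src w)\<^esub> NC (Pull2 N \<alpha>) A)"
    using A X by (simp add: Pull_N[of w])
qed

end

locale cocontinuous_derivator_monad = prederivator_monad +
  assumes derivator: "derivator Dia D" and cocontinuous: "cocontinuous Dia D M"
begin

lemma der: "der1 Dia D" "der2 Dia D" "der3L Dia D" "der3R Dia D" "der4L Dia D" "der4R Dia D"
  using derivator by (auto simp: derivator_def)

lemma ex_univ_to:
  "\<lbrakk>dia_functor Dia u; X \<in> Obj (Val D (Src u))\<rbrakk> \<Longrightarrow> \<exists>A e. univ_to (Pull D u) X A e"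
  using der(3) unfolding der3L_iff by blast

lemma ex_univ_from:
  "\<lbrakk>dia_functor Dia u; X \<in> Obj (Val D (Src u))\<rbrakk> \<Longrightarrow> \<exists>A e. univ_from (Pull D u) X A e"
  using der(4) unfolding der3R_iff by blast

text \<open>
  Cocontinuity says that a mate is invertible whose source and target use the same adjunction; in
  terms of universal arrows it says that the monad preserves those of left Kan extensions.
\<close>

lemma cocontinuous_restriction_along:
  assumes u: "dia_functor Dia u"
  shows "cocontinuous_restriction D M \<mu> S u (Src u) (Tgt u)"
proof -
  interpret u: restriction D M \<mu> S u "Src u" "Tgt u"
    by (rule restriction_along[OF u])
  obtain L \<eta> \<epsilon> where a: "adjunction L (Pull D u) \<eta> \<epsilon>"
    using der(4) u unfolding der3R_def by blast
  have i: "nattr (Val D (Tgt u)) (Val D (Src u)) (Cpt M (Src u) \<circ>\<^sub>F Pull D u)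
      (Pull D u \<circ>\<^sub>F Cpt M (Tgt u)) (inv_nattrans (Gam M u))"
    by (rule nattr_inv[OF u.\<gamma>.nattr_axioms]) simp
  have "is_nat_iso ((\<epsilon> \<rhd> (Cpt M (Tgt u) \<circ>\<^sub>F L)) \<circ>\<^sub>N (L \<lhd> inv_nattrans (Gam M u) \<rhd> L) \<circ>\<^sub>N
      ((L \<circ>\<^sub>F Cpt M (Src u)) \<lhd> \<eta>))"
    using cocontinuous u a unfolding cocontinuous_def by blast
  then have *: "univ_from (Pull D u) (FO (Cpt M (Src u)) X) (FO (Cpt M (Tgt u)) A)
      (NC (inv_nattrans (Gam M u)) A \<cdot>\<^bsub>Val D (Src u)\<^esub> FA (Cpt M (Src u)) h)"
    if "univ_from (Pull D u) X A h" for X A h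
    using that left_mate_iso_iff[OF a a u.F.funct_axioms u.F.funct_axioms u.M'.T.funct_axioms
        u.M.T.funct_axioms i] by blast
  show ?thesis
  proof
    fix X A h assume h: "univ_from (Pull D u) X A h"
    then show "univ_from (Pull D u) (FO (Cpt M (Src u)) X) (FO (Cpt M (Tgt u)) A)
        (u.\<delta> A \<cdot>\<^bsub>Val D (Src u)\<^esub> FA (Cpt M (Src u)) h)"
      using *[OF h] u.F.univ_from_arr[OF h] by simp
  qed
qed

lemma base_change_from_N:
  assumes sq: "left_square Dia D u w p v \<alpha>" and pres: "base_change_from u w p v \<alpha>"
  shows "dia_prederivator.base_change_from N u w p v \<alpha>"
  unfolding dia_prederivator.base_change_from_def[OF dia_prederivator_N]
proof (intro allI impI)
  fix X A t assume t: "univ_from (Pull N u) X A t"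
  interpret left_square Dia D u w p v \<alpha> by fact
  interpret u: cocontinuous_restriction D M \<mu> S u "Src u" "Tgt u" by (rule cocontinuous_restriction_along) simp
  interpret w: cocontinuous_restriction D M \<mu> S w "Src w" "Src v" using cocontinuous_restriction_along[OF dia(2)] by simp
  interpret Nu: funct u.M.Mods u.M'.Mods "Pull N u" using pull_N[OF dia(1)] by simp
  interpret Np: funct u.M'.Mods w.M'.Mods "Pull N p" using pull_N[OF dia(3)] by simp
  interpret Nv: funct u.M.Mods w.M.Mods "Pull N v" using pull_N[OF dia(4)] by simp
  interpret NS: left_square Dia N u w p v \<alpha>
    using dia_prederivator_N cell by (intro left_square.intro dia_square.intro
      dia_square_axioms.intro left_square_axioms.intro) (simp_all add: ends)
  interpret Na: nattr u.M.Mods w.M'.Mods "Pull N p \<circ>\<^sub>F Pull N u" "Pull N w \<circ>\<^sub>F Pull N v" "Pull2 N \<alpha>"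
    using NS.pull2_cell by simp
  have t': "univ_from u.lift X A t" using t by (simp add: Pull_N[of u])
  then have A: "A \<in> Obj u.M.Mods" and X: "X \<in> Obj u.M'.Mods" and tX: "t \<in> Arr u.M'.Mods"
    using u.lift.univ_from_arr by auto
  obtain h where th: "t = (X, h, lift_along u A)" and h: "univ_from (Pull D u) (fst X) (fst A) h"
    by (rule u.univ_from_underlying[OF ex_univ_from[OF dia(1)] t'])
  let ?A = "lift_along v A" and ?X = "lift_obj (Val D (Src w)) (Pull D p) (Gam M p) X"
  have v: "?A \<in> Obj w.M.Mods" using Nv.obj[OF A] A by simp
  have tgt: "lift_obj (Val D (Src w)) (Pull D (v \<circ>\<^sub>F w)) (Gam M (v \<circ>\<^sub>F w)) A = lift_along w ?A"
    by (rule lift_along_comp) (use A in simp_all)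
  let ?t = "NC (Pull2 N \<alpha>) A \<cdot>\<^bsub>w.M'.Mods\<^esub> FA (Pull N p) t"
  have eq: "?t = (?X, NC (Pull2 D \<alpha>) (fst A) \<cdot>\<^bsub>Val D (Src w)\<^esub> FA (Pull D p) h, lift_along w ?A)"
    using A th tX by (simp add: ends tgt)
  have "?t \<in> Arr w.M'.Mods" using Na.cpt[OF A] Np.arr[of t] th tX A X by simp
  then have "univ_from w.lift ?X ?A ?t"
    using v pres h unfolding eq by (intro w.univ_from_lift) (simp_all add: base_change_from_def)
  then show "univ_from (Pull N w) (FO (Pull N p) X) (FO (Pull N v) A)
      (NC (Pull2 N \<alpha>) A \<cdot>\<^bsub>Val N (Src w)\<^esub> FA (Pull N p) t)"
    using A X by (simp add: Pull_N[of w])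
qed

text \<open>
  Let \<open>w i\<close> be the inclusions of the summands. Objects and maps over the coproduct are determined
  by their restrictions along all \<open>w i\<close>. A map is linear if its restrictions are, since the equation
  can be tested after restriction. Given modules \<open>Y i\<close>, glue their underlying objects to an object \<open>A\<close>
  and their actions, transported to the restrictions of \<open>A\<close>, to an action on \<open>A\<close>.
\<close>

lemma der1_N: "der1 Dia N"
  unfolding der1_def
proof (intro allI impI)
  fix I :: "nat set" and J P \<phi>
  assume a: "finite I \<and> (\<forall>i\<in>I. J i \<in> Dia) \<and> P \<in> Dia \<and> cat_iso_between \<phi> (coprod_cat I J) P"
  define w where "w i = \<phi> \<circ>\<^sub>F coprod_incl I J i" for i
  have w: "dia_functor Dia (w i)" if "i \<in> I" for i
    using coprod_leg[of I J P \<phi> i] a that by (simp add: w_def)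
  have ends [simp]: "Src (w i) = J i" "Tgt (w i) = P" for i
    using a by (simp_all add: w_def coprod_incl_def cat_iso_between_def)
  interpret P: em_monad "Val D P" "Cpt M P" "\<mu> P" "S P" using a by (intro monad_at) simp
  interpret d: functor_family "Val D P" I "\<lambda>i. Val D (J i)" "\<lambda>i. Pull D (w i)"
    by (intro functor_family.intro functor_family_axioms.intro)
      (use pull[OF w] P.T.dom.category_axioms in simp_all)
  interpret n: functor_family P.Mods I "\<lambda>i. Val N (J i)" "\<lambda>i. Pull N (w i)"
    by (intro functor_family.intro functor_family_axioms.intro)
      (use pull_N[OF w] P.category_Mods in simp_all)
  have "is_equivalence (tuple_functor (Val D P) I (\<lambda>i. Pull D (w i)))"
    using der(1) a unfolding der1_def w_def by blast
  then have ff: "d.jointly_fully_faithful" and es: "d.jointly_ess_surjective"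
    by (simp_all add: d.is_equivalence_tuple_iff)
  note lifti = pull_N[OF w]
  have "n.jointly_fully_faithful"
    unfolding n.jointly_fully_faithful_def
  proof (intro ballI allI impI)
    fix X Y t
    assume X: "X \<in> Obj P.Mods" and Y: "Y \<in> Obj P.Mods"
      and t: "\<forall>i\<in>I. t i \<in> hom (Val N (J i)) (FO (Pull N (w i)) X) (FO (Pull N (w i)) Y)"
    define g where "g i = fst (snd (t i))" for i
    have tg: "t i = (lift_along (w i) X, g i, lift_along (w i) Y)"
      and g: "(lift_along (w i) X, g i, lift_along (w i) Y) \<in> Arr (Val N (J i))" if i: "i \<in> I" for i
    proof -
      interpret m: restriction D M \<mu> S "w i" "J i" P
        using restriction_along[OF w[OF i]] by simp
      have "t i \<in> Arr m.M'.Mods" "Dom m.M'.Mods (t i) = lift_along (w i) X"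
          "Cod m.M'.Mods (t i) = lift_along (w i) Y"
        using t i X Y w[OF i] by auto
      then obtain h where "t i = (lift_along (w i) X, h, lift_along (w i) Y)"
          "(lift_along (w i) X, h, lift_along (w i) Y) \<in> Arr m.M'.Mods"
        using m.M'.arrE by metis
      then show "t i = (lift_along (w i) X, g i, lift_along (w i) Y)"
          "(lift_along (w i) X, g i, lift_along (w i) Y) \<in> Arr (Val N (J i))"
        by (simp_all add: g_def)
    qed
    have gi: "g i \<in> hom (Val D (J i)) (FO (Pull D (w i)) (fst X)) (FO (Pull D (w i)) (fst Y))" if i: "i \<in> I" for i
    proof -
      interpret m: em_monad "Val D (J i)" "Cpt M (J i)" "\<mu> (J i)" "S (J i)"
        using a i by (intro monad_at) simp
      show ?thesis using g[OF i] by (simp add: m.linear_iff)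
    qed
    obtain f where f: "f \<in> hom (Val D P) (fst X) (fst Y)" "\<And>i. i \<in> I \<Longrightarrow> FA (Pull D (w i)) f = g i"
      by (rule d.jointly_fullE[OF ff _ _ gi]) (use X Y in auto)
    have "f \<cdot>\<^bsub>Val D P\<^esub> snd X = snd Y \<cdot>\<^bsub>Val D P\<^esub> FA (Cpt M P) f"
    proof (rule d.jointly_faithful[OF ff])
      fix i assume i: "i \<in> I"
      interpret m: restriction D M \<mu> S "w i" "J i" P
        using restriction_along[OF w[OF i]] by simp
      let ?C = "Val D (J i)" and ?F = "FA (Pull D (w i))" and ?\<gamma> = "NC (Gam M (w i)) (fst X)"
      have [simp]: "?F f = g i" and eq: "g i \<cdot>\<^bsub>?C\<^esub> ?F (snd X) \<cdot>\<^bsub>?C\<^esub> m.\<delta> (fst X) =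
          ?F (snd Y) \<cdot>\<^bsub>?C\<^esub> m.\<delta> (fst Y) \<cdot>\<^bsub>?C\<^esub> FA (Cpt M (J i)) (g i)"
        using f(2)[OF i] g[OF i] X Y by (auto simp: m.M'.linear_iff)
      have "?F (f \<cdot>\<^bsub>Val D P\<^esub> snd X) = (g i \<cdot>\<^bsub>?C\<^esub> ?F (snd X) \<cdot>\<^bsub>?C\<^esub> m.\<delta> (fst X)) \<cdot>\<^bsub>?C\<^esub> ?\<gamma>"
        using X f(1) gi[OF i] by simp
      also have "\<dots> = ?F (snd Y) \<cdot>\<^bsub>?C\<^esub> m.\<delta> (fst Y) \<cdot>\<^bsub>?C\<^esub> FA (Cpt M (J i)) (g i) \<cdot>\<^bsub>?C\<^esub> ?\<gamma>"
        unfolding eq using X Y gi[OF i] by simp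
      also have "\<dots> = ?F (snd Y) \<cdot>\<^bsub>?C\<^esub> m.\<delta> (fst Y) \<cdot>\<^bsub>?C\<^esub> NC (Gam M (w i)) (fst Y) \<cdot>\<^bsub>?C\<^esub> ?F (FA (Cpt M P) f)"
        using f(1) m.\<gamma>_natural(1)[of f "fst Y"] by simp
      also have "\<dots> = ?F (snd Y \<cdot>\<^bsub>Val D P\<^esub> FA (Cpt M P) f)"
        using Y f(1) by simp
      finally show "?F (f \<cdot>\<^bsub>Val D P\<^esub> snd X) = ?F (snd Y \<cdot>\<^bsub>Val D P\<^esub> FA (Cpt M P) f)" .
    qed (use X Y f(1) in auto)
    then have lin: "(X, f, Y) \<in> Arr P.Mods" using X Y f(1) by (simp add: P.linear_iff)
    show "\<exists>!s. s \<in> hom P.Mods X Y \<and> (\<forall>i\<in>I. FA (Pull N (w i)) s = t i)"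
    proof (rule ex1I[of _ "(X, f, Y)"])
      show "(X, f, Y) \<in> hom P.Mods X Y \<and> (\<forall>i\<in>I. FA (Pull N (w i)) (X, f, Y) = t i)"
        using lin f tg w by simp
      fix s assume s: "s \<in> hom P.Mods X Y \<and> (\<forall>i\<in>I. FA (Pull N (w i)) s = t i)"
      then obtain f' where f': "s = (X, f', Y)" "(X, f', Y) \<in> Arr P.Mods"
        using P.arrE[of s X Y] unfolding in_hom by metis
      have "f' = f"
      proof (rule d.jointly_faithful[OF ff])
        show "FA (Pull D (w i)) f' = FA (Pull D (w i)) f" if "i \<in> I" for i
          using s f' that w[OF that] tg[OF that] f by auto
      qed (use f(1) f'(2) in \<open>auto simp: P.linear_iff\<close>)
      then show "s = (X, f, Y)" using f' by simp
    qed
  qed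
  moreover have "n.jointly_ess_surjective"
    unfolding n.jointly_ess_surjective_def
  proof (intro allI impI)
    fix Y assume Y: "\<forall>i\<in>I. Y i \<in> Obj (Val N (J i))"
    have "\<forall>i\<in>I. fst (Y i) \<in> Obj (Val D (J i))"
    proof
      fix i assume i: "i \<in> I"
      then interpret m: em_monad "Val D (J i)" "Cpt M (J i)" "\<mu> (J i)" "S (J i)"
        using a by (intro monad_at) simp
      show "fst (Y i) \<in> Obj (Val D (J i))" using Y i by simp
    qed
    then have "\<exists>A \<in> Obj (Val D P). \<forall>i \<in> I. iso_objs (Val D (J i)) (FO (Pull D (w i)) A) (fst (Y i))"
      using es unfolding d.jointly_ess_surjective_def by simp
    then obtain A where A: "A \<in> Obj (Val D P)"
      and "\<forall>i \<in> I. \<exists>s. is_iso (Val D (J i)) s \<and> Dom (Val D (J i)) s = FO (Pull D (w i)) A \<and>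
        Cod (Val D (J i)) s = fst (Y i)"
      unfolding iso_objs_def Bex_def in_hom by blast
    then obtain s where s: "\<And>i. i \<in> I \<Longrightarrow> is_iso (Val D (J i)) (s i) \<and>
        Dom (Val D (J i)) (s i) = FO (Pull D (w i)) A \<and> Cod (Val D (J i)) (s i) = fst (Y i)"
      by metis
    \<comment> \<open>The action of \<open>Y i\<close> transported along \<open>s i\<close>, as a map out of the restriction of \<open>M A\<close>.\<close>
    define g where "g i = inv_arr (Val D (J i)) (s i) \<cdot>\<^bsub>Val D (J i)\<^esub> snd (Y i) \<cdot>\<^bsub>Val D (J i)\<^esub>
      FA (Cpt M (J i)) (s i) \<cdot>\<^bsub>Val D (J i)\<^esub> NC (Gam M (w i)) A" for i
    have gi: "g i \<in> hom (Val D (J i)) (FO (Pull D (w i)) (FO (Cpt M P) A)) (FO (Pull D (w i)) A)"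
      if i: "i \<in> I" for i
    proof -
      interpret m: restriction D M \<mu> S "w i" "J i" P
        using restriction_along[OF w[OF i]] by simp
      have "Y i \<in> Obj m.M'.Mods" using Y i by simp
      then show ?thesis using A s[OF i] by (auto simp: g_def)
    qed
    obtain b where b: "b \<in> hom (Val D P) (FO (Cpt M P) A) A" "\<And>i. i \<in> I \<Longrightarrow> FA (Pull D (w i)) b = g i"
      by (rule d.jointly_fullE[OF ff _ _ gi]) (use A in auto)
    have unit: "b \<cdot>\<^bsub>Val D P\<^esub> NC (S P) A = Ide (Val D P) A"
    proof (rule d.jointly_faithful[OF ff])
      fix i assume i: "i \<in> I"
      interpret m: restriction D M \<mu> S "w i" "J i" P
        using restriction_along[OF w[OF i]] by simp
      let ?C = "Val D (J i)" and ?F = "FA (Pull D (w i))" and ?s = "s i"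
      have Yi: "Y i \<in> Obj m.M'.Mods" using Y i by simp
      note [simp] = s[OF i]
      have "?F (b \<cdot>\<^bsub>Val D P\<^esub> NC (S P) A) = inv_arr ?C ?s \<cdot>\<^bsub>?C\<^esub> snd (Y i) \<cdot>\<^bsub>?C\<^esub>
          FA (Cpt M (J i)) ?s \<cdot>\<^bsub>?C\<^esub> NC (S (J i)) (FO (Pull D (w i)) A)"
        using A b Yi i by (simp add: g_def m.\<gamma>_unit)
      also have "\<dots> = inv_arr ?C ?s \<cdot>\<^bsub>?C\<^esub> snd (Y i) \<cdot>\<^bsub>?C\<^esub> NC (S (J i)) (fst (Y i)) \<cdot>\<^bsub>?C\<^esub> ?s"
        using m.M'.unit.natural[of ?s "FO (Pull D (w i)) A" "fst (Y i)"] by simp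
      also have "\<dots> = Ide ?C (FO (Pull D (w i)) A)"
        using m.M'.T.dom.reassoc1[OF m.M'.mod_simps(5)[OF Yi], of ?s] Yi by simp
      finally show "?F (b \<cdot>\<^bsub>Val D P\<^esub> NC (S P) A) = ?F (Ide (Val D P) A)" using A by simp
    qed (use b(1) A in auto)
    have mult: "b \<cdot>\<^bsub>Val D P\<^esub> NC (\<mu> P) A = b \<cdot>\<^bsub>Val D P\<^esub> FA (Cpt M P) b"
    proof (rule d.jointly_faithful[OF ff])
      fix i assume i: "i \<in> I"
      interpret m: restriction D M \<mu> S "w i" "J i" P
        using restriction_along[OF w[OF i]] by simp
      let ?C = "Val D (J i)" and ?F = "FA (Pull D (w i))" and ?s = "s i" and ?T = "FA (Cpt M (J i))"
      let ?i = "inv_arr ?C ?s" and ?y = "snd (Y i)"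
      let ?r = "?T (NC (Gam M (w i)) A) \<cdot>\<^bsub>?C\<^esub> NC (Gam M (w i)) (FO (Cpt M P) A)"
      have Yi [simp]: "Y i \<in> Obj m.M'.Mods" using Y i by simp
      note [simp] = s[OF i]
      have "?F (b \<cdot>\<^bsub>Val D P\<^esub> NC (\<mu> P) A) =
          ?i \<cdot>\<^bsub>?C\<^esub> ?y \<cdot>\<^bsub>?C\<^esub> ?T ?s \<cdot>\<^bsub>?C\<^esub> NC (\<mu> (J i)) (FO (Pull D (w i)) A) \<cdot>\<^bsub>?C\<^esub> ?r"
        using A b i by (simp add: g_def m.\<gamma>_mult)
      also have "\<dots> = ?i \<cdot>\<^bsub>?C\<^esub> ?y \<cdot>\<^bsub>?C\<^esub> NC (\<mu> (J i)) (fst (Y i)) \<cdot>\<^bsub>?C\<^esub> ?T (?T ?s) \<cdot>\<^bsub>?C\<^esub> ?r"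
        using m.M'.mult.natural[of ?s "FO (Pull D (w i)) A" "fst (Y i)"] A
          m.M'.T.dom.reassoc[of "?T ?s" "NC (\<mu> (J i)) (FO (Pull D (w i)) A)"
            "NC (\<mu> (J i)) (fst (Y i))" "?T (?T ?s)" ?r] by simp
      also have "\<dots> = ?i \<cdot>\<^bsub>?C\<^esub> ?y \<cdot>\<^bsub>?C\<^esub> ?T ?y \<cdot>\<^bsub>?C\<^esub> ?T (?T ?s) \<cdot>\<^bsub>?C\<^esub> ?r"
        using A m.M'.T.dom.reassoc[OF m.M'.mod_mult[OF Yi], of "?T (?T ?s) \<cdot>\<^bsub>?C\<^esub> ?r"] by simp
      also have "\<dots> = ?i \<cdot>\<^bsub>?C\<^esub> ?y \<cdot>\<^bsub>?C\<^esub> ?T ?s \<cdot>\<^bsub>?C\<^esub> ?T (g i) \<cdot>\<^bsub>?C\<^esub> NC (Gam M (w i)) (FO (Cpt M P) A)"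
        using A by (simp add: g_def m.M'.T.inv)
      also have "\<dots> = ?i \<cdot>\<^bsub>?C\<^esub> ?y \<cdot>\<^bsub>?C\<^esub> ?T ?s \<cdot>\<^bsub>?C\<^esub> NC (Gam M (w i)) A \<cdot>\<^bsub>?C\<^esub> ?F (FA (Cpt M P) b)"
        using A b m.\<gamma>_natural(1)[of b A] i by simp
      also have "\<dots> = g i \<cdot>\<^bsub>?C\<^esub> ?F (FA (Cpt M P) b)"
        using A b(1) by (simp add: g_def)
      also have "\<dots> = ?F (b \<cdot>\<^bsub>Val D P\<^esub> FA (Cpt M P) b)"
        using A b(1) b(2)[OF i] by simp
      finally show "?F (b \<cdot>\<^bsub>Val D P\<^esub> NC (\<mu> P) A) = ?F (b \<cdot>\<^bsub>Val D P\<^esub> FA (Cpt M P) b)" .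
    qed (use b(1) A in auto)
    have Ab: "(A, b) \<in> Obj P.Mods" using A b(1) unit mult by (intro P.modI) auto
    have "iso_objs (Val N (J i)) (FO (Pull N (w i)) (A, b)) (Y i)" if i: "i \<in> I" for i
    proof -
      interpret m: restriction D M \<mu> S "w i" "J i" P
        using restriction_along[OF w[OF i]] by simp
      have Yi [simp]: "Y i \<in> Obj m.M'.Mods" using Y i by simp
      note [simp] = s[OF i]
      have "(lift_along (w i) (A, b), s i, Y i) \<in> Arr m.M'.Mods"
        using A b(2)[OF i] m.lift_obj[OF Ab] by (simp add: m.M'.linear_iff g_def)
      then show ?thesis
        using m.M'.is_iso_Mods m.M'.Mods.iso_objsI[of "(lift_along (w i) (A, b), s i, Y i)"] Ab w[OF i] by simp
    qed
    then show "\<exists>X\<in>Obj P.Mods. \<forall>i\<in>I. iso_objs (Val N (J i)) (FO (Pull N (w i)) X) (Y i)"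
      using Ab by blast
  qed
  ultimately show "is_equivalence (tuple_functor (Val N P) I (\<lambda>i. Pull N (\<phi> \<circ>\<^sub>F coprod_incl I J i)))"
    using n.is_equivalence_tuple_iff by (simp add: w_def)
qed

lemma der2_N: "der2 Dia N"
  unfolding der2_def
proof (intro ballI)
  fix J t assume J: "J \<in> Dia" and t: "t \<in> Arr (Val N J)"
  interpret J: em_monad "Val D J" "Cpt M J" "\<mu> J" "S J" using J by (rule monad_at)
  obtain A f B where tf: "t = (A, f, B)" by (rule prod_cases3)
  with t have f: "(A, f, B) \<in> Arr J.Mods" by simp
  have "is_iso (Val N one_cat) (FA (Pull N (point J j)) t) \<longleftrightarrow>
      is_iso (Val D one_cat) (FA (Pull D (point J j)) f)" if j: "j \<in> Obj J" for j
  proof -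
    have p: "dia_functor Dia (point J j)" using J j by simp
    interpret m: restriction D M \<mu> S "point J j" one_cat J
      using restriction_along[OF p] by simp
    show ?thesis using tf f p m.M'.is_iso_Mods[OF m.lift_arr[OF f]] by simp
  qed
  moreover have "is_iso (Val N J) t \<longleftrightarrow> is_iso (Val D J) f"
    using tf J.is_iso_Mods[OF f] by simp
  moreover have "is_iso (Val D J) f \<longleftrightarrow>
      (\<forall>j\<in>Obj J. is_iso (Val D one_cat) (FA (Pull D (point J j)) f))"
    using der(2) J f unfolding der2_def by (simp add: J.linear_iff)
  ultimately show "is_iso (Val N J) t \<longleftrightarrow>
      (\<forall>j\<in>Obj J. is_iso (Val N one_cat) (FA (Pull N (point J j)) t))"
    by simp
qed

lemma der3L_N: "der3L Dia N"
  unfolding dia_prederivator.der3L_iff[OF dia_prederivator_N]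
proof (intro allI impI ballI)
  fix u X assume u: "dia_functor Dia u" and X: "X \<in> Obj (Val N (Src u))"
  interpret u: restriction D M \<mu> S u "Src u" "Tgt u"
    by (rule restriction_along[OF u])
  have X': "X \<in> Obj u.M'.Mods" using X by simp
  obtain A e where e: "univ_to (Pull D u) (fst X) A e" using ex_univ_to[OF u] X' by (meson u.M'.mod_simps(1))
  obtain a where "(A, a) \<in> Obj u.M.Mods" "(lift_along u (A, a), e, X) \<in> Arr u.M'.Mods"
    by (rule u.univ_to_lift_exists[OF X' e])
  then have "univ_to (Pull N u) X (A, a) (lift_along u (A, a), e, X)"
    using u.univ_to_lift[of "(A, a)" e X] e by (simp add: Pull_N u)
  then show "\<exists>A t. univ_to (Pull N u) X A t" by blast
qed

lemma der3R_N: "der3R Dia N"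
  unfolding dia_prederivator.der3R_iff[OF dia_prederivator_N]
proof (intro allI impI ballI)
  fix u X assume u: "dia_functor Dia u" and X: "X \<in> Obj (Val N (Src u))"
  interpret u: cocontinuous_restriction D M \<mu> S u "Src u" "Tgt u"
    by (rule cocontinuous_restriction_along[OF u])
  have X': "X \<in> Obj u.M'.Mods" using X by simp
  obtain A h where h: "univ_from (Pull D u) (fst X) A h"
    using ex_univ_from[OF u] X' by (meson u.M'.mod_simps(1))
  obtain a where "(A, a) \<in> Obj u.M.Mods" "(X, h, lift_along u (A, a)) \<in> Arr u.M'.Mods"
    by (rule u.univ_from_lift_exists[OF X' h])
  then have "univ_from (Pull N u) X (A, a) (X, h, lift_along u (A, a))"
    using u.univ_from_lift[of X h "(A, a)"] h by (simp add: Pull_N u)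
  then show "\<exists>A t. univ_from (Pull N u) X A t" by blast
qed

lemma der4L_N: "der4L Dia N"
  using der(5) coslice_square base_change_to_N ex_univ_to
  unfolding der4L_iff[OF der(3)] dia_prederivator.der4L_iff[OF dia_prederivator_N der3L_N] by meson

lemma der4R_N: "der4R Dia N"
  using der(6) slice_square base_change_from_N
  unfolding der4R_iff[OF der(4)] dia_prederivator.der4R_iff[OF dia_prederivator_N der3R_N] by meson

theorem derivator_N: "derivator Dia N"
  using prederivator_N der1_N der2_N der3L_N der3R_N der4L_N der4R_N by (simp add: derivator_def)

end

section \<open>Zero objects\<close>

definition initial :: "('o, 'a) cat \<Rightarrow> 'o \<Rightarrow> bool" where
  "initial C z \<longleftrightarrow> z \<in> Obj C \<and> (\<forall>x \<in> Obj C. \<exists>!f. f \<in> hom C z x)"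

definition terminal :: "('o, 'a) cat \<Rightarrow> 'o \<Rightarrow> bool" where
  "terminal C z \<longleftrightarrow> z \<in> Obj C \<and> (\<forall>x \<in> Obj C. \<exists>!f. f \<in> hom C x z)"

lemma zero_object_iff: "zero_object C z \<longleftrightarrow> initial C z \<and> terminal C z"
  unfolding zero_object_def initial_def terminal_def by blast

lemma initialI:
  assumes "z \<in> Obj C" "\<And>x. x \<in> Obj C \<Longrightarrow> m x \<in> hom C z x"
    "\<And>x f. x \<in> Obj C \<Longrightarrow> f \<in> hom C z x \<Longrightarrow> f = m x"
  shows "initial C z"
  using assms unfolding initial_def by metis

lemma terminalI:
  assumes "z \<in> Obj C" "\<And>x. x \<in> Obj C \<Longrightarrow> m x \<in> hom C x z"
    "\<And>x f. x \<in> Obj C \<Longrightarrow> f \<in> hom C x z \<Longrightarrow> f = m x"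
  shows "terminal C z"
  using assms unfolding terminal_def by metis

context category
begin

lemma initial_eq: "\<lbrakk>initial C z; f \<in> hom C z x; g \<in> hom C z x\<rbrakk> \<Longrightarrow> f = g"
  using obj_simps(2)[of f] unfolding initial_def by auto

lemma terminal_eq: "\<lbrakk>terminal C z; f \<in> hom C x z; g \<in> hom C x z\<rbrakk> \<Longrightarrow> f = g"
  using obj_simps(1)[of f] unfolding terminal_def by auto

end

definition empty_cat :: "'u small_cat" where
  "empty_cat = \<lparr>Obj = {}, Arr = {}, Dom = undefined, Cod = undefined, Ide = undefined, Comp = undefined\<rparr>"

definition empty_functor :: "'u small_cat \<Rightarrow> 'u small_functor" where
  "empty_functor K = \<lparr>Src = empty_cat, Tgt = K, FO = (\<lambda>_. undefined), FA = (\<lambda>_. undefined)\<rparr>"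

lemma empty_cat_simps [simp]: "Obj empty_cat = {}" "Arr empty_cat = {}"
  by (simp_all add: empty_cat_def)

lemma funct_empty: "category K \<Longrightarrow> funct empty_cat K (empty_functor K)"
proof (rule funct_intro)
  show "category empty_cat" by unfold_locales auto
qed (auto simp: empty_functor_def)

context cocontinuous_derivator_monad
begin

lemma empty_in_Dia: "empty_cat \<in> Dia"
  by (rule finite_posets) (auto simp: finite_poset_def intro!: category.intro)

text \<open>
  The axiom on coproducts for the empty family: there is exactly one arrow between any two objects over
  the empty category.
\<close>

lemma empty_val:
  assumes "X \<in> Obj (Val D empty_cat)" "Y \<in> Obj (Val D empty_cat)"
  shows "\<exists>!f. f \<in> hom (Val D empty_cat) X Y"
proof -
  let ?J = "\<lambda>i :: nat. empty_cat :: 'u small_cat"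
  let ?\<phi> = "\<lparr>Src = coprod_cat {} ?J, Tgt = empty_cat :: 'u small_cat, FO = (\<lambda>_. undefined), FA = (\<lambda>_. undefined)\<rparr>"
  have "cat_iso_between ?\<phi> (coprod_cat {} ?J) empty_cat"
    by (auto simp: cat_iso_between_def is_cat_iso_def is_functor_def bij_betw_def coprod_cat_def
        intro!: category.intro)
  then have e: "is_equivalence (tuple_functor (Val D empty_cat) {} (\<lambda>i. Pull D (?\<phi> \<circ>\<^sub>F coprod_incl {} ?J i)))"
    using der(1) empty_in_Dia unfolding der1_def by blast
  interpret functor_family "Val D empty_cat" "{}" "\<lambda>i :: nat. undefined"
      "\<lambda>i. Pull D (?\<phi> \<circ>\<^sub>F coprod_incl {} ?J i)"
    by (intro functor_family.intro functor_family_axioms.intro) (simp_all add: val_category empty_in_Dia)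
  show ?thesis
    using e assms unfolding is_equivalence_tuple_iff jointly_fully_faithful_def by simp
qed

text \<open>
  Initial objects are the left Kan extensions along the functor from the empty category.
\<close>

lemma initial_iff_univ_from_empty:
  assumes J: "J \<in> Dia" and A: "A \<in> Obj (Val D J)"
    and h: "h \<in> hom (Val D empty_cat) X (FO (Pull D (empty_functor J)) A)"
  shows "univ_from (Pull D (empty_functor J)) X A h \<longleftrightarrow> initial (Val D J) A"
proof -
  let ?i = "empty_functor J"
  have i: "dia_functor Dia ?i" "Src ?i = empty_cat" "Tgt ?i = J"
    using funct.is_functor[OF funct_empty[OF is_category[OF J]]] J empty_in_Dia
    by (auto simp: dia_functor_def empty_functor_def)
  interpret i: funct "Val D J" "Val D empty_cat" "Pull D ?i" using pull[OF i(1)] i by simp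
  have X: "X \<in> Obj (Val D empty_cat)" using h by auto
  have eq: "f = g" if "f \<in> hom (Val D empty_cat) X Y" "g \<in> hom (Val D empty_cat) X Y" for f g Y
    using empty_val[OF X, of Y] that by auto
  have "\<exists>g. g \<in> hom (Val D empty_cat) X (FO (Pull D ?i) B)" if "B \<in> Obj (Val D J)" for B
    using empty_val[OF X i.obj[OF that]] by blast
  moreover have "FA (Pull D ?i) f \<cdot>\<^bsub>Val D empty_cat\<^esub> h = g"
    if "f \<in> hom (Val D J) A B" "g \<in> hom (Val D empty_cat) X (FO (Pull D ?i) B)" for f g B
    by (rule eq) (use that h in auto)
  ultimately have "(\<forall>g \<in> hom (Val D empty_cat) X (FO (Pull D ?i) B).
      \<exists>!f. f \<in> hom (Val D J) A B \<and> FA (Pull D ?i) f \<cdot>\<^bsub>Val D empty_cat\<^esub> h = g) \<longleftrightarrow>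
      (\<exists>!f. f \<in> hom (Val D J) A B)" if "B \<in> Obj (Val D J)" for B
    using that by (metis (no_types, lifting))
  then show ?thesis
    unfolding univ_from_def initial_def i.src_tgt using A h by (simp del: in_hom)
qed

lemma monad_preserves_initial:
  assumes J: "J \<in> Dia" and Z: "initial (Val D J) Z"
  shows "initial (Val D J) (FO (Cpt M J) Z)"
proof -
  let ?i = "empty_functor J"
  have i: "dia_functor Dia ?i" "Src ?i = empty_cat" "Tgt ?i = J"
    using funct.is_functor[OF funct_empty[OF is_category[OF J]]] J empty_in_Dia
    by (auto simp: dia_functor_def empty_functor_def)
  interpret i: cocontinuous_restriction D M \<mu> S ?i empty_cat J
    using cocontinuous_restriction_along[OF i(1)] i by simp
  have Z': "Z \<in> Obj (Val D J)" using Z by (simp add: initial_def)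
  have "univ_from (Pull D ?i) (FO (Pull D ?i) Z) Z (Ide (Val D empty_cat) (FO (Pull D ?i) Z))"
    using Z Z' by (subst initial_iff_univ_from_empty[OF J]) auto
  from i.preserves[OF this]
  have "univ_from (Pull D ?i) (FO (Cpt M empty_cat) (FO (Pull D ?i) Z)) (FO (Cpt M J) Z) (i.\<delta> Z)"
    using Z' by simp
  then show ?thesis
    by (subst (asm) initial_iff_univ_from_empty[OF J]) (use Z' in auto)
qed

text \<open>
  All diagrams into a terminal object commute, so a zero object \<open>Z\<close> has an action and every map into it
  is linear. A map out of \<open>Z\<close> is linear since \<open>M Z\<close> is initial.
\<close>

lemma pointed_N:
  assumes "pointed Dia D"
  shows "pointed Dia N"
  unfolding pointed_def
proof
  fix J assume J: "J \<in> Dia"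
  interpret J: em_monad "Val D J" "Cpt M J" "\<mu> J" "S J" using J by (rule monad_at)
  obtain Z where init: "initial (Val D J) Z" and final: "terminal (Val D J) Z"
    using assms J unfolding pointed_def zero_object_iff by blast
  note out = J.T.dom.initial_eq[OF monad_preserves_initial[OF J init]]
    and into = J.T.dom.terminal_eq[OF final]
  have Z: "Z \<in> Obj (Val D J)" using init by (simp add: initial_def)
  obtain m n where m: "\<And>X. X \<in> Obj (Val D J) \<Longrightarrow> m X \<in> hom (Val D J) Z X"
    and n: "\<And>X. X \<in> Obj (Val D J) \<Longrightarrow> n X \<in> hom (Val D J) X Z"
    using init final unfolding initial_def terminal_def by metis
  let ?z = "n (FO (Cpt M J) Z)"
  have z: "?z \<in> hom (Val D J) (FO (Cpt M J) Z) Z" using n Z by simp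
  have Zz: "(Z, ?z) \<in> Obj J.Mods"
  proof (rule J.modI)
    show "?z \<cdot>\<^bsub>Val D J\<^esub> NC (S J) Z = Ide (Val D J) Z" by (rule into[of _ Z]) (use Z z in auto)
    show "?z \<cdot>\<^bsub>Val D J\<^esub> NC (\<mu> J) Z = ?z \<cdot>\<^bsub>Val D J\<^esub> FA (Cpt M J) ?z"
      by (rule into[of _ "FO (Cpt M J) (FO (Cpt M J) Z)"]) (use Z z in auto)
  qed (use Z z in auto)
  have "initial J.Mods (Z, ?z)"
  proof (rule initialI[where m = "\<lambda>B. ((Z, ?z), m (fst B), B)", OF Zz])
    fix B assume B: "B \<in> Obj J.Mods"
    have "m (fst B) \<cdot>\<^bsub>Val D J\<^esub> ?z = snd B \<cdot>\<^bsub>Val D J\<^esub> FA (Cpt M J) (m (fst B))"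
      by (rule out[of _ "fst B"]) (use m[of "fst B"] z B in auto)
    then show "((Z, ?z), m (fst B), B) \<in> hom J.Mods (Z, ?z) B"
      using Zz B m[of "fst B"] by (simp add: J.linear_iff)
    fix s assume "s \<in> hom J.Mods (Z, ?z) B"
    then obtain f where "s = ((Z, ?z), f, B)" "((Z, ?z), f, B) \<in> Arr J.Mods"
      using J.arrE[of s "(Z, ?z)" B] unfolding in_hom by metis
    then show "s = ((Z, ?z), m (fst B), B)"
      using J.T.dom.initial_eq[OF init, of f "fst B" "m (fst B)"] m[of "fst B"] by (simp add: J.linear_iff)
  qed
  moreover have "terminal J.Mods (Z, ?z)"
  proof (rule terminalI[where m = "\<lambda>B. (B, n (fst B), (Z, ?z))", OF Zz])
    fix B assume B: "B \<in> Obj J.Mods"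
    have "n (fst B) \<cdot>\<^bsub>Val D J\<^esub> snd B = ?z \<cdot>\<^bsub>Val D J\<^esub> FA (Cpt M J) (n (fst B))"
      by (rule into[of _ "FO (Cpt M J) (fst B)"]) (use n[of "fst B"] z B in auto)
    then show "(B, n (fst B), (Z, ?z)) \<in> hom J.Mods B (Z, ?z)"
      using Zz B n[of "fst B"] by (simp add: J.linear_iff)
    fix s assume "s \<in> hom J.Mods B (Z, ?z)"
    then obtain f where "s = (B, f, (Z, ?z))" "(B, f, (Z, ?z)) \<in> Arr J.Mods"
      using J.arrE[of s B "(Z, ?z)"] unfolding in_hom by metis
    then show "s = (B, n (fst B), (Z, ?z))"
      using into[of f "fst B" "n (fst B)"] n[of "fst B"] by (simp add: J.linear_iff)
  qed
  ultimately show "\<exists>Z. zero_object (Val N J) Z" by (auto simp: zero_object_iff)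
qed

end

section \<open>Kan extensions along sieves and cosieves\<close>

lemma full_subcat_simps [simp]:
  "Obj (full_subcat Q T) = Obj Q \<inter> T" "Arr (full_subcat Q T) = {f \<in> Arr Q. Dom Q f \<in> T \<and> Cod Q f \<in> T}"
  "Dom (full_subcat Q T) = Dom Q" "Cod (full_subcat Q T) = Cod Q" "Ide (full_subcat Q T) = Ide Q"
  "Comp (full_subcat Q T) = Comp Q"
  by (simp_all add: full_subcat_def)

lemma full_incl_simps [simp]:
  "Src (full_incl Q T) = full_subcat Q T" "Tgt (full_incl Q T) = Q"
  "x \<in> Obj Q \<Longrightarrow> x \<in> T \<Longrightarrow> FO (full_incl Q T) x = x"
  "\<lbrakk>f \<in> Arr Q; Dom Q f \<in> T; Cod Q f \<in> T\<rbrakk> \<Longrightarrow> FA (full_incl Q T) f = f"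
  by (simp_all add: full_incl_def)

lemma funct_full_incl:
  assumes "category Q"
  shows "funct (full_subcat Q T) Q (full_incl Q T)"
proof -
  interpret category Q by fact
  have "category (full_subcat Q T)" by unfold_locales auto
  then show ?thesis
    by (intro funct_intro category_axioms) (auto simp: full_incl_def)
qed

text \<open>
  An object with an arrow into a sieve lies in the sieve. Hence the slices of the inclusion over
  objects of the sieve are literally slices of the ambient category, of which a diagram category
  contains copies.
\<close>

lemma slice_of_sieve:
  fixes Q :: "('o, 'a) cat"
  assumes "category Q" and k: "k \<in> Obj Q" "k \<in> T"
    and sieve: "\<And>f. f \<in> Arr Q \<Longrightarrow> Cod Q f \<in> T \<Longrightarrow> Dom Q f \<in> T"
  shows "slice_cat (full_incl Q T) k = slice_cat (id_functor Q) k"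
proof -
  interpret category Q by fact
  have "Obj (slice_cat (full_incl Q T) k) = Obj (slice_cat (id_functor Q) k)"
    using k sieve by (auto simp: slice_cat_def)
  moreover have "Arr (slice_cat (full_incl Q T) k) = Arr (slice_cat (id_functor Q) k)"
  proof (rule set_eqI)
    fix t :: "('o \<times> 'a) \<times> 'a \<times> ('o \<times> 'a)"
    obtain j a f j' a' where t: "t = ((j, a), f, (j', a'))" by (metis prod.exhaust)
    show "t \<in> Arr (slice_cat (full_incl Q T) k) \<longleftrightarrow> t \<in> Arr (slice_cat (id_functor Q) k)"
    proof (cases "j \<in> T \<and> j' \<in> T")
      case True
      then show ?thesis by (simp add: t slice_cat_def cong: conj_cong) (intro iffI; elim conjE; simp)
    next
      case False
      then have "\<not> (a \<in> Arr Q \<and> Dom Q a = j \<and> Cod Q a = k \<and> a' \<in> Arr Q \<and> Dom Q a' = j' \<and> Cod Q a' = k)"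
        using k(2) sieve by metis
      then show ?thesis using False
        by (simp add: t slice_cat_def cong: conj_cong)
    qed
  qed
  ultimately show ?thesis by (simp add: slice_cat_def)
qed

lemma coslice_of_cosieve:
  fixes Q :: "('o, 'a) cat"
  assumes "category Q" and k: "k \<in> Obj Q" "k \<in> T"
    and cosieve: "\<And>f. f \<in> Arr Q \<Longrightarrow> Dom Q f \<in> T \<Longrightarrow> Cod Q f \<in> T"
  shows "coslice_cat (full_incl Q T) k = coslice_cat (id_functor Q) k"
proof -
  interpret category Q by fact
  have "Obj (coslice_cat (full_incl Q T) k) = Obj (coslice_cat (id_functor Q) k)"
    using k cosieve by (auto simp: coslice_cat_def)
  moreover have "Arr (coslice_cat (full_incl Q T) k) = Arr (coslice_cat (id_functor Q) k)"
  proof (rule set_eqI)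
    fix t :: "('o \<times> 'a) \<times> 'a \<times> ('o \<times> 'a)"
    obtain j a f j' a' where t: "t = ((j, a), f, (j', a'))" by (metis prod.exhaust)
    show "t \<in> Arr (coslice_cat (full_incl Q T) k) \<longleftrightarrow> t \<in> Arr (coslice_cat (id_functor Q) k)"
    proof (cases "j \<in> T \<and> j' \<in> T")
      case True
      then show ?thesis by (simp add: t coslice_cat_def cong: conj_cong) (intro iffI; elim conjE; simp)
    next
      case False
      then have "\<not> (a \<in> Arr Q \<and> Cod Q a = j \<and> Dom Q a = k \<and> a' \<in> Arr Q \<and> Cod Q a' = j' \<and> Dom Q a' = k)"
        using k(2) cosieve by metis
      then show ?thesis using False
        by (simp add: t coslice_cat_def cong: conj_cong) (intro impI notI; simp)
    qed
  qed
  ultimately show ?thesis by (simp add: coslice_cat_def)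
qed

lemma bij_betw_ex1: "bij_betw f A B \<Longrightarrow> (\<exists>!x. x \<in> A) \<longleftrightarrow> (\<exists>!y. y \<in> B)"
  unfolding bij_betw_def inj_on_def by (safe; (metis imageI | (elim imageE, metis imageI)))

lemma cat_iso_hom:
  assumes "cat_iso_between \<phi> P C" "x \<in> Obj P" "y \<in> Obj P"
  shows "bij_betw (FA \<phi>) (hom P x y) (hom C (FO \<phi> x) (FO \<phi> y))"
proof -
  interpret \<phi>: funct P C \<phi> using assms(1) by (rule cat_iso_funct)
  have inj: "inj_on (FO \<phi>) (Obj P)" "inj_on (FA \<phi>) (Arr P)" and onto: "FA \<phi> ` Arr P = Arr C"
    using assms(1) by (auto simp: cat_iso_between_def is_cat_iso_def bij_betw_def)
  have "g \<in> FA \<phi> ` hom P x y" if g: "g \<in> hom C (FO \<phi> x) (FO \<phi> y)" for g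
  proof -
    obtain f where f: "f \<in> Arr P" "g = FA \<phi> f" using g onto by auto
    then have "Dom P f = x" "Cod P f = y"
      using g inj_onD[OF inj(1)] assms(2,3) by auto
    then show ?thesis using f by auto
  qed
  moreover have "inj_on (FA \<phi>) (hom P x y)"
    by (rule inj_on_subset[OF inj(2)]) auto
  ultimately show ?thesis by (auto simp: bij_betw_def)
qed

lemma cat_iso_lift_obj:
  assumes \<phi>: "cat_iso_between \<phi> P C" and c: "c \<in> Obj C"
  obtains t where "t \<in> Obj P" "FO \<phi> t = c"
proof -
  have "FO \<phi> ` Obj P = Obj C"
    using \<phi> by (auto simp: cat_iso_between_def is_cat_iso_def bij_betw_def)
  then have "c \<in> FO \<phi> ` Obj P" using c by simp
  then show ?thesis using that by (elim imageE) simp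
qed

lemma terminal_cat_iso:
  assumes \<phi>: "cat_iso_between \<phi> P C" and t: "t \<in> Obj P" and c: "terminal C (FO \<phi> t)"
  shows "terminal P t"
proof -
  interpret \<phi>: funct P C \<phi> using \<phi> by (rule cat_iso_funct)
  have "\<exists>!f. f \<in> hom P p t" if p: "p \<in> Obj P" for p
    using bij_betw_ex1[OF cat_iso_hom[OF \<phi> p t]] c \<phi>.obj[OF p] unfolding terminal_def by metis
  then show ?thesis using t by (simp add: terminal_def del: in_hom)
qed

lemma initial_cat_iso:
  assumes \<phi>: "cat_iso_between \<phi> P C" and t: "t \<in> Obj P" and c: "initial C (FO \<phi> t)"
  shows "initial P t"
proof -
  interpret \<phi>: funct P C \<phi> using \<phi> by (rule cat_iso_funct)
  have "\<exists>!f. f \<in> hom P t p" if p: "p \<in> Obj P" for p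
    using bij_betw_ex1[OF cat_iso_hom[OF \<phi> t p]] c \<phi>.obj[OF p] unfolding initial_def by metis
  then show ?thesis using t by (simp add: initial_def del: in_hom)
qed

context category
begin

lemma slice_terminal:
  assumes k: "k \<in> Obj C"
  shows "terminal (slice_cat (id_functor C) k) (k, Ide C k)"
proof (rule terminalI[where m = "\<lambda>p. (p, snd p, (k, Ide C k))"])
  fix p assume p: "p \<in> Obj (slice_cat (id_functor C) k)"
  obtain j a where ja: "p = (j, a)" by fastforce
  have a: "a \<in> Arr C" "Dom C a = j" "Cod C a = k" using p ja by (auto simp: slice_cat_def)
  then show "(p, snd p, (k, Ide C k)) \<in> hom (slice_cat (id_functor C) k) p (k, Ide C k)"
    using k ja by (auto simp: slice_cat_def)
  fix t assume t: "t \<in> hom (slice_cat (id_functor C) k) p (k, Ide C k)"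
  obtain b where "t = (p, b, (k, Ide C k))" using t by (cases t) (simp add: slice_cat_def)
  then show "t = (p, snd p, (k, Ide C k))"
    using t k unfolding ja slice_cat_def by (simp, elim conjE, simp)
qed (use k in \<open>simp add: slice_cat_def\<close>)

lemma coslice_initial:
  assumes k: "k \<in> Obj C"
  shows "initial (coslice_cat (id_functor C) k) (k, Ide C k)"
proof (rule initialI[where m = "\<lambda>p. ((k, Ide C k), snd p, p)"])
  fix p assume p: "p \<in> Obj (coslice_cat (id_functor C) k)"
  obtain j a where ja: "p = (j, a)" by fastforce
  have a: "a \<in> Arr C" "Dom C a = k" "Cod C a = j" using p ja by (auto simp: coslice_cat_def)
  then show "((k, Ide C k), snd p, p) \<in> hom (coslice_cat (id_functor C) k) (k, Ide C k) p"
    using k ja by (auto simp: coslice_cat_def)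
  fix t assume t: "t \<in> hom (coslice_cat (id_functor C) k) (k, Ide C k) p"
  obtain b where "t = ((k, Ide C k), b, p)" using t by (cases t) (simp add: coslice_cat_def)
  then show "t = ((k, Ide C k), snd p, p)"
    using t k unfolding ja coslice_cat_def by (simp, elim conjE, simp)
qed (use k in \<open>simp add: coslice_cat_def\<close>)

end

lemma comp_point:
  assumes "funct J K F" "j \<in> Obj J"
  shows "F \<circ>\<^sub>F point J j = point K (FO F j)"
proof -
  interpret funct J K F by fact
  have "funct one_cat J (point J j)" "funct one_cat K (point K (FO F j))"
    using assms(2) by (auto intro!: funct_point dom.category_axioms cod.category_axioms)
  then show ?thesis
    using assms(2) by (intro fnct_eqI[of one_cat K] funct_comp[OF _ funct_axioms]) auto
qed

lemma point_one: "point one_cat undefined = id_functor one_cat"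
  by (simp add: point_def id_functor_def restrict_def fun_eq_iff)

text \<open>
  A terminal object is a right adjoint of the functor to the terminal category.
\<close>

lemma terminal_adjunction:
  assumes "category P" and t: "terminal P t"
  obtains \<tau> where "adjunction (to_one P) (point P t) \<tau> (id_nattrans (id_functor one_cat))"
proof -
  interpret P: category P by fact
  have tP [simp]: "t \<in> Obj P" using t by (simp add: terminal_def)
  interpret p: funct P one_cat "to_one P" by (rule funct_to_one[OF P.category_axioms])
  interpret t: funct one_cat P "point P t" by (rule funct_point[OF P.category_axioms tP])
  have pt [simp]: "to_one P \<circ>\<^sub>F point P t = id_functor one_cat"
    using comp_point[OF p.funct_axioms tP] by (simp add: point_one)
  obtain m where m: "\<And>p. p \<in> Obj P \<Longrightarrow> m p \<in> hom P p t"
    using t unfolding terminal_def by metis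
  define \<tau> where "\<tau> = \<lparr>NSrc = id_functor P, NTgt = point P t \<circ>\<^sub>F to_one P, NC = (\<lambda>p \<in> Obj P. m p)\<rparr>"
  interpret \<tau>: nattr P P "id_functor P" "point P t \<circ>\<^sub>F to_one P" \<tau>
  proof (rule nattr_intro[OF funct_id[OF P.category_axioms] funct_comp[OF p.funct_axioms t.funct_axioms]])
    show "NC \<tau> (Cod P f) \<cdot>\<^bsub>P\<^esub> FA (id_functor P) f = FA (point P t \<circ>\<^sub>F to_one P) f \<cdot>\<^bsub>P\<^esub> NC \<tau> (Dom P f)"
      if "f \<in> Arr P" for f
      by (rule P.terminal_eq[OF t]) (use that m[of "Dom P f"] m[of "Cod P f"] in \<open>auto simp: \<tau>_def\<close>)
  qed (use m in \<open>auto simp: \<tau>_def\<close>)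
  interpret \<iota>: nattr one_cat one_cat "to_one P \<circ>\<^sub>F point P t" "id_functor one_cat" "id_nattrans (id_functor one_cat)"
    using nattr_id[OF funct_id[OF category_one]] by simp
  have "NC \<tau> t = Ide P t"
    by (rule P.terminal_eq[OF t]) (use m[OF tP] in \<open>auto simp: \<tau>_def\<close>)
  then have "adj P one_cat (to_one P) (point P t) \<tau> (id_nattrans (id_functor one_cat))"
    by unfold_locales simp_all
  then show ?thesis using that adj.adjunction by blast
qed

lemma initial_adjunction:
  assumes "category P" and t: "initial P t"
  obtains \<tau> where "adjunction (point P t) (to_one P) (id_nattrans (id_functor one_cat)) \<tau>"
proof -
  interpret P: category P by fact
  have tP [simp]: "t \<in> Obj P" using t by (simp add: initial_def)
  interpret p: funct P one_cat "to_one P" by (rule funct_to_one[OF P.category_axioms])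
  interpret t: funct one_cat P "point P t" by (rule funct_point[OF P.category_axioms tP])
  have pt [simp]: "to_one P \<circ>\<^sub>F point P t = id_functor one_cat"
    using comp_point[OF p.funct_axioms tP] by (simp add: point_one)
  obtain m where m: "\<And>p. p \<in> Obj P \<Longrightarrow> m p \<in> hom P t p"
    using t unfolding initial_def by metis
  define \<tau> where "\<tau> = \<lparr>NSrc = point P t \<circ>\<^sub>F to_one P, NTgt = id_functor P, NC = (\<lambda>p \<in> Obj P. m p)\<rparr>"
  interpret \<tau>: nattr P P "point P t \<circ>\<^sub>F to_one P" "id_functor P" \<tau>
  proof (rule nattr_intro[OF funct_comp[OF p.funct_axioms t.funct_axioms] funct_id[OF P.category_axioms]])
    show "NC \<tau> (Cod P f) \<cdot>\<^bsub>P\<^esub> FA (point P t \<circ>\<^sub>F to_one P) f = FA (id_functor P) f \<cdot>\<^bsub>P\<^esub> NC \<tau> (Dom P f)"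
      if "f \<in> Arr P" for f
      by (rule P.initial_eq[OF t]) (use that m[of "Dom P f"] m[of "Cod P f"] in \<open>auto simp: \<tau>_def\<close>)
  qed (use m in \<open>auto simp: \<tau>_def\<close>)
  interpret \<iota>: nattr one_cat one_cat "id_functor one_cat" "to_one P \<circ>\<^sub>F point P t" "id_nattrans (id_functor one_cat)"
    using nattr_id[OF funct_id[OF category_one]] by simp
  have "NC \<tau> t = Ide P t"
    by (rule P.initial_eq[OF t]) (use m[OF tP] in \<open>auto simp: \<tau>_def\<close>)
  then have "adj one_cat P (point P t) (to_one P) (id_nattrans (id_functor one_cat)) \<tau>"
    by unfold_locales simp_all
  then show ?thesis using that adj.adjunction by blast
qed

context dia_prederivator
begin

text \<open>
  A prederivator is a 2-functor that reverses 1-cells, so it maps an adjunction to an adjunction with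
  the two functors exchanged.
\<close>

lemma pull_adjunction:
  assumes a: "adjunction l r \<eta> \<epsilon>" and l: "dia_functor Dia l"
  shows "adjunction (Pull D r) (Pull D l) (Pull2 D \<eta>) (Pull2 D \<epsilon>)"
proof -
  let ?P = "Src l" and ?E = "Tgt l"
  have r: "dia_functor Dia r" and ends [simp]: "Src r = ?E" "Tgt r = ?P"
    and n: "nattrans_between \<eta> (id_functor ?P) (r \<circ>\<^sub>F l)" "nattrans_between \<epsilon> (l \<circ>\<^sub>F r) (id_functor ?E)"
    and tri: "(\<epsilon> \<rhd> l) \<circ>\<^sub>N (l \<lhd> \<eta>) = id_nattrans l" "(r \<lhd> \<epsilon>) \<circ>\<^sub>N (\<eta> \<rhd> r) = id_nattrans r"
    using a l by (auto simp: adjunction_def intro!: dia_functorI)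
  have n' [simp]: "NSrc \<eta> = id_functor ?P" "NTgt \<eta> = r \<circ>\<^sub>F l" "NSrc \<epsilon> = l \<circ>\<^sub>F r" "NTgt \<epsilon> = id_functor ?E"
      "is_nattrans \<eta>" "is_nattrans \<epsilon>"
    using n by (auto simp: nattrans_between_def)
  have d: "dia_nattrans Dia \<eta>" "dia_nattrans Dia \<epsilon>"
    using l r by (auto intro!: dia_nattransI)
  have w: "dia_nattrans Dia (\<epsilon> \<rhd> l)" "dia_nattrans Dia (l \<lhd> \<eta>)" "dia_nattrans Dia (r \<lhd> \<epsilon>)"
      "dia_nattrans Dia (\<eta> \<rhd> r)"
    using l r by (auto intro!: dia_nattransI)
  have "(Pull2 D \<epsilon> \<rhd> Pull D r) \<circ>\<^sub>N (Pull D r \<lhd> Pull2 D \<eta>) = Pull2 D ((r \<lhd> \<epsilon>) \<circ>\<^sub>N (\<eta> \<rhd> r))"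
    using l r d w by (simp add: pull2_vcomp pull2_whisker_left pull2_whisker_right)
  moreover have "(Pull D l \<lhd> Pull2 D \<epsilon>) \<circ>\<^sub>N (Pull2 D \<eta> \<rhd> Pull D l) = Pull2 D ((\<epsilon> \<rhd> l) \<circ>\<^sub>N (l \<lhd> \<eta>))"
    using l r d w by (simp add: pull2_vcomp pull2_whisker_left pull2_whisker_right)
  moreover have "nattrans_between (Pull2 D \<eta>) (id_functor (Val D ?P)) (Pull D l \<circ>\<^sub>F Pull D r)"
      "nattrans_between (Pull2 D \<epsilon>) (Pull D r \<circ>\<^sub>F Pull D l) (id_functor (Val D ?E))"
    using pull2_nattrans[OF d(1)] pull2_nattrans[OF d(2)] l r by (simp_all add: pull_id pull_comp)
  ultimately show ?thesis
    using funct.is_functor[OF pull[OF l]] funct.is_functor[OF pull[OF r]]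
      funct.src_tgt[OF pull[OF l]] funct.src_tgt[OF pull[OF r]]
    by (simp add: adjunction_def tri pull2_id l r)
qed

lemma Pull2_id_one:
  "B \<in> Obj (Val D one_cat) \<Longrightarrow> NC (Pull2 D (id_nattrans (id_functor one_cat))) B = Ide (Val D one_cat) B"
  by (simp add: pull2_id pull_id)

text \<open>
  By \<open>terminal_adjunction\<close> and \<open>pull_adjunction\<close>, \<open>t\<^sup>*\<close> is left adjoint to pullback along
  \<open>P \<rightarrow> e\<close>, with an identity as counit. Hence \<open>t\<^sup>* w\<close> is the transpose of \<open>w\<close>, which is invertible since \<open>w\<close> is universal.
\<close>

lemma iso_at_terminal:
  assumes P: "P \<in> Dia" and t: "terminal P t" and w: "univ_from (Pull D (to_one P)) W B w"
  shows "is_iso (Val D one_cat) (FA (Pull D (point P t)) w)"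
proof -
  have tP: "t \<in> Obj P" using t by (simp add: terminal_def)
  obtain \<tau> where \<tau>: "adjunction (to_one P) (point P t) \<tau> (id_nattrans (id_functor one_cat))"
    using terminal_adjunction[OF is_category[OF P] t] .
  interpret adj "Val D P" "Val D one_cat" "Pull D (point P t)" "Pull D (to_one P)" "Pull2 D \<tau>"
      "Pull2 D (id_nattrans (id_functor one_cat))"
    using pull_adjunction[OF \<tau>] funct.src_tgt[OF pull[of "point P t"]] P tP by (intro adjI) simp_all
  note [simp] = R.univ_from_arr[OF w]
  have "FO (Pull D (point P t)) (FO (Pull D (to_one P)) B) = B"
    using counit.cpt(2)[of B] by (simp add: Pull2_id_one)
  then show ?thesis
    using transpose_iso_iff[of w W B] w by (simp add: Pull2_id_one)
qed

lemma iso_at_initial: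
  assumes P: "P \<in> Dia" and t: "initial P t" and w: "univ_to (Pull D (to_one P)) W B w"
  shows "is_iso (Val D one_cat) (FA (Pull D (point P t)) w)"
proof -
  have tP: "t \<in> Obj P" using t by (simp add: initial_def)
  obtain \<tau> where \<tau>: "adjunction (point P t) (to_one P) (id_nattrans (id_functor one_cat)) \<tau>"
    using initial_adjunction[OF is_category[OF P] t] .
  interpret adj "Val D one_cat" "Val D P" "Pull D (to_one P)" "Pull D (point P t)"
      "Pull2 D (id_nattrans (id_functor one_cat))" "Pull2 D \<tau>"
    using pull_adjunction[OF \<tau>] funct.src_tgt[OF pull[of "to_one P"]] P tP by (intro adjI) simp_all
  note [simp] = L.univ_to_arr[OF w]
  have "FO (Pull D (point P t)) (FO (Pull D (to_one P)) B) = B"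
    using unit.cpt(3)[of B] by (simp add: Pull2_id_one)
  then show ?thesis
    using cotranspose_iso_iff[of w W B] w by (simp add: Pull2_id_one)
qed

lemma cell_at_point:
  assumes c: "dia_nattrans Dia c" and src: "Src (NSrc c) = P" "Tgt (NSrc c) = Q"
    and t: "t \<in> Obj P" and k: "k \<in> Obj Q" and ck: "NC c t = Ide Q k" and A: "A \<in> Obj (Val D Q)"
  shows "FA (Pull D (point P t)) (NC (Pull2 D c) A) = Ide (Val D one_cat) (FO (Pull D (point Q k)) A)"
proof -
  note par = dia_nattrans_parallel[OF c]
  have PQ: "P \<in> Dia" "Q \<in> Dia" using par(2) src by auto
  obtain F G where "nattr P Q F G c" using par(1) src is_nattrans_nattr by blast
  then interpret c: nattr P Q F G c .
  have [simp]: "FO F t = k" "FO G t = k"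
    using c.cpt(2,3)[OF t] ck k c.S.cod.obj_simps(4,5)[OF k] by simp_all
  have pt: "funct one_cat P (point P t)" "funct one_cat Q (point Q k)"
    using t k by (auto intro!: funct_point c.S.dom.category_axioms c.S.cod.category_axioms)
  have "c \<rhd> point P t = id_nattrans (point Q k)"
    using nattr_whisker_right[OF c.nattr_axioms pt(1)] nattr_id[OF pt(2)] ck
    by (intro nattrans_eqI[of one_cat Q "point Q k" "point Q k"])
      (simp_all add: comp_point[OF c.S.funct_axioms t] comp_point[OF c.T.funct_axioms t])
  then have "Pull D (point P t) \<lhd> Pull2 D c = id_nattrans (Pull D (point Q k))"
    using pull2_whisker_right[of "point P t" c] pull2_id[of "point Q k"] c src PQ t k by simp
  moreover interpret funct "Val D Q" "Val D one_cat" "Pull D (point Q k)"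
    using pull[of "point Q k"] PQ k by simp
  interpret Dc: nattr "Val D Q" "Val D P" "Pull D F" "Pull D G" "Pull2 D c"
    using pull2[OF c] src by simp
  show ?thesis
    using arg_cong[OF calculation, of "\<lambda>n. NC n A"] A by simp
qed

text \<open>
  Left Kan extension along the inclusion of a sieve does not change the values on the sieve. At an
  object \<open>k\<close> of the sieve, the axiom on slices computes the value as a left Kan extension along
  \<open>P \<rightarrow> e\<close>, where \<open>P\<close> is the slice over \<open>k\<close>. The slice has the terminal object \<open>(k, id)\<close>, at which
  the 2-cell of the slice is an identity, so that \<open>iso_at_terminal\<close> speaks about \<open>h\<close> at \<open>k\<close>.
\<close>

lemma sieve_unit_iso:
  assumes D: "der2 Dia D" "der3R Dia D" "der4R Dia D"
    and Q: "Q \<in> Dia" and J: "full_subcat Q T \<in> Dia"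
    and sieve: "\<And>f. f \<in> Arr Q \<Longrightarrow> Cod Q f \<in> T \<Longrightarrow> Dom Q f \<in> T"
    and h: "univ_from (Pull D (full_incl Q T)) Y A h"
  shows "is_iso (Val D (full_subcat Q T)) h"
proof -
  let ?u = "full_incl Q T" and ?J = "full_subcat Q T"
  interpret Q: category Q using Q by (rule is_category)
  interpret u: funct ?J Q ?u by (rule funct_full_incl[OF Q.category_axioms])
  have du: "dia_functor Dia ?u" using Q J by (simp add: dia_functorI)
  interpret Du: funct "Val D Q" "Val D ?J" "Pull D ?u" using pull[OF du] by simp
  note [simp] = Du.univ_from_arr[OF h]
  have "is_iso (Val D one_cat) (FA (Pull D (point ?J k)) h)" if k: "k \<in> Obj ?J" for k
  proof -
    have kQ: "k \<in> Obj Q" "k \<in> T" "k \<in> Obj (Tgt ?u)" using k by auto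
    have sl: "slice_cat ?u k = slice_cat (id_functor Q) k"
      by (rule slice_of_sieve[OF Q.category_axioms kQ(1,2) sieve])
    obtain P \<phi> where P: "P \<in> Dia" and \<phi>: "cat_iso_between \<phi> P (slice_cat ?u k)"
      using slices[OF Q kQ(1)] unfolding has_copy_def sl by blast
    have fin: "terminal (slice_cat ?u k) (k, Ide Q k)" using Q.slice_terminal[OF kQ(1)] sl by simp
    then obtain t where t: "t \<in> Obj P" "FO \<phi> t = (k, Ide Q k)" "terminal P t"
      using cat_iso_lift_obj[OF \<phi>] terminal_cat_iso[OF \<phi>] unfolding terminal_def by metis
    let ?pr = "slice_pr ?u k \<phi>" and ?c = "slice_cell ?u k \<phi>" and ?t = "point P t"
    interpret \<phi>: funct P "slice_cat ?u k" \<phi> using \<phi> by (rule cat_iso_funct)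
    interpret left_square Dia D ?u "to_one P" ?pr "point Q k" ?c
      using slice_square[OF du kQ(3) P \<phi>] by simp
    interpret Dc: nattr "Val D Q" "Val D P" "Pull D ?pr \<circ>\<^sub>F Pull D ?u" "Pull D (to_one P) \<circ>\<^sub>F Pull D (point Q k)"
        "Pull2 D ?c"
      using pull2_cell by simp
    interpret Dpr: funct "Val D ?J" "Val D P" "Pull D ?pr" using pull[OF dia(3)] by simp
    interpret Dt: funct "Val D P" "Val D one_cat" "Pull D ?t" using pull[of ?t] P t by simp
    let ?w = "NC (Pull2 D ?c) A \<cdot>\<^bsub>Val D P\<^esub> FA (Pull D ?pr) h"
    have "base_change_from ?u (to_one P) ?pr (point Q k) ?c"
      using D(3) du kQ P \<phi> unfolding der4R_iff[OF D(2)] by (metis full_incl_simps(2))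
    then have "univ_from (Pull D (to_one P)) (FO (Pull D ?pr) Y) (FO (Pull D (point Q k)) A) ?w"
      using h unfolding base_change_from_def by simp
    then have "is_iso (Val D one_cat) (FA (Pull D ?t) ?w)"
      by (rule iso_at_terminal[OF P t(3)])
    moreover have "FA (Pull D ?t) (NC (Pull2 D ?c) A) = Ide (Val D one_cat) (FO (Pull D (point Q k)) A)"
      using cell_at_point[OF cell _ _ t(1) kQ(1)] t by (simp add: ends slice_cell_def cat_iso_between_def)
    moreover have "FO ?pr t = k"
      using t(1,2) fin unfolding terminal_def by (simp add: slice_pr_def comma_proj_def)
    then have "?pr \<circ>\<^sub>F ?t = point ?J k"
      using comp_point[OF dia_funct[OF dia(3)], of t] t(1) by simp
    then have pt: "Pull D (point ?J k) = Pull D ?t \<circ>\<^sub>F Pull D ?pr"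
      using pull_comp[of ?t ?pr] P t(1) by simp
    moreover have "?u \<circ>\<^sub>F point ?J k = point Q k"
      using comp_point[OF u.funct_axioms k] kQ by simp
    then have "Pull D (point Q k) = Pull D (point ?J k) \<circ>\<^sub>F Pull D ?u"
      using pull_comp[of "point ?J k" ?u] du k J by simp
    then have "FO (Pull D (point Q k)) A = Cod (Val D one_cat) (FA (Pull D ?t) (FA (Pull D ?pr) h))"
      by (simp add: pt)
    ultimately show ?thesis by simp
  qed
  then show ?thesis using D(1) J unfolding der2_def by simp
qed

lemma cosieve_counit_iso:
  assumes D: "der2 Dia D" "der3L Dia D" "der4L Dia D"
    and Q: "Q \<in> Dia" and J: "full_subcat Q T \<in> Dia"
    and cosieve: "\<And>f. f \<in> Arr Q \<Longrightarrow> Dom Q f \<in> T \<Longrightarrow> Cod Q f \<in> T"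
    and h: "univ_to (Pull D (full_incl Q T)) Y A h"
  shows "is_iso (Val D (full_subcat Q T)) h"
proof -
  let ?u = "full_incl Q T" and ?J = "full_subcat Q T"
  interpret Q: category Q using Q by (rule is_category)
  interpret u: funct ?J Q ?u by (rule funct_full_incl[OF Q.category_axioms])
  have du: "dia_functor Dia ?u" using Q J by (simp add: dia_functorI)
  interpret Du: funct "Val D Q" "Val D ?J" "Pull D ?u" using pull[OF du] by simp
  note [simp] = Du.univ_to_arr[OF h]
  have "is_iso (Val D one_cat) (FA (Pull D (point ?J k)) h)" if k: "k \<in> Obj ?J" for k
  proof -
    have kQ: "k \<in> Obj Q" "k \<in> T" "k \<in> Obj (Tgt ?u)" using k by auto
    have sl: "coslice_cat ?u k = coslice_cat (id_functor Q) k"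
      by (rule coslice_of_cosieve[OF Q.category_axioms kQ(1,2) cosieve])
    obtain P \<phi> where P: "P \<in> Dia" and \<phi>: "cat_iso_between \<phi> P (coslice_cat ?u k)"
      using coslices[OF Q kQ(1)] unfolding has_copy_def sl by blast
    have init: "initial (coslice_cat ?u k) (k, Ide Q k)" using Q.coslice_initial[OF kQ(1)] sl by simp
    then obtain t where t: "t \<in> Obj P" "FO \<phi> t = (k, Ide Q k)" "initial P t"
      using cat_iso_lift_obj[OF \<phi>] initial_cat_iso[OF \<phi>] unfolding initial_def by metis
    let ?pr = "coslice_pr ?u k \<phi>" and ?c = "coslice_cell ?u k \<phi>" and ?t = "point P t"
    interpret \<phi>: funct P "coslice_cat ?u k" \<phi> using \<phi> by (rule cat_iso_funct)
    interpret right_square Dia D ?u "to_one P" ?pr "point Q k" ?c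
      using coslice_square[OF du kQ(3) P \<phi>] by simp
    interpret Dc: nattr "Val D Q" "Val D P" "Pull D (to_one P) \<circ>\<^sub>F Pull D (point Q k)" "Pull D ?pr \<circ>\<^sub>F Pull D ?u"
        "Pull2 D ?c"
      using pull2_cell by simp
    interpret Dpr: funct "Val D ?J" "Val D P" "Pull D ?pr" using pull[OF dia(3)] by simp
    interpret Dt: funct "Val D P" "Val D one_cat" "Pull D ?t" using pull[of ?t] P t by simp
    let ?w = "FA (Pull D ?pr) h \<cdot>\<^bsub>Val D P\<^esub> NC (Pull2 D ?c) A"
    have "base_change_to ?u (to_one P) ?pr (point Q k) ?c"
      using D(3) du kQ P \<phi> unfolding der4L_iff[OF D(2)] by (metis full_incl_simps(2))
    then have "univ_to (Pull D (to_one P)) (FO (Pull D ?pr) Y) (FO (Pull D (point Q k)) A) ?w"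
      using h unfolding base_change_to_def by simp
    then have "is_iso (Val D one_cat) (FA (Pull D ?t) ?w)"
      by (rule iso_at_initial[OF P t(3)])
    moreover have "FA (Pull D ?t) (NC (Pull2 D ?c) A) = Ide (Val D one_cat) (FO (Pull D (point Q k)) A)"
      using cell_at_point[OF cell _ _ t(1) kQ(1)] t by (simp add: ends coslice_cell_def cat_iso_between_def)
    moreover have "FO ?pr t = k"
      using t(1,2) init unfolding initial_def by (simp add: coslice_pr_def comma_proj_def)
    then have "?pr \<circ>\<^sub>F ?t = point ?J k"
      using comp_point[OF dia_funct[OF dia(3)], of t] t(1) by simp
    then have pt: "Pull D (point ?J k) = Pull D ?t \<circ>\<^sub>F Pull D ?pr"
      using pull_comp[of ?t ?pr] P t(1) by simp
    moreover have "?u \<circ>\<^sub>F point ?J k = point Q k"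
      using comp_point[OF u.funct_axioms k] kQ by simp
    then have "Pull D (point Q k) = Pull D (point ?J k) \<circ>\<^sub>F Pull D ?u"
      using pull_comp[of "point ?J k" ?u] du k J by simp
    then have "FO (Pull D (point Q k)) A = Dom (Val D one_cat) (FA (Pull D ?t) (FA (Pull D ?pr) h))"
      by (simp add: pt)
    ultimately show ?thesis by simp
  qed
  then show ?thesis using D(1) J unfolding der2_def by simp
qed

end

section \<open>Cocartesian and cartesian squares\<close>

locale square_copy = diagram_category Dia
  for Dia :: "'u small_cat set" and Q :: "'u small_cat" and
    \<phi> :: "('u, 'u, bool \<times> bool, (bool \<times> bool) \<times> (bool \<times> bool)) fnct" +
  assumes Q: "Q \<in> Dia" and iso: "cat_iso_between \<phi> Q square_cat"
begin

sublocale \<phi>: funct Q square_cat \<phi> using iso by (rule cat_iso_funct)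

lemma FA_square: "f \<in> Arr Q \<Longrightarrow> FA \<phi> f = (FO \<phi> (Dom Q f), FO \<phi> (Cod Q f))"
  using \<phi>.arr(2,3)[of f] by (cases "FA \<phi> f") (simp add: square_cat_def)

lemma square_le:
  "f \<in> Arr Q \<Longrightarrow> fst (FO \<phi> (Dom Q f)) \<le> fst (FO \<phi> (Cod Q f)) \<and> snd (FO \<phi> (Dom Q f)) \<le> snd (FO \<phi> (Cod Q f))"
proof -
  assume f: "f \<in> Arr Q"
  have "(FO \<phi> (Dom Q f), FO \<phi> (Cod Q f)) \<in> Arr square_cat"
    using \<phi>.arr(1)[OF f] FA_square[OF f] by simp
  then show ?thesis by (simp add: square_cat_def)
qed

text \<open>
  The copy of the square and its full subcategories are finite posets.
\<close>

lemma full_subcat_in_Dia: "full_subcat Q T \<in> Dia"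
proof (rule finite_posets)
  have inj: "inj_on (FO \<phi>) (Obj Q)" "inj_on (FA \<phi>) (Arr Q)"
    using iso by (auto simp: cat_iso_between_def is_cat_iso_def bij_betw_def)
  have "finite (Obj Q)" by (rule finite_imageD[OF _ inj(1)]) (rule finite)
  moreover have "f = g" if "f \<in> hom Q x y" "g \<in> hom Q x y" for f g x y
    using inj_onD[OF inj(2), of f g] that FA_square[of f] FA_square[of g] by simp
  moreover have "x = y" if "f \<in> hom Q x y" "g \<in> hom Q y x" for f g x y
  proof -
    have "FO \<phi> x = FO \<phi> y"
      using square_le[of f] square_le[of g] that by (auto intro!: prod_eqI)
    then show ?thesis using inj_onD[OF inj(1), of x y] that \<phi>.dom.obj_simps by auto
  qed
  ultimately show "finite_poset (full_subcat Q T)"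
    using funct_full_incl[OF \<phi>.dom.category_axioms, of T]
    unfolding finite_poset_def funct_def in_hom full_subcat_simps by blast
qed

lemma dia_full_incl: "dia_functor Dia (full_incl Q T)"
  using funct.is_functor[OF funct_full_incl[OF \<phi>.dom.category_axioms]] full_subcat_in_Dia Q
  by (simp add: dia_functor_def)

lemma ul_sieve: "f \<in> Arr Q \<Longrightarrow> FO \<phi> (Cod Q f) \<noteq> (True, True) \<Longrightarrow> FO \<phi> (Dom Q f) \<noteq> (True, True)"
  using square_le[of f] by (cases "FO \<phi> (Cod Q f)") auto

lemma lr_cosieve: "f \<in> Arr Q \<Longrightarrow> FO \<phi> (Dom Q f) \<noteq> (False, False) \<Longrightarrow> FO \<phi> (Cod Q f) \<noteq> (False, False)"
  using square_le[of f] by (cases "FO \<phi> (Dom Q f)") auto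

lemma cocartesian_iff:
  assumes "dia_prederivator Dia E" "der3R Dia E"
  shows "cocartesian E Q \<phi> X \<longleftrightarrow> (\<exists>Y h. univ_from (Pull E (ul_incl Q \<phi>)) Y X h)"
proof -
  interpret E: dia_prederivator Dia E by fact
  have u: "dia_functor Dia (ul_incl Q \<phi>)" unfolding ul_incl_def by (rule dia_full_incl)
  have *: "X \<in> ess_image L \<longleftrightarrow> (\<exists>Y h. univ_from (Pull E (ul_incl Q \<phi>)) Y X h)"
    if "adjunction L (Pull E (ul_incl Q \<phi>)) \<eta> \<epsilon>" for L \<eta> \<epsilon>
    by (rule adj.ess_image_iff[OF adjI[OF that refl refl]])
  moreover have "\<exists>L \<eta> \<epsilon>. adjunction L (Pull E (ul_incl Q \<phi>)) \<eta> \<epsilon>"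
    using assms(2) u unfolding der3R_def by blast
  ultimately show ?thesis unfolding cocartesian_def by blast
qed

lemma cartesian_iff:
  assumes "dia_prederivator Dia E" "der3L Dia E"
  shows "cartesian E Q \<phi> X \<longleftrightarrow> (\<exists>Y e. univ_to (Pull E (lr_incl Q \<phi>)) Y X e)"
proof -
  interpret E: dia_prederivator Dia E by fact
  have u: "dia_functor Dia (lr_incl Q \<phi>)" unfolding lr_incl_def by (rule dia_full_incl)
  have *: "X \<in> ess_image R \<longleftrightarrow> (\<exists>Y e. univ_to (Pull E (lr_incl Q \<phi>)) Y X e)"
    if "adjunction (Pull E (lr_incl Q \<phi>)) R \<eta> \<epsilon>" for R \<eta> \<epsilon>
    by (rule adj.ess_image_right_iff[OF adjI[OF that refl refl]])
  moreover have "\<exists>R \<eta> \<epsilon>. adjunction (Pull E (lr_incl Q \<phi>)) R \<eta> \<epsilon>"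
    using assms(2) u unfolding der3L_def by blast
  ultimately show ?thesis unfolding cartesian_def by blast
qed

end

context cocontinuous_derivator_monad
begin

text \<open>
  The point is to find a module over the corner with a universal arrow, given merely an object of the
  underlying derivator with a universal arrow \<open>h\<close>. Since \<open>h\<close> is invertible, the identity of the
  restriction of \<open>X\<close> is universal as well, and it is linear.
\<close>

lemma cocartesian_N_iff:
  assumes Q: "Q \<in> Dia" and \<phi>: "cat_iso_between \<phi> Q square_cat" and X: "X \<in> Obj (Val N Q)"
  shows "cocartesian N Q \<phi> X \<longleftrightarrow> cocartesian D Q \<phi> (fst X)"
proof -
  interpret square_copy Dia Q \<phi> by unfold_locales (fact Q, fact \<phi>)
  let ?T = "{q. FO \<phi> q \<noteq> (True, True)}"
  let ?u = "full_incl Q ?T" and ?J = "full_subcat Q ?T"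
  have u: "dia_functor Dia ?u" by (rule dia_full_incl)
  interpret u: cocontinuous_restriction D M \<mu> S "?u" "?J" Q
    using cocontinuous_restriction_along[OF u] by simp
  have P: "Pull N ?u = u.lift" using Pull_N[OF u] by simp
  have X': "X \<in> Obj u.M.Mods" using X by simp
  have ex: "\<exists>B h. univ_from (Pull D ?u) Y B h" if "Y \<in> Obj (Val D ?J)" for Y
    using ex_univ_from[OF u] that by simp
  have "(\<exists>Y t. univ_from u.lift Y X t) \<longleftrightarrow> (\<exists>Y h. univ_from (Pull D ?u) Y (fst X) h)"
  proof
    assume "\<exists>Y t. univ_from u.lift Y X t"
    then show "\<exists>Y h. univ_from (Pull D ?u) Y (fst X) h"
      by (elim exE) (rule u.univ_from_underlying[OF ex], blast+)
  next
    assume "\<exists>Y h. univ_from (Pull D ?u) Y (fst X) h"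
    then obtain Y h where h: "univ_from (Pull D ?u) Y (fst X) h" by blast
    \<comment> \<open>Since \<open>h\<close> is invertible, its source may be replaced by a module.\<close>
    have i: "is_iso (Val D ?J) h"
      by (rule sieve_unit_iso[OF der(2,4,6) Q full_subcat_in_Dia _ h]) (use ul_sieve in auto)
    let ?Y = "lift_obj (Val D ?J) (Pull D ?u) (Gam M ?u) X" and ?id = "Ide (Val D ?J) (FO (Pull D ?u) (fst X))"
    have "univ_from (Pull D ?u) (FO (Pull D ?u) (fst X)) (fst X) (h \<cdot>\<^bsub>Val D ?J\<^esub> inv_arr (Val D ?J) h)"
      by (rule u.F.univ_from_precomp_iso[OF h]) (use i u.F.univ_from_arr[OF h] in auto)
    then have "univ_from (Pull D ?u) (fst ?Y) (fst X) ?id"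
      using i u.F.univ_from_arr[OF h] by simp
    moreover have "(?Y, ?id, ?Y) \<in> Arr u.M'.Mods"
      using u.M'.Mods.obj_simps(3)[OF u.lift_obj[OF X']] by simp
    ultimately show "\<exists>Y t. univ_from u.lift Y X t"
      using u.univ_from_lift[OF _ X'] by blast
  qed
  then show ?thesis
    using cocartesian_iff[OF dia_prederivator_N der3R_N] cocartesian_iff[OF dia_prederivator_axioms der(4)]
    by (simp add: ul_incl_def P)
qed

lemma cartesian_N_iff:
  assumes Q: "Q \<in> Dia" and \<phi>: "cat_iso_between \<phi> Q square_cat" and X: "X \<in> Obj (Val N Q)"
  shows "cartesian N Q \<phi> X \<longleftrightarrow> cartesian D Q \<phi> (fst X)"
proof -
  interpret square_copy Dia Q \<phi> by unfold_locales (fact Q, fact \<phi>)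
  let ?T = "{q. FO \<phi> q \<noteq> (False, False)}"
  let ?u = "full_incl Q ?T" and ?J = "full_subcat Q ?T"
  have u: "dia_functor Dia ?u" by (rule dia_full_incl)
  interpret u: restriction D M \<mu> S "?u" "?J" Q
    using restriction_along[OF u] by simp
  have P: "Pull N ?u = u.lift" using Pull_N[OF u] by simp
  have X': "X \<in> Obj u.M.Mods" using X by simp
  have ex: "\<exists>B e. univ_to (Pull D ?u) Y B e" if "Y \<in> Obj (Val D ?J)" for Y
    using ex_univ_to[OF u] that by simp
  have "(\<exists>Y t. univ_to u.lift Y X t) \<longleftrightarrow> (\<exists>Y e. univ_to (Pull D ?u) Y (fst X) e)"
  proof
    assume "\<exists>Y t. univ_to u.lift Y X t"
    then show "\<exists>Y e. univ_to (Pull D ?u) Y (fst X) e"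
      by (elim exE) (rule u.univ_to_underlying[OF ex], blast+)
  next
    assume "\<exists>Y e. univ_to (Pull D ?u) Y (fst X) e"
    then obtain Y e where e: "univ_to (Pull D ?u) Y (fst X) e" by blast
    have i: "is_iso (Val D ?J) e"
      by (rule cosieve_counit_iso[OF der(2,3,5) Q full_subcat_in_Dia _ e]) (use lr_cosieve in auto)
    let ?Y = "lift_obj (Val D ?J) (Pull D ?u) (Gam M ?u) X" and ?id = "Ide (Val D ?J) (FO (Pull D ?u) (fst X))"
    have "univ_to (Pull D ?u) (FO (Pull D ?u) (fst X)) (fst X) (inv_arr (Val D ?J) e \<cdot>\<^bsub>Val D ?J\<^esub> e)"
      by (rule u.F.univ_to_postcomp_iso[OF e]) (use i u.F.univ_to_arr[OF e] in auto)
    then have "univ_to (Pull D ?u) (fst ?Y) (fst X) ?id"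
      using i u.F.univ_to_arr[OF e] by simp
    moreover have "(?Y, ?id, ?Y) \<in> Arr u.M'.Mods"
      using u.M'.Mods.obj_simps(3)[OF u.lift_obj[OF X']] by simp
    ultimately show "\<exists>Y t. univ_to u.lift Y X t"
      using u.univ_to_lift[OF _ X'] by blast
  qed
  then show ?thesis
    using cartesian_iff[OF dia_prederivator_N der3L_N] cartesian_iff[OF dia_prederivator_axioms der(3)]
    by (simp add: lr_incl_def P)
qed

end

theorem proposition6p3:
  fixes Dia :: "'u small_cat set"
    and D :: "('u, 'o, 'a) prederivator"
    and M :: "('u, 'o, 'a, 'o, 'a) pder_map"
    and \<mu> S :: "('u, 'o, 'a, 'o, 'a) pder_2cell"
  assumes "diagram_category Dia"
    and "stable_derivator Dia D"
    and "monad_on Dia D M \<mu> S"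
    and "cocontinuous Dia D M"
  shows "stable_derivator Dia (module_prederivator D M \<mu> S)"
proof -
  have D: "derivator Dia D" "pointed Dia D"
    and sq: "\<And>Q \<phi> X. \<lbrakk>Q \<in> Dia; cat_iso_between \<phi> Q square_cat; X \<in> Obj (Val D Q)\<rbrakk>
      \<Longrightarrow> cocartesian D Q \<phi> X \<longleftrightarrow> cartesian D Q \<phi> X"
    using assms(2) unfolding stable_derivator_def by blast+
  interpret cocontinuous_derivator_monad Dia D M \<mu> S
    using assms D(1) by (intro cocontinuous_derivator_monad.intro prederivator_monad.intro dia_prederivator.intro
        prederivator_monad_axioms.intro cocontinuous_derivator_monad_axioms.intro) (simp_all add: derivator_def)
  have "cocartesian N Q \<phi> X \<longleftrightarrow> cartesian N Q \<phi> X"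
    if Q: "Q \<in> Dia" and \<phi>: "cat_iso_between \<phi> Q square_cat" and X: "X \<in> Obj (Val N Q)" for Q \<phi> X
  proof -
    interpret em_monad "Val D Q" "Cpt M Q" "\<mu> Q" "S Q" using Q by (rule monad_at)
    have "fst X \<in> Obj (Val D Q)" using X by simp
    then show ?thesis
      using sq[OF Q \<phi>] cocartesian_N_iff[OF Q \<phi> X] cartesian_N_iff[OF Q \<phi> X] by simp
  qed
  then show ?thesis
    using derivator_N pointed_N[OF D(2)] unfolding stable_derivator_def by blast
qed

end
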